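(* The moduli space $\mathcal{N}_6$ of metric $2$-step nilpotent Lie algebras of dimension $6$ is homeomorphic to a cone over a contractible $4$-dimensional simplicial complex. More precisely, $\mathcal{N}_6$ is homeomorphic to the (open) cone $\bigl(\mathcal{N}_6^0\times[0,\infty)\bigr)/\bigl(\mathcal{N}_6^0\times\{0\}\bigr)$ with the class of the abelian Lie algebra $\mathbb{R}^6$ corresponding to the peak, where $\mathcal{N}_6^0\subset\mathcal{N}_6$ is the subspace of classes of brackets $c$ with $\operatorname{Tr}(c^*c)=2$, and $\mathcal{N}_6^0$ is homeomorphic to a contractible simplicial complex of dimension $4$.
   Context: Let $\mathbb{R}^n$ carry its standard scalar product and $\Lambda^2\mathbb{R}^n$ the induced one (a fixed $\mathrm{O}(n)$-invariant scalar product; rescaling it is immaterial). Put $\widehat{\mathcal{N}}_n=\{c\in\operatorname{Hom}(\Lambda^2\mathbb{R}^n,\mathbb{R}^n)\mid c(c(u,v),w)=0\ \forall u,v,w\in\mathbb{R}^n\}$, with the subspace topology, where $c(u,v):=c(u\wedge v)$. This is the set of Lie brackets on $\mathbb{R}^n$ that are at most $2$-step nilpotent (the zero bracket, i.e. the abelian Lie algebra, is included). The group $\mathrm{O}(n)$ acts on it by $(T\cdot c)(u,v)=T\,c(T^{-1}u,T^{-1}v)$. The moduli space of metric $2$-step nilpotent Lie algebras of dimension $n$ is the quotient space $\mathcal{N}_n=\widehat{\mathcal{N}}_n/\mathrm{O}(n)$ with the quotient topology; its points are the isometric isomorphism classes of such Lie algebras endowed with a scalar product. $c^*$ denotes the adjoint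 of $c$. *)

theory Defs
  imports "HOL-Analysis.Analysis"
begin

section \<open>The exterior square\<close>

text \<open>
  \<open>\<Lambda>\<^sup>2 \<real>\<^sup>n\<close> is modelled as the Euclidean space of coordinates with respect to the vectors
  \<open>e\<^sub>i \<and> e\<^sub>j\<close>, \<open>i < j\<close>. Its standard scalar product is the one induced from \<open>\<real>\<^sup>n\<close>
  (see \<open>inner_wedge\<close> below). The sort \<open>card2\<close> (that is, \<open>n \<ge> 2\<close>) makes the index type nonempty.
\<close>

typedef (overloaded) ('n :: "{card2, linorder}") opair = "{p :: 'n \<times> 'n. fst p < snd p}"
proof -
  have "\<exists>i j :: 'n. i \<noteq> j"
    using one_less_card[where 'a = 'n] card_le_Suc0_iff_eq[of "UNIV :: 'n set"] by fastforce
  then obtain i j :: 'n where "i < j"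
    by (meson neqE)
  then show ?thesis
    by (intro exI[of _ "(i, j)"]) simp
qed

instance opair :: ("{card2, linorder}") finite
proof
  have "inj (Rep_opair :: 'a opair \<Rightarrow> _)"
    by (simp add: inj_on_def Rep_opair_inject)
  then show "finite (UNIV :: 'a opair set)"
    by (rule inj_on_finite[where B = UNIV]) (rule subset_UNIV, rule finite)
qed

type_synonym 'n euc = "real ^ 'n"
type_synonym 'n ext2 = "real ^ 'n opair"

definition wedge :: "('n :: {card2, linorder}) euc \<Rightarrow> 'n euc \<Rightarrow> 'n ext2"  (infixl \<open>\<and>\<^sub>\<Lambda>\<close> 70)
  where "u \<and>\<^sub>\<Lambda> v = (\<chi> p. case Rep_opair p of (i, j) \<Rightarrow> u $ i * v $ j - u $ j * v $ i)"

lemma inner_wedge: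
  fixes u v x y :: "('n :: {card2, linorder}) euc"
  shows "(u \<and>\<^sub>\<Lambda> v) \<bullet> (x \<and>\<^sub>\<Lambda> y) = (u \<bullet> x) * (v \<bullet> y) - (u \<bullet> y) * (v \<bullet> x)"
proof -
  define g where "g = (\<lambda>p :: 'n \<times> 'n.
    (u $ fst p * v $ snd p - u $ snd p * v $ fst p) * (x $ fst p * y $ snd p - x $ snd p * y $ fst p))"
  let ?L = "{p :: 'n \<times> 'n. fst p < snd p}" and ?G = "{p :: 'n \<times> 'n. snd p < fst p}"
    and ?D = "{p :: 'n \<times> 'n. fst p = snd p}"
  have bij: "bij_betw Rep_opair (UNIV :: 'n opair set) ?L"
    unfolding bij_betw_def
    by (simp add: type_definition.Rep_range[OF type_definition_opair] inj_on_def Rep_opair_inject)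
  have "(u \<and>\<^sub>\<Lambda> v) \<bullet> (x \<and>\<^sub>\<Lambda> y) = (\<Sum>q\<in>UNIV. g (Rep_opair q))"
    by (simp add: inner_vec_def wedge_def g_def case_prod_beta)
  also have "\<dots> = sum g ?L"
    by (rule sum.reindex_bij_betw[OF bij])
  finally have L: "(u \<and>\<^sub>\<Lambda> v) \<bullet> (x \<and>\<^sub>\<Lambda> y) = sum g ?L" .
  have G: "sum g ?G = sum g ?L"
    by (rule sum.reindex_bij_witness[of _ prod.swap prod.swap]) (auto simp: g_def algebra_simps)
  have D: "sum g ?D = 0"
    by (rule sum.neutral) (auto simp: g_def)
  have "sum g UNIV = sum g (?L \<union> (?G \<union> ?D))"
    by (rule arg_cong[where f = "sum g"]) auto
  also have "\<dots> = sum g ?L + (sum g ?G + sum g ?D)"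
    by (subst sum.union_disjoint; (subst sum.union_disjoint)?) auto
  finally have "2 * ((u \<and>\<^sub>\<Lambda> v) \<bullet> (x \<and>\<^sub>\<Lambda> y)) = sum g UNIV"
    using L G D by simp
  also have "\<dots> = (\<Sum>i\<in>UNIV. \<Sum>j\<in>UNIV. g (i, j))"
    unfolding UNIV_Times_UNIV[symmetric] by (simp add: sum.cartesian_product)
  also have "\<dots> = (\<Sum>i\<in>UNIV. \<Sum>j\<in>UNIV. (u $ i * x $ i) * (v $ j * y $ j))
      - (\<Sum>i\<in>UNIV. \<Sum>j\<in>UNIV. (u $ i * y $ i) * (v $ j * x $ j))
      - (\<Sum>i\<in>UNIV. \<Sum>j\<in>UNIV. (v $ i * x $ i) * (u $ j * y $ j))
      + (\<Sum>i\<in>UNIV. \<Sum>j\<in>UNIV. (v $ i * y $ i) * (u $ j * x $ j))"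
    by (simp add: g_def algebra_simps sum.distrib sum_subtractf)
  also have "\<dots> = 2 * ((u \<bullet> x) * (v \<bullet> y) - (u \<bullet> y) * (v \<bullet> x))"
    unfolding sum_product[symmetric] by (simp add: inner_vec_def mult.commute)
  finally show ?thesis
    by simp
qed


section \<open>Quotient spaces and open cones\<close>

text \<open>Meaningful if \<open>r\<close> is an equivalence relation on the points of \<open>X\<close>; the points of the
  quotient are the equivalence classes.\<close>

definition quotient_topology :: "'a topology \<Rightarrow> ('a \<times> 'a) set \<Rightarrow> 'a set topology"
  where "quotient_topology X r = topology (\<lambda>\<U>. \<U> \<subseteq> topspace X // r \<and> openin X (\<Union>\<U>))"

lemma openin_quotient_topology:
  assumes "equiv (topspace X) r"
  shows "openin (quotient_topology X r) \<U> \<longleftrightarrow> \<U> \<subseteq> topspace X // r \<and> openin X (\<Union>\<U>)"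
proof -
  have Int: "\<Union>(\<U> \<inter> \<V>) = \<Union>\<U> \<inter> \<Union>\<V>"
    if "\<U> \<subseteq> topspace X // r" "\<V> \<subseteq> topspace X // r" for \<U> \<V>
  proof (intro subset_antisym subsetI)
    fix x assume "x \<in> \<Union>\<U> \<inter> \<Union>\<V>"
    then obtain A B where AB: "A \<in> \<U>" "B \<in> \<V>" "x \<in> A" "x \<in> B"
      by blast
    then have "A = B"
      using that quotient_disj[OF assms, of A B] by blast
    then show "x \<in> \<Union>(\<U> \<inter> \<V>)"
      using AB by blast
  qed blast
  have "istopology (\<lambda>\<U>. \<U> \<subseteq> topspace X // r \<and> openin X (\<Union>\<U>))"
    unfolding istopology_def
  proof (intro conjI allI impI)
    fix \<K> assume *: "\<forall>K\<in>\<K>. K \<subseteq> topspace X // r \<and> openin X (\<Union>K)"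
    show "\<Union>\<K> \<subseteq> topspace X // r"
      using * by blast
    have "\<Union>(\<Union>\<K>) = \<Union>((\<lambda>K. \<Union>K) ` \<K>)"
      by blast
    then show "openin X (\<Union>(\<Union>\<K>))"
      using * by auto
  qed (auto simp: Int)
  then show ?thesis
    by (simp add: quotient_topology_def topology_inverse')
qed

text \<open>The space \<open>(X \<times> [0,\<infinity>)) / (X \<times> {0})\<close>.\<close>

definition collapse_rel :: "'a set \<Rightarrow> 'a set \<Rightarrow> ('a \<times> 'a) set"
  where "collapse_rel S A = Id_on S \<union> A \<times> A"

definition open_cone :: "'a topology \<Rightarrow> ('a \<times> real) set topology"
  where "open_cone X = quotient_topology (prod_topology X (top_of_set {0..}))
           (collapse_rel (topspace X \<times> {0..}) (topspace X \<times> {0}))"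

definition cone_peak :: "'a topology \<Rightarrow> ('a \<times> real) set"
  where "cone_peak X = topspace X \<times> {0}"

lemma equiv_collapse_rel: "A \<subseteq> S \<Longrightarrow> equiv S (collapse_rel S A)"
  by (auto simp: equiv_def refl_on_def sym_def trans_def collapse_rel_def)


section \<open>The moduli space of metric 2-step nilpotent Lie algebras\<close>

text \<open>\<open>Hom(\<Lambda>\<^sup>2 \<real>\<^sup>n, \<real>\<^sup>n)\<close>: in finite dimension all linear maps are bounded and the operator norm
  induces the usual topology.\<close>

type_synonym 'n bracket = "'n ext2 \<Rightarrow>\<^sub>L 'n euc"

abbreviation br :: "('n :: {card2, linorder}) bracket \<Rightarrow> 'n euc \<Rightarrow> 'n euc \<Rightarrow> 'n euc"
  where "br c u v \<equiv> blinfun_apply c (u \<and>\<^sub>\<Lambda> v)"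

definition nil_brackets :: "('n :: {card2, linorder}) bracket set"
  where "nil_brackets = {c. \<forall>u v w. br c (br c u v) w = 0}"

text \<open>The orbit relation of the action \<open>(T \<cdot> c)(u, v) = T (c (T\<^sup>-\<^sup>1 u, T\<^sup>-\<^sup>1 v))\<close> of \<open>O(n)\<close>.\<close>

definition isometry_rel :: "(('n :: {card2, linorder}) bracket \<times> 'n bracket) set"
  where "isometry_rel = {(c, d). c \<in> nil_brackets \<and> d \<in> nil_brackets \<and>
    (\<exists>T. orthogonal_transformation T \<and> (\<forall>u v. br d u v = T (br c (inv T u) (inv T v))))}"

lemma equiv_isometry_rel: "equiv (nil_brackets :: ('n :: {card2, linorder}) bracket set) isometry_rel"
  (is "equiv ?N ?R")
proof (rule equivI)
  show "?R \<subseteq> ?N \<times> ?N"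
    by (auto simp: isometry_rel_def)
  have "orthogonal_transformation (id :: 'n euc \<Rightarrow> 'n euc)"
    by (simp add: id_def)
  then have "(c, c) \<in> isometry_rel" if "c \<in> nil_brackets" for c :: "'n bracket"
    unfolding isometry_rel_def mem_Collect_eq prod.case
    by (intro conjI that exI[of _ id]) simp_all
  then show "refl_on ?N ?R"
    by (blast intro: refl_onI)
  show "sym ?R"
  proof (rule symI)
    fix c d :: "'n bracket" assume "(c, d) \<in> isometry_rel"
    then obtain T where T: "c \<in> nil_brackets" "d \<in> nil_brackets" "orthogonal_transformation T"
      "\<And>u v. br d u v = T (br c (inv T u) (inv T v))"
      by (auto simp: isometry_rel_def)
    have "bij T"
      using T(3) by (rule orthogonal_transformation_bij)
    then have "br c u v = inv T (br d (inv (inv T) u) (inv (inv T) v))" for u v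
      by (simp add: T(4) inv_inv_eq bij_is_inj)
    then show "(d, c) \<in> isometry_rel"
      unfolding isometry_rel_def mem_Collect_eq prod.case
      by (intro conjI T(1,2) exI[of _ "inv T"] orthogonal_transformation_inv[OF T(3)]) blast
  qed
  show "trans ?R"
  proof (rule transI)
    fix c d e :: "'n bracket" assume "(c, d) \<in> isometry_rel" "(d, e) \<in> isometry_rel"
    then obtain S T where ST: "c \<in> nil_brackets" "e \<in> nil_brackets"
      "orthogonal_transformation S" "\<And>u v. br d u v = S (br c (inv S u) (inv S v))"
      "orthogonal_transformation T" "\<And>u v. br e u v = T (br d (inv T u) (inv T v))"
      unfolding isometry_rel_def by blast
    have "inv (T \<circ> S) = inv S \<circ> inv T"
      using ST by (intro o_inv_distrib orthogonal_transformation_bij)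
    then have "br e u v = (T \<circ> S) (br c (inv (T \<circ> S) u) (inv (T \<circ> S) v))" for u v
      by (simp add: ST)
    then show "(c, e) \<in> isometry_rel"
      unfolding isometry_rel_def mem_Collect_eq prod.case
      by (intro conjI ST(1,2) exI[of _ "T \<circ> S"] orthogonal_transformation_compose[OF ST(5,3)]) blast
  qed
qed

definition moduli :: "('n :: {card2, linorder}) bracket set topology"
  where "moduli = quotient_topology (top_of_set nil_brackets) isometry_rel"

definition isometry_class :: "('n :: {card2, linorder}) bracket \<Rightarrow> 'n bracket set"
  where "isometry_class c = isometry_rel `` {c}"

definition moduli0 :: "('n :: {card2, linorder}) bracket set topology"
  where "moduli0 = subtopology moduli (isometry_class `
    {c \<in> nil_brackets. trace (matrix (adjoint (blinfun_apply c) \<circ> blinfun_apply c)) = 2})"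


section \<open>Simplicial complexes\<close>

text \<open>The library's \<open>simplicial_complex\<close> is a finite geometric complex; it contains the empty
  simplex, whose affine dimension is \<open>-1\<close>. Finiteness is no restriction for a compact space, and
  every finite complex of dimension \<open>d\<close> embeds linearly in \<open>\<real>\<^sup>m\<close> with \<open>m = 2d + 1\<close>, so
  \<open>\<real>\<^sup>9\<close> is a sufficiently large ambient space for \<open>d = 4\<close>.\<close>

definition complex_dim :: "'a :: euclidean_space set set \<Rightarrow> int"
  where "complex_dim \<C> = Max (aff_dim ` \<C>)"

end

theory Submission
  imports Defs
begin

text \<open>
  A bracket \<open>c\<close> with image of dimension at most two is a pair of 2-forms on \<open>\<real>\<^sup>4\<close>. Splitting them into self-dual and
  anti-self-dual parts gives two pairs of vectors in \<open>\<real>\<^sup>3\<close>, and up to \<open>SO(4)\<close> these are determined by their Gram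
  matrices \<open>P\<close>, \<open>Q\<close>. What remains is the action of \<open>O(2)\<close> on both matrices and the exchange of \<open>P\<close> and \<open>Q\<close>. Writing
  the traceless parts as complex numbers \<open>w\<close>, \<open>z\<close>, the \<open>O(2)\<close>-orbit of \<open>(P, Q)\<close> is given by \<open>p = tr P\<close>, \<open>q = tr Q\<close>,
  \<open>r = \<bar>w\<bar>\<close>, \<open>s = \<bar>z\<bar>\<close>, \<open>t = \<bar>w + z\<bar>\<close>, subject only to \<open>r \<le> p\<close>, \<open>s \<le> q\<close> and the triangle inequalities. The exchange acts
  as \<open>-1\<close> on \<open>(r - s, (p - r) - (q - s))\<close>, and folding this plane piecewise linearly turns the quotient into a cone over
  four 4-simplices. A bracket with three-dimensional image is given by its singular values \<open>a \<ge> b \<ge> h > 0\<close>; these contribute a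
  triangle, attached along the edge \<open>h = 0\<close>. All simplices share a vertex, so their union is starlike.

  These coordinates define an \<open>O(6)\<close>-invariant map onto a closed cone in \<open>\<real>\<^sup>9\<close> that separates orbits. Since \<open>O(6)\<close> is
  compact and \<open>Tr (c\<^sup>* c)\<close> is proper, it is a quotient map.
\<close>

text \<open>Two obstacles shape the proof. An isometry between two flat normal forms need respect
  neither the two distinguished axes nor the splitting of R^4, so invariance of the five numbers is
  not visible. It is read off the skew matrices J_a of the 2-forms <c(u, v), a>: the traces of J_a^2
  and J_a^4 give the sum and the product of the values P(a) and Q(a) of the two Gram forms. This
  fixes the unordered pair {P(a), Q(a)} for each a, and a fact on products of quadratic forms makes
  the matching uniform in a. Secondly, the normal form of a bracket is an arbitrary choice, so
  continuity of the coordinates is never proved on brackets. The normal forms make up one closed set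
  of parameters on which the coordinates are continuous and proper; both halves of the quotient
  property are then statements on closed images of closed sets. The coordinates are homogeneous of
  degree two in c, so that their sum can be Tr(c* c) / 2. This puts the classes with Tr(c* c) = 2 on
  the hyperplane where the sum is 1, which also carries the simplices.\<close>

lemma exhaust_6: fixes x::6 shows "x=0 \<or> x=1\<or>x=2\<or>x=3\<or>x=4\<or>x=5"
proof (induct x)
  case (of_int z)
  then have "0 \<le> z" "z < 6" by simp_all
  then have "z=0\<or>z=1\<or>z=2\<or>z=3\<or>z=4\<or>z=5" by arith
  then show ?case by auto
qed
lemma UNIV_6: "(UNIV::6 set) = {0,1,2,3,4,5}"
  using exhaust_6 by auto
lemma sum_6: "sum f (UNIV::6 set) = f 0 + f 1 + f 2 + f 3 + f 4 + f 5"
  unfolding UNIV_6 by (simp add: ac_simps)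
lemma forall_6: "(\<forall>i::6. P i) \<longleftrightarrow> P 0 \<and> P 1 \<and> P 2 \<and> P 3 \<and> P 4 \<and> P 5"
  by (metis exhaust_6)

section \<open>Brackets and alternating bilinear maps\<close>

text \<open>Turns sums over the coordinates of the exterior square into plain double sums, in which
  the order of the index type is invisible; every pair is then counted twice.\<close>

lemma sum_opair:
  fixes g :: "('n :: {card2, linorder}) \<Rightarrow> 'n \<Rightarrow> 'a :: real_vector"
  assumes sym: "\<And>i j. g i j = g j i" and diag: "\<And>i. g i i = 0"
  shows "2 *\<^sub>R (\<Sum>p\<in>UNIV. g (fst (Rep_opair p)) (snd (Rep_opair (p :: 'n opair))))
    = (\<Sum>i\<in>UNIV. \<Sum>j\<in>UNIV. g i j)"
proof -
  define h where "h = (\<lambda>p :: 'n \<times> 'n. g (fst p) (snd p))"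
  let ?L = "{p :: 'n \<times> 'n. fst p < snd p}" and ?G = "{p :: 'n \<times> 'n. snd p < fst p}"
    and ?D = "{p :: 'n \<times> 'n. fst p = snd p}"
  have bij: "bij_betw Rep_opair (UNIV :: 'n opair set) ?L"
    unfolding bij_betw_def
    by (simp add: type_definition.Rep_range[OF type_definition_opair] inj_on_def Rep_opair_inject)
  have L: "(\<Sum>p\<in>UNIV. h (Rep_opair p)) = sum h ?L"
    by (rule sum.reindex_bij_betw[OF bij])
  have G: "sum h ?G = sum h ?L"
    by (rule sum.reindex_bij_witness[of _ prod.swap prod.swap]) (auto simp: h_def sym)
  have D: "sum h ?D = 0"
    by (rule sum.neutral) (auto simp: h_def diag)
  have "sum h UNIV = sum h (?L \<union> (?G \<union> ?D))"
    by (rule arg_cong[where f = "sum h"]) auto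
  also have "\<dots> = sum h ?L + (sum h ?G + sum h ?D)"
    by (subst sum.union_disjoint; (subst sum.union_disjoint)?) auto
  finally have "2 *\<^sub>R sum h ?L = sum h UNIV"
    using G D by (simp add: scaleR_2)
  also have "\<dots> = (\<Sum>i\<in>UNIV. \<Sum>j\<in>UNIV. g i j)"
    unfolding UNIV_Times_UNIV[symmetric] by (simp add: sum.cartesian_product h_def case_prod_beta)
  finally show ?thesis
    using L by (simp add: h_def)
qed

lemma wedge_axis:
  fixes p :: "('n :: {card2, linorder}) opair"
  shows "axis (fst (Rep_opair p)) 1 \<and>\<^sub>\<Lambda> axis (snd (Rep_opair p)) 1 = axis p (1 :: real)"
proof -
  have *: "fst (Rep_opair q) < snd (Rep_opair q)" for q :: "'n opair"
    using Rep_opair[of q] by simp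
  have "Rep_opair q = Rep_opair p" if "fst (Rep_opair q) = fst (Rep_opair p)"
    "snd (Rep_opair q) = snd (Rep_opair p)" for q
    using that by (simp add: prod_eq_iff)
  then have **: "q = p" if "fst (Rep_opair q) = fst (Rep_opair p)"
    "snd (Rep_opair q) = snd (Rep_opair p)" for q
    using that by (metis Rep_opair_inverse)
  show ?thesis
    using * ** less_asym[OF * ]
    by (auto simp: wedge_def vec_eq_iff axis_def case_prod_beta) (metis * less_asym)+
qed

lemma bilinear_wedge: "bilinear (\<and>\<^sub>\<Lambda>)"
  by (auto intro!: linearI simp: bilinear_def wedge_def vec_eq_iff case_prod_beta algebra_simps)

lemma wedge_self [simp]: "u \<and>\<^sub>\<Lambda> u = 0"
  by (simp add: wedge_def vec_eq_iff case_prod_beta)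

lemma norm_wedge_le: "norm (u \<and>\<^sub>\<Lambda> v) \<le> norm u * norm v"
proof -
  have "(norm (u \<and>\<^sub>\<Lambda> v))\<^sup>2 = (u \<bullet> u) * (v \<bullet> v) - (u \<bullet> v)\<^sup>2"
    by (simp only: power2_norm_eq_inner inner_wedge) (simp add: power2_eq_square inner_commute)
  also have "\<dots> \<le> (norm u * norm v)\<^sup>2"
    by (simp add: power_mult_distrib power2_norm_eq_inner)
  finally show ?thesis
    by (rule power2_le_imp_le) simp
qed

lemma bilinear_br: "bilinear (br c)"
proof -
  have "linear (blinfun_apply c)"
    by (rule bounded_linear.linear[OF blinfun.bounded_linear_right])
  from linear_compose[OF _ this] have "linear f \<Longrightarrow> linear (\<lambda>x. blinfun_apply c (f x))" for f :: "'a euc \<Rightarrow> 'a ext2"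
    by (simp add: o_def)
  then show ?thesis
    using bilinear_wedge unfolding bilinear_def by blast
qed

lemma br_self [simp]: "br c u u = 0"
  by (simp add: blinfun.zero_right)

lemmas br_simps = bilinear_ladd[OF bilinear_br] bilinear_radd[OF bilinear_br]
  bilinear_lmul[OF bilinear_br] bilinear_rmul[OF bilinear_br]
  bilinear_lsub[OF bilinear_br] bilinear_rsub[OF bilinear_br]
  bilinear_lneg[OF bilinear_br] bilinear_rneg[OF bilinear_br]
  bilinear_lzero[OF bilinear_br] bilinear_rzero[OF bilinear_br]

lemma bilinear_alternating_skew:
  assumes "bilinear B" "\<And>u. B u u = 0" shows "B v u = - B u v"
proof -
  have "B (u + v) (u + v) = B u u + B u v + (B v u + B v v)"
    by (simp add: bilinear_ladd[OF assms(1)] bilinear_radd[OF assms(1)] del: assms(2))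
  then have "B u v + B v u = 0"
    by (simp add: assms(2))
  then show ?thesis
    by (simp add: eq_neg_iff_add_eq_0 add.commute)
qed

lemma br_skew: "br c v u = - br c u v"
  by (rule bilinear_alternating_skew[OF bilinear_br br_self])

lemma bracket_eqI:
  assumes "\<And>i j. br c (axis i 1) (axis j 1) = br d (axis i 1) (axis j 1)"
  shows "c = d"
proof (rule blinfun_euclidean_eqI)
  fix b :: "'a ext2" assume "b \<in> Basis"
  then obtain p where "b = axis p 1"
    by (auto simp: Basis_vec_def)
  then show "blinfun_apply c b = blinfun_apply d b"
    using assms by (simp flip: wedge_axis)
qed

definition bracket_of :: "(('n :: {card2, linorder}) euc \<Rightarrow> 'n euc \<Rightarrow> 'n euc) \<Rightarrow> 'n bracket"
  where "bracket_of B = Blinfun (\<lambda>\<omega>. \<Sum>p\<in>UNIV.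
    \<omega> $ p *\<^sub>R B (axis (fst (Rep_opair p)) 1) (axis (snd (Rep_opair p)) 1))"

lemma bracket_of_apply: "blinfun_apply (bracket_of B) \<omega> = (\<Sum>p\<in>UNIV.
    \<omega> $ p *\<^sub>R B (axis (fst (Rep_opair p)) 1) (axis (snd (Rep_opair p)) 1))"
  unfolding bracket_of_def
  by (subst bounded_linear_Blinfun_apply)
     (auto intro!: bounded_linear_sum bounded_linear_scaleR_left[THEN bounded_linear_compose] bounded_linear_vec_nth)

lemma bilinear_euc_expand:
  fixes B :: "'n :: finite euc \<Rightarrow> 'n euc \<Rightarrow> 'a :: real_vector"
  assumes "bilinear B"
  shows "B u v = (\<Sum>i\<in>UNIV. \<Sum>j\<in>UNIV. (u $ i * v $ j) *\<^sub>R B (axis i 1) (axis j 1))"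
proof -
  have "B u v = B (\<Sum>i\<in>UNIV. u $ i *\<^sub>R axis i 1) (\<Sum>j\<in>UNIV. v $ j *\<^sub>R axis j 1)"
    by (simp add: basis_expansion flip: scalar_mult_eq_scaleR)
  also have "\<dots> = (\<Sum>(i, j)\<in>UNIV \<times> UNIV. B (u $ i *\<^sub>R axis i 1) (v $ j *\<^sub>R axis j 1))"
    by (rule bilinear_sum[OF assms]) 
  also have "\<dots> = (\<Sum>i\<in>UNIV. \<Sum>j\<in>UNIV. (u $ i * v $ j) *\<^sub>R B (axis i 1) (axis j 1))"
    by (simp add: sum.cartesian_product bilinear_lmul[OF assms] bilinear_rmul[OF assms] mult.commute)
  finally show ?thesis .
qed

text \<open>The universal property of the exterior square. After doubling, the sum over ordered
  pairs becomes a full double sum whose two halves are \<open>B u v\<close> and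
  \<open>- B v u\<close>.\<close>

lemma br_bracket_of:
  assumes B: "bilinear B" "\<And>u. B u u = 0"
  shows "br (bracket_of B) u v = B u v"
proof -
  define g where "g = (\<lambda>i j. (u $ i * v $ j - u $ j * v $ i) *\<^sub>R B (axis i 1) (axis j 1))"
  have skew: "B v u = - B u v" for u v
    by (rule bilinear_alternating_skew[OF B])
  have "2 *\<^sub>R br (bracket_of B) u v = 2 *\<^sub>R (\<Sum>p\<in>UNIV. g (fst (Rep_opair p)) (snd (Rep_opair p)))"
    by (simp add: bracket_of_apply g_def wedge_def case_prod_beta)
  also have "\<dots> = (\<Sum>i\<in>UNIV. \<Sum>j\<in>UNIV. g i j)"
  proof (rule sum_opair)
    show "g i j = g j i" for i j
      unfolding g_def using skew[of "axis i 1" "axis j 1"] by (simp add: algebra_simps)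
  qed (simp add: g_def)
  also have "\<dots> = B u v - (\<Sum>i\<in>UNIV. \<Sum>j\<in>UNIV. (u $ j * v $ i) *\<^sub>R B (axis i 1) (axis j 1))"
    by (simp add: g_def scaleR_diff_left sum_subtractf bilinear_euc_expand[OF B(1), of u v])
  also have "(\<Sum>i\<in>UNIV. \<Sum>j\<in>UNIV. (u $ j * v $ i) *\<^sub>R B (axis i 1) (axis j 1)) = B v u"
    by (simp add: bilinear_euc_expand[OF B(1), of v u] mult.commute)
  finally have "2 *\<^sub>R br (bracket_of B) u v = 2 *\<^sub>R B u v"
    using skew[of v u] by (simp add: scaleR_2)
  then show ?thesis
    by simp
qed

text \<open>The trace is the squared Hilbert-Schmidt norm on the basis of wedges of axes. Running
  over all index pairs costs the factor 2, but lets each argument be moved to another orthonormal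
  frame separately later on.\<close>

lemma trace_adjoint_bracket:
  fixes c :: "('n :: {card2, linorder}) bracket"
  shows "2 * trace (matrix (adjoint (blinfun_apply c) \<circ> blinfun_apply c))
    = (\<Sum>i\<in>UNIV. \<Sum>j\<in>UNIV. (norm (br c (axis i 1) (axis j 1)))\<^sup>2)"
proof -
  have lin: "linear (blinfun_apply c)"
    by (rule bounded_linear.linear[OF blinfun.bounded_linear_right])
  have "trace (matrix (adjoint (blinfun_apply c) \<circ> blinfun_apply c))
      = (\<Sum>p\<in>UNIV. axis p 1 \<bullet> adjoint (blinfun_apply c) (blinfun_apply c (axis p 1)))"
    by (simp add: trace_def matrix_def inner_axis')
  also have "\<dots> = (\<Sum>p\<in>UNIV. (norm (blinfun_apply c (axis p 1)))\<^sup>2)"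
    by (simp add: adjoint_works[OF lin] power2_norm_eq_inner)
  also have "\<dots> = (\<Sum>p\<in>UNIV. (norm (br c (axis (fst (Rep_opair p)) 1) (axis (snd (Rep_opair p)) 1)))\<^sup>2)"
    by (simp add: wedge_axis)
  finally have "2 * trace (matrix (adjoint (blinfun_apply c) \<circ> blinfun_apply c)) = 2 *\<^sub>R \<dots>"
    by simp
  also have "\<dots> = (\<Sum>i\<in>UNIV. \<Sum>j\<in>UNIV. (norm (br c (axis i 1) (axis j 1)))\<^sup>2)"
    by (rule sum_opair) (metis br_skew norm_minus_cancel, simp)
  finally show ?thesis .
qed

lemma isometry_relI:
  assumes c: "c \<in> nil_brackets" "d \<in> nil_brackets" and T: "orthogonal_transformation T"
    and eq: "\<And>u v. br d (T u) (T v) = T (br c u v)"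
  shows "(c, d) \<in> isometry_rel"
proof -
  have "T (inv T u) = u" for u
    using orthogonal_transformation_surj[OF T] by (simp add: surj_f_inv_f)
  then have "br d u v = T (br c (inv T u) (inv T v))" for u v
    using eq[of "inv T u" "inv T v"] by simp
  then show ?thesis
    using c T unfolding isometry_rel_def by blast
qed

lemma isometry_relE:
  assumes "(c, d) \<in> isometry_rel"
  obtains T where "orthogonal_transformation T" "\<And>u v. br d (T u) (T v) = T (br c u v)"
proof -
  obtain T where T: "orthogonal_transformation T" "\<And>u v. br d u v = T (br c (inv T u) (inv T v))"
    using assms by (auto simp: isometry_rel_def)
  moreover have "inv T (T u) = u" for u
    using orthogonal_transformation_inj[OF T(1)] by simp
  ultimately show ?thesis
    by (intro that[of T]) auto
qed

section \<open>Quotient maps and open cones\<close>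

text \<open>A convergent sequence in the image is bounded, hence lies in the compact image of one of
  the bounded pieces. This serves three maps: the parametrisation of the cone, the coordinates, and
  the action of the orthogonal group.\<close>

lemma closed_image_proper:
  fixes f :: "'a :: heine_borel \<Rightarrow> 'b :: real_normed_vector"
  assumes cont: "continuous_on K f" and K: "closed K"
    and bd: "\<And>R. bounded {x \<in> K. norm (f x) \<le> R}"
  shows "closed (f ` K)"
proof -
  have comp: "compact (f ` {x \<in> K. norm (f x) \<le> R})" for R
  proof (rule compact_continuous_image)
    show "continuous_on {x \<in> K. norm (f x) \<le> R} f"
      by (rule continuous_on_subset[OF cont]) auto
    have "{x \<in> K. norm (f x) \<le> R} = K \<inter> f -` cball 0 R"
      by auto
    moreover have "closed (K \<inter> f -` cball 0 R)"
      using continuous_closed_preimage[OF cont K] by simp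
    ultimately have "closed {x \<in> K. norm (f x) \<le> R}"
      by simp
    then show "compact {x \<in> K. norm (f x) \<le> R}"
      using bd compact_eq_bounded_closed by blast
  qed
  show ?thesis
    unfolding closed_sequential_limits
  proof (intro allI impI, elim conjE)
    fix s l assume s: "\<forall>n. s n \<in> f ` K" "s \<longlonglongrightarrow> l"
    then obtain R where R: "\<And>n. norm (s n) \<le> R"
      using convergent_imp_Bseq[OF convergentI[OF s(2)]] unfolding Bseq_def by blast
    have "s n \<in> f ` {x \<in> K. norm (f x) \<le> R}" for n
      using s(1)[rule_format, of n] R[of n] by auto
    then have "\<forall>n. s n \<in> f ` {x \<in> K. norm (f x) \<le> R}"
      by blast
    then have "l \<in> f ` {x \<in> K. norm (f x) \<le> R}"
      using compact_imp_closed[OF comp[of R]] s(2) unfolding closed_sequential_limits by blast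
    then show "l \<in> f ` K"
      by blast
  qed
qed

text \<open>The classes of \<open>r\<close> are the fibres of \<open>h\<close>, so \<open>h\<close>
  can be evaluated at any chosen representative, and the induced map is an injective quotient
  map.\<close>

lemma homeomorphic_map_quotient_topology:
  assumes q: "quotient_map X Y h"
    and r: "\<And>x y. (x, y) \<in> r \<longleftrightarrow> x \<in> topspace X \<and> y \<in> topspace X \<and> h x = h y"
  obtains g where "homeomorphic_map (quotient_topology X r) Y g"
    "\<And>x. x \<in> topspace X \<Longrightarrow> g (r `` {x}) = h x" "topspace (quotient_topology X r) = topspace X // r"
proof -
  define g where "g = (\<lambda>A. h (SOME a. a \<in> A))"
  have eq: "equiv (topspace X) r"
    by (rule equivI) (auto simp: r intro!: refl_onI symI transI)
  have g: "g (r `` {x}) = h x" if "x \<in> topspace X" for x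
  proof -
    have "x \<in> r `` {x}"
      using that by (simp add: r)
    then have "(SOME a. a \<in> r `` {x}) \<in> r `` {x}"
      by (rule someI)
    then have "(x, SOME a. a \<in> r `` {x}) \<in> r"
      by (simp only: Image_singleton_iff)
    then show ?thesis
      unfolding g_def r by simp
  qed
  have open_eq: "openin (quotient_topology X r) \<U> \<longleftrightarrow> \<U> \<subseteq> topspace X // r \<and> openin X (\<Union>\<U>)" for \<U>
    by (rule openin_quotient_topology[OF eq])
  have UQ: "\<Union>(topspace X // r) = topspace X"
    by (rule Union_quotient[OF eq])
  have top: "topspace (quotient_topology X r) = topspace X // r"
  proof
    show "topspace (quotient_topology X r) \<subseteq> topspace X // r"
      using open_eq openin_topspace by blast
    show "topspace X // r \<subseteq> topspace (quotient_topology X r)"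
      using UQ by (intro openin_subset) (simp add: open_eq)
  qed
  have img: "g ` (topspace X // r) = h ` topspace X"
  proof -
    have "topspace X // r = (\<lambda>x. r `` {x}) ` topspace X"
      unfolding quotient_def by blast
    then show ?thesis
      by (simp add: image_image g cong: image_cong)
  qed
  have inj: "inj_on g (topspace X // r)"
  proof (rule inj_onI)
    fix A B assume AB: "A \<in> topspace X // r" "B \<in> topspace X // r" "g A = g B"
    obtain x y where xy: "x \<in> topspace X" "y \<in> topspace X" "A = r `` {x}" "B = r `` {y}"
      using AB by (auto simp: quotient_def)
    then show "A = B"
      using AB(3) by (auto simp: g r)
  qed
  have "quotient_map (quotient_topology X r) Y g"
    unfolding quotient_map_def
  proof (intro conjI allI impI)
    show "g ` topspace (quotient_topology X r) = topspace Y"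
      using q by (simp add: top img quotient_map_def)
    fix U assume U: "U \<subseteq> topspace Y"
    have "\<Union>{A \<in> topspace X // r. g A \<in> U} = {x \<in> topspace X. h x \<in> U}"
    proof (intro subset_antisym subsetI)
      fix x assume "x \<in> \<Union>{A \<in> topspace X // r. g A \<in> U}"
      then obtain y where "y \<in> topspace X" "x \<in> r `` {y}" "g (r `` {y}) \<in> U"
        by (auto simp: quotient_def)
      then show "x \<in> {x \<in> topspace X. h x \<in> U}"
        by (auto simp: g r)
    next
      fix x assume x: "x \<in> {x \<in> topspace X. h x \<in> U}"
      then have "r `` {x} \<in> topspace X // r" "x \<in> r `` {x}" "g (r `` {x}) \<in> U"
        by (auto simp: g quotientI r)
      then show "x \<in> \<Union>{A \<in> topspace X // r. g A \<in> U}"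
        by blast
    qed
    then show "openin (quotient_topology X r) {x \<in> topspace (quotient_topology X r). g x \<in> U} = openin Y U"
      using q U unfolding open_eq top quotient_map_def by simp
  qed
  then have "homeomorphic_map (quotient_topology X r) Y g"
    using inj by (simp add: homeomorphic_map_def top)
  then show ?thesis
    using g top by (rule that)
qed

text \<open>The open cone over a compact space is modelled by the rays through a copy of the space inside an affine
  hyperplane \<open>l = 1\<close>.\<close>

lemma homeomorphic_map_open_cone:
  fixes E :: "'a :: euclidean_space set"
  assumes l: "linear l" and E: "closed E"
    and cone: "\<And>x t. x \<in> E \<Longrightarrow> 0 \<le> t \<Longrightarrow> t *\<^sub>R x \<in> E"
    and pos: "\<And>x. x \<in> E \<Longrightarrow> norm x \<le> l x" and ne: "\<exists>x\<in>E. l x = 1"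
    and hom: "homeomorphic_map X (top_of_set {x \<in> E. l x = (1 :: real)}) f"
  obtains g where "homeomorphic_map (open_cone X) (top_of_set E) g" "g (cone_peak X) = 0"
    "cone_peak X \<in> topspace (open_cone X)"
proof -
  let ?E1 = "{x \<in> E. l x = 1}"
  \<comment> \<open>Multiplication maps the product of the slice and the half-line onto
    \<open>E\<close> and identifies only points with \<open>t = 0\<close>. It is shown to be closed,
    hence a quotient map; this rests on the slice being bounded, since there the norm is at most
    \<open>l x = 1\<close>.\<close>
  define s where "s = (\<lambda>(x :: 'a, t :: real). t *\<^sub>R x)"
  define h where "h = (\<lambda>(k, t). s (f k, t))"
  have lcont: "continuous_on UNIV l"
    using l by (simp add: linear_continuous_on linear_conv_bounded_linear)
  have E1: "closed ?E1"
  proof -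
    have "?E1 = E \<inter> l -` {1}" by auto
    moreover have "closed (l -` {1})"
      using lcont by (simp add: continuous_on_closed_vimage)
    ultimately show ?thesis
      using E by (metis closed_Int)
  qed
  have s_img: "s ` (?E1 \<times> {0..}) = E"
  proof (intro subset_antisym subsetI)
    fix x assume "x \<in> s ` (?E1 \<times> {0..})"
    then show "x \<in> E"
      by (auto simp: s_def cone)
  next
    fix x assume x: "x \<in> E"
    show "x \<in> s ` (?E1 \<times> {0..})"
    proof (cases "x = 0")
      case True
      obtain y where "y \<in> E" "l y = 1" using ne by blast
      then show ?thesis
        using True by (intro image_eqI[where x = "(y, 0)"]) (auto simp: s_def)
    next
      case False
      then have lx: "l x > 0"
        using pos[OF x] by (meson less_le_trans zero_less_norm_iff)
      then have "inverse (l x) *\<^sub>R x \<in> ?E1"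
        using x by (simp add: cone linear_cmul[OF l])
      then show ?thesis
        using lx by (intro image_eqI[where x = "(inverse (l x) *\<^sub>R x, l x)"]) (auto simp: s_def)
    qed
  qed
  have s_cont: "continuous_on S s" for S
    unfolding s_def case_prod_beta by (intro continuous_intros)
  have "closed_map (top_of_set (?E1 \<times> {0..})) (top_of_set E) s"
    unfolding closed_map_def
  proof (intro allI impI)
    fix C :: "('a \<times> real) set" assume C0: "closedin (top_of_set (?E1 \<times> {0..})) C"
    have C: "closed C" "C \<subseteq> ?E1 \<times> {0..}"
      using closedin_closed_trans[OF C0 closed_Times[OF E1 closed_atLeast]] closedin_imp_subset[OF C0]
      by simp_all
    have "closed (s ` C)"
    proof (rule closed_image_proper[OF s_cont C(1)])
      fix R :: real
      obtain B where B: "\<And>x. norm (l x) \<le> norm x * B" 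
          using bounded_linear.bounded[OF l[unfolded linear_conv_bounded_linear]] by blast
      show "bounded {x \<in> C. norm (s x) \<le> R}"
      proof (rule bounded_subset)
        show "{x \<in> C. norm (s x) \<le> R} \<subseteq> cball 0 1 \<times> cball 0 (R * \<bar>B\<bar>)"
        proof
          fix z assume z: "z \<in> {x \<in> C. norm (s x) \<le> R}"
          obtain x t where xt: "z = (x, t)" by (cases z)
          then have *: "x \<in> E" "l x = 1" "t \<ge> 0" "norm (t *\<^sub>R x) \<le> R"
            using z C(2) by (auto simp: s_def)
          have "norm x \<le> 1" using pos[OF *(1)] *(2) by simp
          \<comment> \<open>On the slice the scalar is recovered from the product by
            \<open>l\<close>, so bounded products force bounded scalars: \<open>s\<close> is
            proper.\<close>
          have "t = l (t *\<^sub>R x)" using * by (simp add: linear_cmul[OF l])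
          then have "t \<le> norm (t *\<^sub>R x) * B"
            using order_trans[OF abs_ge_self B[of "t *\<^sub>R x", unfolded real_norm_def]] by linarith
          also have "\<dots> \<le> norm (t *\<^sub>R x) * \<bar>B\<bar>"
            by (intro mult_left_mono) auto
          also have "\<dots> \<le> R * \<bar>B\<bar>"
            using *(4) by (intro mult_right_mono) auto
          finally have "t \<le> R * \<bar>B\<bar>" .
          with \<open>norm x \<le> 1\<close> show "z \<in> cball 0 1 \<times> cball 0 (R * \<bar>B\<bar>)"
            using *(3) by (simp add: xt)
        qed
        show "bounded (cball (0 :: 'a) 1 \<times> cball (0 :: real) (R * \<bar>B\<bar>))"
          by (intro bounded_Times bounded_cball)
      qed
    qed
    moreover have "s ` C \<subseteq> E"
      using C(2) s_img by blast
    ultimately show "closedin (top_of_set E) (s ` C)"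
      by (simp add: closed_subset)
  qed
  moreover have "continuous_map (top_of_set (?E1 \<times> {0..})) (top_of_set E) s"
    using s_cont s_img by (simp add: continuous_map_in_subtopology image_subset_iff_funcset[symmetric])
  ultimately have qs: "quotient_map (top_of_set (?E1 \<times> {0..})) (top_of_set E) s"
    using s_img by (intro continuous_closed_imp_quotient_map) simp_all
  have "homeomorphic_map (prod_topology X (top_of_set {0..}))
      (prod_topology (top_of_set ?E1) (top_of_set {0..})) (\<lambda>(k, t). (f k, (t :: real)))"
  proof -
    obtain f' where f': "homeomorphic_maps X (top_of_set ?E1) f f'"
      using hom homeomorphic_map_maps by blast
    have "homeomorphic_maps (top_of_set {0 :: real..}) (top_of_set {0..}) (\<lambda>x. x) (\<lambda>x. x)"
      by (simp add: homeomorphic_maps_def)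
    with f' show ?thesis
      unfolding homeomorphic_map_maps
      by (intro exI[of _ "\<lambda>(k, t). (f' k, t)"], subst homeomorphic_maps_prod) (intro disjI2 conjI)
  qed
  then have "homeomorphic_map (prod_topology X (top_of_set {0..}))
      (top_of_set (?E1 \<times> {0..})) (\<lambda>(k, t). (f k, (t :: real)))"
    by (simp only: prod_topology_subtopology_eu)
  then have "quotient_map (prod_topology X (top_of_set {0..})) (top_of_set E) (s \<circ> (\<lambda>(k, t). (f k, t)))"
    by (intro quotient_map_compose[OF _ qs]) (simp add: homeomorphic_map_def)
  moreover have "s \<circ> (\<lambda>(k, t). (f k, t)) = h"
    by (auto simp: h_def)
  ultimately have qh: "quotient_map (prod_topology X (top_of_set {0..})) (top_of_set E) h"
    by simp
  have fX: "f ` topspace X = ?E1" and finj: "inj_on f (topspace X)"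
    using hom by (simp_all add: homeomorphic_eq_everything_map)
  have fE: "f k \<in> E" "l (f k) = 1" if "k \<in> topspace X" for k
    using fX that by blast+
  have rel: "(a, b) \<in> collapse_rel (topspace X \<times> {0..}) (topspace X \<times> {0}) \<longleftrightarrow>
     a \<in> topspace (prod_topology X (top_of_set {0..})) \<and> b \<in> topspace (prod_topology X (top_of_set {0..})) \<and> h a = h b"
    (is "?L \<longleftrightarrow> ?R") for a b
  proof
    show ?R if ?L
      using that by (auto simp: collapse_rel_def h_def s_def Id_on_def)
    show ?L if R: ?R
    proof -
      obtain k t k' t' where ab: "a = (k, t)" "b = (k', t')" by (cases a, cases b)
      have *: "k \<in> topspace X" "k' \<in> topspace X" "t \<ge> 0" "t' \<ge> 0" "t *\<^sub>R f k = t' *\<^sub>R f k'"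
        using R by (auto simp: ab h_def s_def)
      from *(5) have "l (t *\<^sub>R f k) = l (t' *\<^sub>R f k')" by simp
      then have tt: "t = t'" using fE(2)[OF *(1)] fE(2)[OF *(2)] by (simp only: linear_cmul[OF l]) simp
      show ?L
      proof (cases "t = 0")
        case True then show ?thesis using * tt by (auto simp: ab collapse_rel_def)
      next
        case False then have "f k = f k'" using *(5) tt by simp
        then have "k = k'" using finj * by (simp add: inj_on_def)
        then show ?thesis using * tt by (auto simp: ab collapse_rel_def)
      qed
    qed
  qed
  obtain g where g: "homeomorphic_map (open_cone X) (top_of_set E) g"
    "\<And>x. x \<in> topspace (prod_topology X (top_of_set {0..})) \<Longrightarrow>
      g (collapse_rel (topspace X \<times> {0..}) (topspace X \<times> {0}) `` {x}) = h x"
    "topspace (open_cone X) = topspace (prod_topology X (top_of_set {0..})) //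
      collapse_rel (topspace X \<times> {0..}) (topspace X \<times> {0})"
    by (rule homeomorphic_map_quotient_topology[OF qh rel, folded open_cone_def]) blast
  obtain k where k: "k \<in> topspace X"
    using ne fX by blast
  then have peak: "collapse_rel (topspace X \<times> {0..}) (topspace X \<times> {0}) `` {(k, 0)} = cone_peak X"
    by (auto simp: collapse_rel_def cone_peak_def Id_on_def)
  then have "g (cone_peak X) = 0"
    using g(2)[of "(k, 0)"] k by (simp add: h_def s_def)
  moreover have "cone_peak X \<in> topspace (open_cone X)"
    unfolding g(3) peak[symmetric] by (rule quotientI) (simp add: k)
  ultimately show ?thesis
    using g(1) that by blast
qed

section \<open>Brackets built from pairs of 2-forms on \<open>\<real>\<^sup>4\<close>\<close>

definition vec6 :: "real \<Rightarrow> real \<Rightarrow> real \<Rightarrow> real \<Rightarrow> real \<Rightarrow> real \<Rightarrow> 6 euc"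
  where "vec6 a b c d e f = (\<chi> i. if i = 0 then a else if i = 1 then b else if i = 2 then c
    else if i = 3 then d else if i = 4 then e else f)"

lemma vec6_nth [simp]: "vec6 a b c d e f $ 0 = a" "vec6 a b c d e f $ 1 = b" "vec6 a b c d e f $ 2 = c"
  "vec6 a b c d e f $ 3 = d" "vec6 a b c d e f $ 4 = e" "vec6 a b c d e f $ 5 = f"
  by (simp_all add: vec6_def)

lemma vec6_eq_iff: "(u :: 6 euc) = v \<longleftrightarrow> u $ 0 = v $ 0 \<and> u $ 1 = v $ 1 \<and> u $ 2 = v $ 2 \<and> u $ 3 = v $ 3
   \<and> u $ 4 = v $ 4 \<and> u $ 5 = v $ 5"
  by (simp add: vec_eq_iff forall_6)

lemma inner_6: "(u :: 6 euc) \<bullet> v = u $ 0 * v $ 0 + u $ 1 * v $ 1 + u $ 2 * v $ 2 + u $ 3 * v $ 3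
   + u $ 4 * v $ 4 + u $ 5 * v $ 5"
  by (simp add: inner_vec_def sum_6)

lemma inner_3: "(x :: real ^ 3) \<bullet> y = x $ 1 * y $ 1 + x $ 2 * y $ 2 + x $ 3 * y $ 3"
  by (simp add: inner_vec_def sum_3)

text \<open>Identify \<open>\<real>\<^sup>4\<close> with the quaternions. The skew forms belonging to left multiplication by the imaginary quaternion \<open>x\<close>
  and right multiplication by \<open>y\<close> decompose \<open>\<Lambda>\<^sup>2 \<real>\<^sup>4\<close> into its self-dual and anti-self-dual parts.\<close>

definition sform :: "real ^ 3 \<Rightarrow> real ^ 3 \<Rightarrow> 6 euc \<Rightarrow> 6 euc \<Rightarrow> real"
  where "sform x y u v =
    (x $ 1 + y $ 1) * (u $ 0 * v $ 1 - u $ 1 * v $ 0) + (x $ 1 - y $ 1) * (u $ 2 * v $ 3 - u $ 3 * v $ 2)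
  + (x $ 2 + y $ 2) * (u $ 0 * v $ 2 - u $ 2 * v $ 0) + (y $ 2 - x $ 2) * (u $ 1 * v $ 3 - u $ 3 * v $ 1)
  + (x $ 3 + y $ 3) * (u $ 0 * v $ 3 - u $ 3 * v $ 0) + (x $ 3 - y $ 3) * (u $ 1 * v $ 2 - u $ 2 * v $ 1)"

type_synonym param = "(real ^ 3) \<times> (real ^ 3) \<times> (real ^ 3) \<times> (real ^ 3) \<times> real"

text \<open>A parameter \<open>(x, x', y, y', h)\<close> lists the self-dual parts \<open>x\<close>, \<open>x'\<close> and the anti-self-dual parts \<open>y\<close>, \<open>y'\<close> of the components of
  the bracket along the last two axes; \<open>h\<close> is the only entry of its component along the fourth axis.\<close>

definition param_form :: "param \<Rightarrow> 6 euc \<Rightarrow> 6 euc \<Rightarrow> 6 euc"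
  where "param_form = (\<lambda>(x, x', y, y', h) u v.
    vec6 0 0 0 (h * (u $ 1 * v $ 2 - u $ 2 * v $ 1)) (sform x y u v) (sform x' y' u v))"

definition param_bracket :: "param \<Rightarrow> 6 bracket"
  where "param_bracket m = bracket_of (param_form m)"

lemma bilinear_param_form: "bilinear (param_form m)"
  by (cases m) (auto intro!: linearI simp: bilinear_def param_form_def sform_def vec6_eq_iff algebra_simps)

lemma br_param_bracket: "br (param_bracket m) u v = param_form m u v"
  unfolding param_bracket_def
  by (rule br_bracket_of[OF bilinear_param_form]) (cases m, simp add: param_form_def sform_def vec6_eq_iff)

lemma param_bracket_nil: "param_bracket (x, x', y, y', 0) \<in> nil_brackets"
  by (simp add: nil_brackets_def br_param_bracket param_form_def sform_def vec6_eq_iff)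

abbreviation diag_param :: "real \<Rightarrow> real \<Rightarrow> real \<Rightarrow> param"
  where "diag_param a b h \<equiv> (axis 1 (a / 2), axis 2 (b / 2), axis 1 (a / 2), axis 2 (b / 2), h)"

lemma param_form_diag_param: "param_form (diag_param a b h) u v = vec6 0 0 0 (h * (u $ 1 * v $ 2 - u $ 2 * v $ 1))
    (a * (u $ 0 * v $ 1 - u $ 1 * v $ 0)) (b * (u $ 0 * v $ 2 - u $ 2 * v $ 0))"
  by (simp add: param_form_def sform_def axis_def)

lemma param_bracket_diag_param_nil: "param_bracket (diag_param a b h) \<in> nil_brackets"
  by (simp add: nil_brackets_def br_param_bracket param_form_diag_param vec6_eq_iff)

section \<open>Isometries acting on the flat parameters\<close>

lemma isometry_rel_sym: "(c, d) \<in> isometry_rel \<Longrightarrow> (d, c) \<in> isometry_rel"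
  using equiv_isometry_rel by (meson equivE symE)

lemma isometry_rel_trans: "(c, d) \<in> isometry_rel \<Longrightarrow> (d, e) \<in> isometry_rel \<Longrightarrow> (c, e) \<in> isometry_rel"
  using equiv_isometry_rel by (meson equivE transE)

lemma orthogonal_transformation_6I:
  fixes T :: "6 euc \<Rightarrow> 6 euc"
  assumes "linear T" "\<And>u. T u \<bullet> T u = u \<bullet> u"
  shows "orthogonal_transformation T"
  using assms by (simp add: orthogonal_transformation norm_eq_sqrt_inner)

text \<open>Left multiplication by the imaginary quaternion \<open>n\<close> on the first four
  coordinates, the identity on the last two.\<close>

definition lquat :: "real ^ 3 \<Rightarrow> 6 euc \<Rightarrow> 6 euc"
  where "lquat n u = vec6 (- (n $ 1 * u $ 1 + n $ 2 * u $ 2 + n $ 3 * u $ 3))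
    (u $ 0 * n $ 1 + n $ 2 * u $ 3 - n $ 3 * u $ 2) (u $ 0 * n $ 2 + n $ 3 * u $ 1 - n $ 1 * u $ 3)
    (u $ 0 * n $ 3 + n $ 1 * u $ 2 - n $ 2 * u $ 1) (u $ 4) (u $ 5)"

text \<open>Conjugation by a unit imaginary quaternion is the half turn about it, while left
  multiplication commutes with all right multiplications; so only the self-dual part is rotated. The
  factors \<open>n \<bullet> n\<close> make both sides homogeneous in \<open>n\<close> and the
  equation a polynomial identity.\<close>

lemma sform_lquat:
  "sform x y (lquat n u) (lquat n v) = sform ((2 * (n \<bullet> x)) *\<^sub>R n - (n \<bullet> n) *\<^sub>R x) ((n \<bullet> n) *\<^sub>R y) u v"
  unfolding sform_def lquat_def inner_3 vec6_nth vector_add_component vector_minus_component vector_scaleR_component real_scaleR_def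
  by algebra

lemma lquat_nth: "lquat n (vec6 a b c d e f) $ 4 = e" "lquat n (vec6 a b c d e f) $ 5 = f"
  "lquat n (vec6 0 0 0 0 e f) = vec6 0 0 0 0 e f"
  by (simp_all add: lquat_def)

lemma orthogonal_lquat:
  assumes "n \<bullet> n = 1" shows "orthogonal_transformation (lquat n)"
proof (rule orthogonal_transformation_6I)
  show "linear (lquat n)"
    by (auto intro!: linearI simp: lquat_def vec6_eq_iff algebra_simps)
  show "lquat n u \<bullet> lquat n u = u \<bullet> u" for u
    using assms unfolding inner_6 inner_3 lquat_def vec6_nth by algebra
qed

lemma param_bracket_rot_left:
  assumes "n \<bullet> n = 1"
  shows "(param_bracket (x, x', y, y', 0), param_bracket ((2 * (n \<bullet> x)) *\<^sub>R n - x, (2 * (n \<bullet> x')) *\<^sub>R n - x', y, y', 0)) \<in> isometry_rel"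
proof (rule isometry_rel_sym)
  show "(param_bracket ((2 * (n \<bullet> x)) *\<^sub>R n - x, (2 * (n \<bullet> x')) *\<^sub>R n - x', y, y', 0), param_bracket (x, x', y, y', 0)) \<in> isometry_rel"
    by (rule isometry_relI[OF param_bracket_nil param_bracket_nil orthogonal_lquat[OF assms]])
      (simp add: br_param_bracket param_form_def sform_lquat assms vec6_eq_iff lquat_nth)
qed

definition flip3 :: "real ^ 3 \<Rightarrow> real ^ 3"
  where "flip3 x = (\<chi> i. if i = 3 then - x $ 3 else x $ i)"

lemma flip3_flip3 [simp]: "flip3 (flip3 x) = x"
  by (simp add: flip3_def vec_eq_iff)

lemma inner_flip3 [simp]: "flip3 x \<bullet> flip3 y = x \<bullet> y"
  by (simp add: inner_3 flip3_def)

text \<open>A reflection of R^4 reverses the orientation and therefore exchanges self-dual and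
  anti-self-dual forms; \<open>flip3\<close> corrects the sign on the axis reflected.\<close>

lemma param_bracket_swap:
  "(param_bracket (x, x', y, y', 0), param_bracket (flip3 y, flip3 y', flip3 x, flip3 x', 0)) \<in> isometry_rel"
proof (rule isometry_relI[OF param_bracket_nil param_bracket_nil])
  let ?T = "\<lambda>u :: 6 euc. vec6 (u $ 0) (u $ 1) (u $ 2) (- u $ 3) (u $ 4) (u $ 5)"
  show "orthogonal_transformation ?T"
    by (rule orthogonal_transformation_6I) (auto intro!: linearI simp: vec6_eq_iff inner_6)
  show "br (param_bracket (flip3 y, flip3 y', flip3 x, flip3 x', 0)) (?T u) (?T v) = ?T (br (param_bracket (x, x', y, y', 0)) u v)" for u v
    by (simp add: br_param_bracket param_form_def vec6_eq_iff sform_def flip3_def algebra_simps)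
qed

lemma param_bracket_rot:
  assumes "C\<^sup>2 + S\<^sup>2 = 1"
  shows "(param_bracket (x, x', y, y', 0), param_bracket (C *\<^sub>R x + S *\<^sub>R x', C *\<^sub>R x' - S *\<^sub>R x, C *\<^sub>R y + S *\<^sub>R y', C *\<^sub>R y' - S *\<^sub>R y, 0)) \<in> isometry_rel"
proof (rule isometry_relI[OF param_bracket_nil param_bracket_nil])
  let ?T = "\<lambda>u :: 6 euc. vec6 (u $ 0) (u $ 1) (u $ 2) (u $ 3) (C * u $ 4 + S * u $ 5) (C * u $ 5 - S * u $ 4)"
  show "orthogonal_transformation ?T"
  proof (rule orthogonal_transformation_6I)
    show "linear ?T"
      by (auto intro!: linearI simp: vec6_eq_iff algebra_simps)
    show "?T u \<bullet> ?T u = u \<bullet> u" for u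
      using assms unfolding inner_6 vec6_nth by algebra
  qed
  show "br (param_bracket (C *\<^sub>R x + S *\<^sub>R x', C *\<^sub>R x' - S *\<^sub>R x, C *\<^sub>R y + S *\<^sub>R y', C *\<^sub>R y' - S *\<^sub>R y, 0)) (?T u) (?T v) = ?T (br (param_bracket (x, x', y, y', 0)) u v)" for u v
    by (simp add: br_param_bracket param_form_def vec6_eq_iff sform_def algebra_simps)
qed

lemma param_bracket_reflect:
  "(param_bracket (x, x', y, y', 0), param_bracket (x, - x', y, - y', 0)) \<in> isometry_rel"
proof (rule isometry_relI[OF param_bracket_nil param_bracket_nil])
  let ?T = "\<lambda>u :: 6 euc. vec6 (u $ 0) (u $ 1) (u $ 2) (u $ 3) (u $ 4) (- u $ 5)"
  show "orthogonal_transformation ?T"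
    by (rule orthogonal_transformation_6I) (auto intro!: linearI simp: vec6_eq_iff inner_6)
  show "br (param_bracket (x, - x', y, - y', 0)) (?T u) (?T v) = ?T (br (param_bracket (x, x', y, y', 0)) u v)" for u v
    by (simp add: br_param_bracket param_form_def vec6_eq_iff sform_def algebra_simps)
qed

text \<open>For distinct \<open>a\<close> and \<open>b\<close> the mirror is the bisecting plane,
  which contains \<open>p\<close> because \<open>p\<close> has equal products with both. For
  \<open>a = b\<close> the mirror has to contain \<open>a\<close> and \<open>p\<close>, and three
  dimensions leave room for its normal.\<close>

lemma reflection_exists:
  fixes a b p :: "real ^ 3"
  assumes ab: "a \<bullet> a = b \<bullet> b" and p: "p \<bullet> a = p \<bullet> b"
  obtains n where "n \<bullet> n = 1" "a - (2 * (n \<bullet> a)) *\<^sub>R n = b" "p - (2 * (n \<bullet> p)) *\<^sub>R n = p"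
proof (cases "a = b")
  case True
  have "dim {a, p} \<le> card {a, p}"
    by (rule dim_le_card) (auto simp: span_superset)
  also have "\<dots> \<le> 2"
    by (simp add: card_insert_if)
  finally have "dim {a, p} < DIM(real ^ 3)"
    by simp
  then obtain x where x: "x \<noteq> 0" "\<And>y. y \<in> span {a, p} \<Longrightarrow> orthogonal x y"
    by (rule orthogonal_to_subspace_exists) blast
  have "x \<bullet> a = 0" "x \<bullet> p = 0"
    using x(2) by (auto simp: orthogonal_def span_base)
  then show ?thesis
    using x(1) True by (intro that[of "x /\<^sub>R norm x"]) (auto simp: dot_square_norm power2_eq_square divide_simps)
next
  case False
  define n where "n = (a - b) /\<^sub>R norm (a - b)"
  have nn: "n \<bullet> n = 1"
    using False by (simp add: n_def dot_square_norm power2_eq_square divide_simps)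
  have sq: "norm (a - b) * norm (a - b) = 2 * ((a - b) \<bullet> a)"
    using ab by (simp add: dot_square_norm[symmetric] power2_eq_square[symmetric] inner_diff_left inner_diff_right inner_commute)
  have "(2 * (n \<bullet> a)) *\<^sub>R n = ((2 * ((a - b) \<bullet> a)) / (norm (a - b) * norm (a - b))) *\<^sub>R (a - b)"
    by (simp add: n_def divide_simps)
  also have "\<dots> = a - b"
    using False by (simp flip: sq)
  finally have "a - (2 * (n \<bullet> a)) *\<^sub>R n = b"
    by simp
  moreover have "n \<bullet> p = 0"
    using p by (simp add: n_def inner_diff_left inner_diff_right inner_commute[of _ p])
  ultimately show ?thesis
    using nn by (intro that[of n]) simp_all
qed

text \<open>Two reflections of R^3 carry one pair of vectors to the other with the same Gram matrix.
  The available isometries are half turns, the negatives of reflections, and with two of them the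
  signs cancel.\<close>

lemma param_bracket_gram_left:
  assumes "x \<bullet> x = X \<bullet> X" "x \<bullet> x' = X \<bullet> X'" "x' \<bullet> x' = X' \<bullet> X'"
  shows "(param_bracket (x, x', y, y', 0), param_bracket (X, X', y, y', 0)) \<in> isometry_rel"
proof -
  obtain n where n: "n \<bullet> n = 1" "x - (2 * (n \<bullet> x)) *\<^sub>R n = X"
    using reflection_exists[of x X 0] assms(1) by auto
  define z where "z = x' - (2 * (n \<bullet> x')) *\<^sub>R n"
  have "X \<bullet> z = x \<bullet> x'" "z \<bullet> z = x' \<bullet> x'"
    using n(1) unfolding z_def n(2)[symmetric]
    by (simp_all add: inner_diff_left inner_diff_right algebra_simps inner_commute)
  then obtain m where m: "m \<bullet> m = 1" "z - (2 * (m \<bullet> z)) *\<^sub>R m = X'" "X - (2 * (m \<bullet> X)) *\<^sub>R m = X"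
    using reflection_exists[of z X' X] assms by auto
  have "(param_bracket (x, x', y, y', 0), param_bracket (- X, - z, y, y', 0)) \<in> isometry_rel"
    using param_bracket_rot_left[OF n(1), of x x' y y'] by (simp add: z_def flip: n(2))
  moreover have "(param_bracket (- X, - z, y, y', 0), param_bracket (X, X', y, y', 0)) \<in> isometry_rel"
  proof -
    have "(2 * (m \<bullet> - X)) *\<^sub>R m - - X = X" "(2 * (m \<bullet> - z)) *\<^sub>R m - - z = X'"
      using m(2,3) by (simp_all add: algebra_simps)
    then show ?thesis
      using param_bracket_rot_left[OF m(1), of "- X" "- z" y y'] by (simp only:)
  qed
  ultimately show ?thesis
    by (rule isometry_rel_trans)
qed

text \<open>The anti-self-dual pair is moved by conjugating the previous lemma with the exchange of
  the two parts.\<close>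

lemma param_bracket_gram:
  assumes "x \<bullet> x = X \<bullet> X" "x \<bullet> x' = X \<bullet> X'" "x' \<bullet> x' = X' \<bullet> X'"
    and "y \<bullet> y = Y \<bullet> Y" "y \<bullet> y' = Y \<bullet> Y'" "y' \<bullet> y' = Y' \<bullet> Y'"
  shows "(param_bracket (x, x', y, y', 0), param_bracket (X, X', Y, Y', 0)) \<in> isometry_rel"
proof -
  have "(param_bracket (x, x', y, y', 0), param_bracket (X, X', y, y', 0)) \<in> isometry_rel"
    using assms by (intro param_bracket_gram_left)
  moreover have "(param_bracket (flip3 y, flip3 y', flip3 X, flip3 X', 0), param_bracket (flip3 Y, flip3 Y', flip3 X, flip3 X', 0)) \<in> isometry_rel"
    using assms by (intro param_bracket_gram_left) simp_all
  moreover have "(param_bracket (flip3 Y, flip3 Y', flip3 X, flip3 X', 0), param_bracket (X, X', Y, Y', 0)) \<in> isometry_rel"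
    using param_bracket_swap[of "flip3 Y" "flip3 Y'" "flip3 X" "flip3 X'"] by simp
  ultimately show ?thesis
    using param_bracket_swap[of X X' y y'] isometry_rel_trans by metis
qed

text \<open>The traceless part of the Gram matrix of \<open>x\<close>, \<open>x'\<close>; rotating the pair by \<open>\<theta>\<close> multiplies it by \<open>cis (- 2 * \<theta>)\<close>.\<close>

definition gramC :: "real ^ 3 \<Rightarrow> real ^ 3 \<Rightarrow> complex"
  where "gramC x x' = Complex (x \<bullet> x - x' \<bullet> x') (2 * (x \<bullet> x'))"

definition gramT :: "real ^ 3 \<Rightarrow> real ^ 3 \<Rightarrow> real"
  where "gramT x x' = x \<bullet> x + x' \<bullet> x'"

lemma gram_eqI:
  assumes "gramC x x' = gramC X X'" "gramT x x' = gramT X X'"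
  shows "x \<bullet> x = X \<bullet> X" "x \<bullet> x' = X \<bullet> X'" "x' \<bullet> x' = X' \<bullet> X'"
  using assms by (auto simp: gramC_def gramT_def)

lemma gram_rot:
  fixes x x' :: "real ^ 3" and \<theta> :: real
  defines "X \<equiv> cos \<theta> *\<^sub>R x + sin \<theta> *\<^sub>R x'" and "X' \<equiv> cos \<theta> *\<^sub>R x' - sin \<theta> *\<^sub>R x"
  shows "gramC X X' = cis (- 2 * \<theta>) * gramC x x'" "gramT X X' = gramT x x'"
proof -
  define c s where cs: "c = cos \<theta>" "s = sin \<theta>"
  have *: "c * c = 1 - s * s"
    using sin_cos_squared_add[of \<theta>] unfolding cs power2_eq_square by linarith
  have i: "X \<bullet> X = c * c * (x \<bullet> x) + 2 * c * s * (x \<bullet> x') + s * s * (x' \<bullet> x')"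
    "X' \<bullet> X' = c * c * (x' \<bullet> x') - 2 * c * s * (x \<bullet> x') + s * s * (x \<bullet> x)"
    "X \<bullet> X' = c * c * (x \<bullet> x') - s * c * (x \<bullet> x) + s * c * (x' \<bullet> x') - s * s * (x \<bullet> x')"
    unfolding X_def X'_def cs[symmetric]
    by (simp_all add: inner_add_left inner_add_right inner_diff_left inner_diff_right inner_commute[of x' x] algebra_simps)
  show "gramT X X' = gramT x x'"
    unfolding gramT_def i * by (simp add: algebra_simps)
  have cs2: "cis (- 2 * \<theta>) = Complex (c * c - s * s) (- 2 * c * s)"
    by (simp add: cis.ctr cs cos_double sin_double power2_eq_square)
  show "gramC X X' = cis (- 2 * \<theta>) * gramC x x'"
    unfolding gramC_def i cs2 by (simp add: complex_eq_iff algebra_simps)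
qed

lemma gram_reflect: "gramC x (- x') = cnj (gramC x x')" "gramT x (- x') = gramT x x'"
  by (simp_all add: gramC_def gramT_def complex_eq_iff)

text \<open>The rotations in O(2) turn the two complex numbers simultaneously, and the reflection
  conjugates both. The rotation is spent on making the first number a nonnegative real, the
  reflection on moving the second into the upper half plane.\<close>

lemma param_bracket_normal_form:
  obtains X X' Y Y' where "(param_bracket (x, x', y, y', 0), param_bracket (X, X', Y, Y', 0)) \<in> isometry_rel"
    "gramT X X' = gramT x x'" "gramT Y Y' = gramT y y'"
    "gramC X X' = of_real (cmod (gramC x x'))" "cmod (gramC Y Y') = cmod (gramC y y')"
    "cmod (gramC X X' + gramC Y Y') = cmod (gramC x x' + gramC y y')"
    "Im (gramC Y Y') \<ge> 0" "gramC x x' = 0 \<Longrightarrow> gramC Y Y' = of_real (cmod (gramC y y'))"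
proof -
  \<comment> \<open>If the first number vanishes, the rotation is still free and normalises the
    second number instead.\<close>
  define g where "g = (if gramC x x' = 0 then gramC y y' else gramC x x')"
  define \<theta> where "\<theta> = Arg g / 2"
  have rot: "cis (- 2 * \<theta>) * g = of_real (cmod g)"
  proof -
    have "cis (- 2 * \<theta>) * g = cis (- Arg g) * (of_real (cmod g) * cis (Arg g))"
      using rcis_cmod_Arg[of g] by (simp add: \<theta>_def rcis_def)
    also have "\<dots> = of_real (cmod g) * (cis (- Arg g) * cis (Arg g))"
      by (simp only: mult.left_commute)
    also have "\<dots> = of_real (cmod g)"
      by (simp add: cis_mult)
    finally show ?thesis .
  qed
  define X X' Y Y' where XY: "X = cos \<theta> *\<^sub>R x + sin \<theta> *\<^sub>R x'" "X' = cos \<theta> *\<^sub>R x' - sin \<theta> *\<^sub>R x"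
     "Y = cos \<theta> *\<^sub>R y + sin \<theta> *\<^sub>R y'" "Y' = cos \<theta> *\<^sub>R y' - sin \<theta> *\<^sub>R y"
  have gX: "gramC X X' = cis (- 2 * \<theta>) * gramC x x'" "gramT X X' = gramT x x'"
    and gY: "gramC Y Y' = cis (- 2 * \<theta>) * gramC y y'" "gramT Y Y' = gramT y y'"
    unfolding XY by (rule gram_rot)+
  have nX: "gramC X X' = of_real (cmod (gramC x x'))"
    using rot gX by (auto simp: g_def split: if_splits)
  have nY: "gramC x x' = 0 \<Longrightarrow> gramC Y Y' = of_real (cmod (gramC y y'))"
    using rot gY by (auto simp: g_def split: if_splits)
  have cY: "cmod (gramC Y Y') = cmod (gramC y y')"
    by (simp add: gY norm_mult)
  have cS: "cmod (gramC X X' + gramC Y Y') = cmod (gramC x x' + gramC y y')"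
    unfolding gX gY distrib_left[symmetric] by (simp add: norm_mult)
  have rel: "(param_bracket (x, x', y, y', 0), param_bracket (X, X', Y, Y', 0)) \<in> isometry_rel"
    unfolding XY by (rule param_bracket_rot) simp
  show ?thesis
  proof (cases "Im (gramC Y Y') \<ge> 0")
    case True
    show ?thesis
      by (rule that[OF rel gX(2) gY(2) nX cY cS True nY])
  next
    case False
    have 1: "gramC X (- X') = of_real (cmod (gramC x x'))"
      by (simp add: gram_reflect nX)
    have 2: "gramC x x' = 0 \<Longrightarrow> gramC Y (- Y') = of_real (cmod (gramC y y'))"
      by (simp add: gram_reflect nY)
    have 3: "cmod (gramC X (- X') + gramC Y (- Y')) = cmod (gramC x x' + gramC y y')"
      by (simp add: gram_reflect cS flip: complex_cnj_add)
    show ?thesis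
      by (rule that[OF isometry_rel_trans[OF rel param_bracket_reflect] _ _ 1 _ 3 _ 2])
        (use False in \<open>simp_all add: gram_reflect gX gY cY norm_mult\<close>)
  qed
qed

text \<open>A triangle with given sides is unique up to rotation and reflection: once the first side
  is on the positive real axis, the length of the sum gives the real part of the second, its own
  length gives the imaginary part up to sign, and the half plane gives the sign.\<close>

lemma param_bracket_rel_if_invariants:
  assumes "gramT x x' = gramT u u'" "gramT y y' = gramT v v'"
    "cmod (gramC x x') = cmod (gramC u u')" "cmod (gramC y y') = cmod (gramC v v')"
    "cmod (gramC x x' + gramC y y') = cmod (gramC u u' + gramC v v')"
  shows "(param_bracket (x, x', y, y', 0), param_bracket (u, u', v, v', 0)) \<in> isometry_rel"
proof -
  obtain X X' Y Y' where X: "(param_bracket (x, x', y, y', 0), param_bracket (X, X', Y, Y', 0)) \<in> isometry_rel"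
    "gramT X X' = gramT x x'" "gramT Y Y' = gramT y y'"
    "gramC X X' = of_real (cmod (gramC x x'))" "cmod (gramC Y Y') = cmod (gramC y y')"
    "cmod (gramC X X' + gramC Y Y') = cmod (gramC x x' + gramC y y')"
    "Im (gramC Y Y') \<ge> 0" "gramC x x' = 0 \<Longrightarrow> gramC Y Y' = of_real (cmod (gramC y y'))"
    by (rule param_bracket_normal_form) blast
  obtain U U' V V' where U: "(param_bracket (u, u', v, v', 0), param_bracket (U, U', V, V', 0)) \<in> isometry_rel"
    "gramT U U' = gramT u u'" "gramT V V' = gramT v v'"
    "gramC U U' = of_real (cmod (gramC u u'))" "cmod (gramC V V') = cmod (gramC v v')"
    "cmod (gramC U U' + gramC V V') = cmod (gramC u u' + gramC v v')"
    "Im (gramC V V') \<ge> 0" "gramC u u' = 0 \<Longrightarrow> gramC V V' = of_real (cmod (gramC v v'))"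
    by (rule param_bracket_normal_form) blast
  have XU: "gramC X X' = gramC U U'"
    using X U assms by simp
  have "gramC Y Y' = gramC V V'"
  proof (cases "gramC x x' = 0")
    case True
    then have "gramC u u' = 0"
      using assms(3) by simp
    with True show ?thesis
      using X U assms by simp
  next
    case False
    define r where "r = cmod (gramC x x')"
    have r: "r > 0" "gramC U U' = of_real r"
      using False XU X(4) by (auto simp: r_def)
    have n: "cmod (gramC Y Y') = cmod (gramC V V')" 
      using X U assms by simp
    have "cmod (of_real r + gramC Y Y') = cmod (of_real r + gramC V V')"
      using X U assms XU r by simp
    then have "(cmod (of_real r + gramC Y Y'))\<^sup>2 = (cmod (of_real r + gramC V V'))\<^sup>2"
      by simp
    moreover have n2: "(cmod (gramC Y Y'))\<^sup>2 = (cmod (gramC V V'))\<^sup>2"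
      using n by simp
    ultimately have "2 * r * Re (gramC Y Y') = 2 * r * Re (gramC V V')"
      by (simp only: cmod_power2 plus_complex.sel Re_complex_of_real Im_complex_of_real power2_sum)
    then have re: "Re (gramC Y Y') = Re (gramC V V')"
      using r by simp
    then have "(Im (gramC Y Y'))\<^sup>2 = (Im (gramC V V'))\<^sup>2"
      using n2 unfolding cmod_power2 by simp
    then have "Im (gramC Y Y') = Im (gramC V V')"
      using X(7) U(7) by (simp add: power2_eq_iff_nonneg)
    with re show ?thesis
      by (simp add: complex_eq_iff)
  qed
  moreover have "gramT X X' = gramT U U'" "gramT Y Y' = gramT V V'"
    using X(2,3) U(2,3) assms by simp_all
  ultimately have "(param_bracket (X, X', Y, Y', 0), param_bracket (U, U', V, V', 0)) \<in> isometry_rel"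
    by (intro param_bracket_gram gram_eqI[OF XU] gram_eqI[of Y Y' V V'])
  then show ?thesis
    using X(1) U(1) isometry_rel_sym isometry_rel_trans by metis
qed

lemma param_bracket_rel_if_invariants_swap:
  assumes "gramT x x' = gramT v v'" "gramT y y' = gramT u u'"
    "cmod (gramC x x') = cmod (gramC v v')" "cmod (gramC y y') = cmod (gramC u u')"
    "cmod (gramC x x' + gramC y y') = cmod (gramC u u' + gramC v v')"
  shows "(param_bracket (x, x', y, y', 0), param_bracket (u, u', v, v', 0)) \<in> isometry_rel"
proof -
  have "gramT (flip3 x) (flip3 x') = gramT x x'" "gramC (flip3 x) (flip3 x') = gramC x x'" for x x'
    by (simp_all add: gramT_def gramC_def)
  then have "(param_bracket (flip3 y, flip3 y', flip3 x, flip3 x', 0), param_bracket (u, u', v, v', 0)) \<in> isometry_rel"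
    using assms by (intro param_bracket_rel_if_invariants) (simp_all add: add.commute)
  then show ?thesis
    using param_bracket_swap isometry_rel_trans by metis
qed

section \<open>Orthogonal invariants\<close>

lemma inner_matrix_congruence:
  fixes A J :: "real ^ 'n ^ 'n"
  shows "u \<bullet> ((transpose A ** J ** A) *v v) = (A *v u) \<bullet> (J *v (A *v v))"
proof -
  have "u \<bullet> (transpose A *v w) = (A *v u) \<bullet> w" for w
  proof -
    have "u \<bullet> (transpose A *v w) = (transpose A *v w) \<bullet> u"
      by (rule inner_commute)
    also have "\<dots> = w \<bullet> (A *v u)"
      unfolding transpose_matrix_vector by (rule dot_lmul_matrix)
    also have "\<dots> = (A *v u) \<bullet> w"
      by (rule inner_commute)
    finally show ?thesis .
  qed
  from this[of "J *v (A *v v)"] show ?thesis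
    by (simp only: matrix_vector_mul_assoc matrix_mul_assoc)
qed

lemma matrix_eqI_inner:
  fixes M N :: "real ^ 'n ^ 'n"
  assumes "\<And>u v. u \<bullet> (M *v v) = u \<bullet> (N *v v)"
  shows "M = N"
  unfolding matrix_eq by (metis assms vector_eq_ldot)

lemma symmetric_matrix_eqI:
  fixes M N :: "real ^ 'n ^ 'n"
  assumes sym: "transpose M = M" "transpose N = N" and eq: "\<And>u. u \<bullet> (M *v u) = u \<bullet> (N *v u)"
  shows "M = N"
proof (rule matrix_eqI_inner)
  have s: "v \<bullet> (L *v u) = u \<bullet> (L *v v)" if "transpose L = L" for L :: "real ^ 'n ^ 'n" and u v
  proof -
    have "v \<bullet> (L *v u) = (transpose L *v v) \<bullet> u"
      unfolding transpose_matrix_vector dot_lmul_matrix ..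
    then show ?thesis
      unfolding that by (rule trans[OF _ inner_commute])
  qed
  fix u v
  have "(u + v) \<bullet> (M *v (u + v)) = (u + v) \<bullet> (N *v (u + v))"
    by (rule eq)
  then have "u \<bullet> (M *v u) + u \<bullet> (M *v v) + (v \<bullet> (M *v u) + v \<bullet> (M *v v))
      = u \<bullet> (N *v u) + u \<bullet> (N *v v) + (v \<bullet> (N *v u) + v \<bullet> (N *v v))"
    by (simp only: matrix_vector_right_distrib inner_add_left inner_add_right)
  then show "u \<bullet> (M *v v) = u \<bullet> (N *v v)"
    using eq[of u] eq[of v] s[OF sym(1), of v u] s[OF sym(2), of v u] by linarith
qed

lemma trace_congruence:
  fixes A J :: "real ^ 'n ^ 'n"
  assumes "orthogonal_matrix A"
  shows "trace (transpose A ** J ** A) = trace J"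
proof -
  have "trace (transpose A ** J ** A) = trace (A ** (transpose A ** J))"
    by (rule trace_mul_sym)
  also have "\<dots> = trace (A ** transpose A ** J)"
    by (simp only: matrix_mul_assoc)
  also have "A ** transpose A = mat 1"
    using assms by (simp only: orthogonal_matrix_def)
  finally show ?thesis
    by (simp only: matrix_mul_lid)
qed

lemma congruence_mult:
  fixes A J K :: "real ^ 'n ^ 'n"
  assumes "orthogonal_matrix A"
  shows "(transpose A ** J ** A) ** (transpose A ** K ** A) = transpose A ** (J ** K) ** A"
proof -
  have "(transpose A ** J ** A) ** (transpose A ** K ** A) = transpose A ** J ** (A ** transpose A) ** K ** A"
    by (simp only: matrix_mul_assoc)
  also have "A ** transpose A = mat 1"
    using assms by (simp only: orthogonal_matrix_def)
  finally show ?thesis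
    by (simp only: matrix_mul_assoc matrix_mul_rid)
qed

section \<open>Skew matrices of a bracket and the traces of their powers\<close>

definition skew_matrix :: "6 bracket \<Rightarrow> 6 euc \<Rightarrow> real ^ 6 ^ 6"
  where "skew_matrix c a = (\<chi> i j. br c (axis i 1) (axis j 1) \<bullet> a)"

lemma skew_matrix_inner: "u \<bullet> (skew_matrix c a *v v) = br c u v \<bullet> a"
proof -
  have "br c u v \<bullet> a = (\<Sum>i\<in>UNIV. \<Sum>j\<in>UNIV. (u $ i * v $ j) * (br c (axis i 1) (axis j 1) \<bullet> a))"
    by (subst bilinear_euc_expand[OF bilinear_br]) (simp add: inner_sum_left)
  also have "\<dots> = u \<bullet> (skew_matrix c a *v v)"
    unfolding inner_vec_def[of u] matrix_vector_mult_def skew_matrix_def by (simp add: sum_distrib_left mult_ac)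
  finally show ?thesis ..
qed

text \<open>An isometry acts on these matrices by orthogonal congruence and on the vector
  \<open>a\<close>, so the trace of any power is, as a function of \<open>a\<close>, preserved up to
  the substitution of \<open>T a\<close>.\<close>

lemma skew_matrix_isometry:
  assumes T: "orthogonal_transformation T" and eq: "\<And>u v. br d (T u) (T v) = T (br c u v)"
  shows "skew_matrix c a = transpose (matrix T) ** skew_matrix d (T a) ** matrix T"
proof (rule matrix_eqI_inner)
  fix u v
  have lin: "matrix T *v u = T u" for u
    by (rule fun_cong[OF matrix_vector_mul(2)[OF orthogonal_transformation_linear[OF T]]])
  have "br c u v \<bullet> a = T (br c u v) \<bullet> T a"
    using T unfolding orthogonal_transformation_def by metis
  then show "u \<bullet> (skew_matrix c a *v v) = u \<bullet> ((transpose (matrix T) ** skew_matrix d (T a) ** matrix T) *v v)"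
    unfolding inner_matrix_congruence lin skew_matrix_inner eq .
qed

text \<open>Padded by zeros to size 6, because the congruence by an element of O(6) need not
  preserve the last two axes.\<close>

definition gram_matrix :: "real ^ 3 \<Rightarrow> real ^ 3 \<Rightarrow> real ^ 6 ^ 6"
  where "gram_matrix x x' = (\<chi> i j. if i = 4 \<and> j = 4 then x \<bullet> x else if i = 5 \<and> j = 5 then x' \<bullet> x'
     else if i = 4 \<and> j = 5 \<or> i = 5 \<and> j = 4 then x \<bullet> x' else 0)"

lemma transpose_gram_matrix: "transpose (gram_matrix x x') = gram_matrix x x'"
  by (simp add: gram_matrix_def transpose_def vec_eq_iff forall_6)

lemma matrix_mult_6: "((M :: real ^ 6 ^ 6) ** N) $ i $ j = M $ i $ 0 * N $ 0 $ j + M $ i $ 1 * N $ 1 $ j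
   + M $ i $ 2 * N $ 2 $ j + M $ i $ 3 * N $ 3 $ j + M $ i $ 4 * N $ 4 $ j + M $ i $ 5 * N $ 5 $ j"
  by (simp add: matrix_matrix_mult_def sum_6)

lemma trace_6: "trace (M :: real ^ 6 ^ 6) = M $ 0 $ 0 + M $ 1 $ 1 + M $ 2 $ 2 + M $ 3 $ 3 + M $ 4 $ 4 + M $ 5 $ 5"
  by (simp add: trace_def sum_6)

lemma gram_matrix_nth:
  "gram_matrix x x' $ 4 $ 4 = x \<bullet> x" "gram_matrix x x' $ 5 $ 5 = x' \<bullet> x'" "gram_matrix x x' $ 4 $ 5 = x \<bullet> x'" "gram_matrix x x' $ 5 $ 4 = x \<bullet> x'"
  "gram_matrix x x' $ 0 $ j = 0" "gram_matrix x x' $ 1 $ j = 0" "gram_matrix x x' $ 2 $ j = 0" "gram_matrix x x' $ 3 $ j = 0"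
  "gram_matrix x x' $ i $ 0 = 0" "gram_matrix x x' $ i $ 1 = 0" "gram_matrix x x' $ i $ 2 = 0" "gram_matrix x x' $ i $ 3 = 0"
  by (auto simp: gram_matrix_def)

lemma gram_matrix_form: "a \<bullet> (gram_matrix x x' *v a) = (a $ 4 *\<^sub>R x + a $ 5 *\<^sub>R x') \<bullet> (a $ 4 *\<^sub>R x + a $ 5 *\<^sub>R x')"
  by (simp add: inner_6 matrix_vector_mult_def sum_6 gram_matrix_nth inner_add_left inner_add_right inner_commute[of x' x] algebra_simps)

lemma gram_matrix_traces: "trace (gram_matrix x x') = x \<bullet> x + x' \<bullet> x'"
  "trace (gram_matrix x x' ** gram_matrix y y') = (x \<bullet> x) * (y \<bullet> y) + 2 * (x \<bullet> x') * (y \<bullet> y') + (x' \<bullet> x') * (y' \<bullet> y')"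
  by (simp_all add: trace_6 matrix_mult_6 gram_matrix_nth algebra_simps)

lemma skew_matrix_param_bracket:
  fixes x x' y y' :: "real ^ 3" and a :: "6 euc" and h :: real
  defines "X \<equiv> a $ 4 *\<^sub>R x + a $ 5 *\<^sub>R x'" and "Y \<equiv> a $ 4 *\<^sub>R y + a $ 5 *\<^sub>R y'"
  defines "J \<equiv> skew_matrix (param_bracket (x, x', y, y', h)) a"
  shows "J $ i $ 4 = 0" "J $ i $ 5 = 0" "J $ 4 $ i = 0" "J $ 5 $ i = 0"
    "J $ 0 $ 0 = 0" "J $ 1 $ 1 = 0" "J $ 2 $ 2 = 0" "J $ 3 $ 3 = 0"
    "J $ 0 $ 1 = X $ 1 + Y $ 1" "J $ 1 $ 0 = - (X $ 1 + Y $ 1)"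
    "J $ 2 $ 3 = X $ 1 - Y $ 1" "J $ 3 $ 2 = - (X $ 1 - Y $ 1)"
    "J $ 0 $ 2 = X $ 2 + Y $ 2" "J $ 2 $ 0 = - (X $ 2 + Y $ 2)"
    "J $ 1 $ 3 = Y $ 2 - X $ 2" "J $ 3 $ 1 = - (Y $ 2 - X $ 2)"
    "J $ 0 $ 3 = X $ 3 + Y $ 3" "J $ 3 $ 0 = - (X $ 3 + Y $ 3)"
    "J $ 1 $ 2 = X $ 3 - Y $ 3 + h * a $ 3" "J $ 2 $ 1 = - (X $ 3 - Y $ 3 + h * a $ 3)"
  unfolding J_def X_def Y_def skew_matrix_def
  by (simp_all add: br_param_bracket param_form_def inner_6 sform_def axis_def algebra_simps)

text \<open>The hypothesis makes the 2-form along the fourth axis orthogonal to those along the last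
  two, so no mixed terms with \<open>h\<close> arise.\<close>

lemma trace_skewm2:
  assumes "h = 0 \<or> x $ 3 = y $ 3 \<and> x' $ 3 = y' $ 3"
  shows "trace (skew_matrix (param_bracket (x, x', y, y', h)) a ** skew_matrix (param_bracket (x, x', y, y', h)) a)
    = - 4 * (a \<bullet> (gram_matrix x x' *v a) + a \<bullet> (gram_matrix y y' *v a)) - 2 * (h * a $ 3)\<^sup>2"
proof -
  define X Y where XY: "X = a $ 4 *\<^sub>R x + a $ 5 *\<^sub>R x'" "Y = a $ 4 *\<^sub>R y + a $ 5 *\<^sub>R y'"
  have h: "h = 0 \<or> X $ 3 = Y $ 3"
    using assms by (auto simp: XY)
  show ?thesis
    unfolding gram_matrix_form trace_6 matrix_mult_6 skew_matrix_param_bracket XY[symmetric] inner_3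
    using h by (auto simp: power2_eq_square algebra_simps)
qed

text \<open>Up to sign \<open>J\<close> is the sum of a left and a right quaternion multiplication,
  by X and Y, and these commute. So J^2 has on R^4 the eigenvalues -(|X| + |Y|)^2 and -(|X| -
  |Y|)^2, each twice; together with the trace of J^2 this yields the product of |X|^2 and
  |Y|^2.\<close>

lemma trace_skewm4:
  fixes x x' y y' :: "real ^ 3" and a :: "6 euc"
  defines "J \<equiv> skew_matrix (param_bracket (x, x', y, y', 0)) a"
  shows "trace ((J ** J) ** (J ** J)) = 4 * (a \<bullet> (gram_matrix x x' *v a) + a \<bullet> (gram_matrix y y' *v a))\<^sup>2 +
    16 * (a \<bullet> (gram_matrix x x' *v a)) * (a \<bullet> (gram_matrix y y' *v a))"
proof -
  define X Y where XY: "X = a $ 4 *\<^sub>R x + a $ 5 *\<^sub>R x'" "Y = a $ 4 *\<^sub>R y + a $ 5 *\<^sub>R y'"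
  define K where "K = J ** J"
  note J = skew_matrix_param_bracket[where x = x and x' = x' and y = y and y' = y' and h = 0 and a = a, folded XY J_def]
  have K0: "K $ i $ 4 = 0" "K $ i $ 5 = 0" "K $ 4 $ i = 0" "K $ 5 $ i = 0" for i
    by (simp_all add: K_def matrix_mult_6 J)
  define X1 X2 X3 Y1 Y2 Y3 where abb: "X1 = X $ 1" "X2 = X $ 2" "X3 = X $ 3" "Y1 = Y $ 1" "Y2 = Y $ 2" "Y3 = Y $ 3"
  define N where "N = X1 * X1 + X2 * X2 + X3 * X3 + Y1 * Y1 + Y2 * Y2 + Y3 * Y3"
  have K: "K $ 0 $ 0 = - N - 2 * (X1 * Y1 + X2 * Y2 + X3 * Y3)"
    "K $ 1 $ 1 = - N - 2 * (X1 * Y1 - X2 * Y2 - X3 * Y3)"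
    "K $ 2 $ 2 = - N - 2 * (X2 * Y2 - X1 * Y1 - X3 * Y3)"
    "K $ 3 $ 3 = - N - 2 * (X3 * Y3 - X1 * Y1 - X2 * Y2)"
    "K $ 0 $ 1 = 2 * (X2 * Y3 - X3 * Y2)" "K $ 1 $ 0 = 2 * (X2 * Y3 - X3 * Y2)"
    "K $ 0 $ 2 = 2 * (X3 * Y1 - X1 * Y3)" "K $ 2 $ 0 = 2 * (X3 * Y1 - X1 * Y3)"
    "K $ 0 $ 3 = 2 * (X1 * Y2 - X2 * Y1)" "K $ 3 $ 0 = 2 * (X1 * Y2 - X2 * Y1)"
    "K $ 1 $ 2 = - 2 * (X1 * Y2 + X2 * Y1)" "K $ 2 $ 1 = - 2 * (X1 * Y2 + X2 * Y1)"
    "K $ 1 $ 3 = - 2 * (X1 * Y3 + X3 * Y1)" "K $ 3 $ 1 = - 2 * (X1 * Y3 + X3 * Y1)"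
    "K $ 2 $ 3 = - 2 * (X2 * Y3 + X3 * Y2)" "K $ 3 $ 2 = - 2 * (X2 * Y3 + X3 * Y2)"
    unfolding K_def N_def matrix_mult_6 J abb by (simp_all add: algebra_simps)
  show ?thesis
    unfolding gram_matrix_form K_def[symmetric] trace_6 matrix_mult_6 K K0 XY[symmetric] inner_3 abb[symmetric] N_def
    by (simp add: power2_eq_square) algebra
qed

lemma quadratic_form_product_zero:
  fixes M N :: "real ^ 'n ^ 'n"
  assumes "\<And>a. a \<bullet> (M *v a) = 0 \<or> a \<bullet> (N *v a) = 0"
  shows "(\<forall>a. a \<bullet> (M *v a) = 0) \<or> (\<forall>a. a \<bullet> (N *v a) = 0)"
proof (rule ccontr)
  assume "\<not> ?thesis"
  then obtain a b where ab: "a \<bullet> (M *v a) \<noteq> 0" "b \<bullet> (N *v b) \<noteq> 0"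
    by blast
  define u v where "u = a \<bullet> (M *v b) + b \<bullet> (M *v a)" and "v = a \<bullet> (N *v b) + b \<bullet> (N *v a)"
  have 0: "a \<bullet> (N *v a) = 0" "b \<bullet> (M *v b) = 0"
    using assms[of a] assms[of b] ab by auto
  have "(a + s *\<^sub>R b) \<bullet> (M *v (a + s *\<^sub>R b)) = a \<bullet> (M *v a) + s * u"
    "(a + s *\<^sub>R b) \<bullet> (N *v (a + s *\<^sub>R b)) = s * (v + s * (b \<bullet> (N *v b)))" for s
    by (simp_all add: 0 u_def v_def matrix_vector_right_distrib matrix_vector_mult_scaleR inner_add_left inner_add_right algebra_simps)
  then have *: "a \<bullet> (M *v a) + s * u = 0 \<or> s * (v + s * (b \<bullet> (N *v b))) = 0" for s
    using assms[of "a + s *\<^sub>R b"] by simp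
  \<comment> \<open>For \<open>s\<close> different from 0 each of the two factors, linear in
    \<open>s\<close>, has at most one zero; three values of \<open>s\<close> cannot all be
    covered.\<close>
  show False
    using *[of 1] *[of 2] *[of 3] ab by auto
qed

text \<open>The modulus is the difference of the two eigenvalues of the Gram matrix, whose square is
  a polynomial in traces. This makes it accessible to congruence by O(6).\<close>

lemma cmod_gramC: "(cmod (gramC x x'))\<^sup>2 = 2 * trace (gram_matrix x x' ** gram_matrix x x') - (trace (gram_matrix x x'))\<^sup>2"
  unfolding gram_matrix_traces gramC_def cmod_power2 complex.sel by (simp add: power2_eq_square algebra_simps)

lemma cmod_gramC_add: "(cmod (gramC x x' + gramC y y'))\<^sup>2 = 2 * (trace (gram_matrix x x' ** gram_matrix x x')
    + 2 * trace (gram_matrix x x' ** gram_matrix y y') + trace (gram_matrix y y' ** gram_matrix y y')) - (trace (gram_matrix x x') + trace (gram_matrix y y'))\<^sup>2"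
  unfolding gram_matrix_traces gramC_def cmod_power2 complex.sel plus_complex.sel by (simp add: power2_eq_square algebra_simps)

lemma gramT_trace: "gramT x x' = trace (gram_matrix x x')"
  by (simp add: gramT_def gram_matrix_traces)

lemma gram_congruence_invariants:
  assumes A: "orthogonal_matrix A"
    and "gram_matrix x x' = transpose A ** gram_matrix u u' ** A" "gram_matrix y y' = transpose A ** gram_matrix v v' ** A"
  shows "gramT x x' = gramT u u'" "gramT y y' = gramT v v'"
    "cmod (gramC x x') = cmod (gramC u u')" "cmod (gramC y y') = cmod (gramC v v')"
    "cmod (gramC x x' + gramC y y') = cmod (gramC u u' + gramC v v')"
proof -
  show "gramT x x' = gramT u u'" "gramT y y' = gramT v v'"
    unfolding gramT_trace assms(2,3) trace_congruence[OF A] by (rule refl)+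
  have "(cmod (gramC x x'))\<^sup>2 = (cmod (gramC u u'))\<^sup>2" "(cmod (gramC y y'))\<^sup>2 = (cmod (gramC v v'))\<^sup>2"
    "(cmod (gramC x x' + gramC y y'))\<^sup>2 = (cmod (gramC u u' + gramC v v'))\<^sup>2"
    unfolding cmod_gramC cmod_gramC_add assms(2,3) congruence_mult[OF A] trace_congruence[OF A] by (rule refl)+
  then show "cmod (gramC x x') = cmod (gramC u u')" "cmod (gramC y y') = cmod (gramC v v')"
    "cmod (gramC x x' + gramC y y') = cmod (gramC u u' + gramC v v')"
    by (simp_all add: power2_eq_iff_nonneg)
qed

lemma transpose_congruence:
  fixes A M :: "real ^ 'n ^ 'n"
  assumes "transpose M = M"
  shows "transpose (transpose A ** M ** A) = transpose A ** M ** A"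
  using assms by (simp add: matrix_transpose_mul matrix_mul_assoc)

text \<open>Equal sums and products mean that for each \<open>a\<close> the value of the first Gram
  form is one of the two transported values. By \<open>quadratic_form_product_zero\<close> one of
  the two alternatives holds for all \<open>a\<close>; the second one is the exchange of the two
  parts.\<close>

lemma invariants_if_param_bracket_rel:
  assumes "(param_bracket (x, x', y, y', 0), param_bracket (u, u', v, v', 0)) \<in> isometry_rel"
  shows "cmod (gramC x x' + gramC y y') = cmod (gramC u u' + gramC v v') \<and>
   (gramT x x' = gramT u u' \<and> gramT y y' = gramT v v' \<and>
    cmod (gramC x x') = cmod (gramC u u') \<and> cmod (gramC y y') = cmod (gramC v v') \<or>
    gramT x x' = gramT v v' \<and> gramT y y' = gramT u u' \<and>
    cmod (gramC x x') = cmod (gramC v v') \<and> cmod (gramC y y') = cmod (gramC u u'))"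
proof -
  obtain T where T: "orthogonal_transformation T"
    "\<And>a b. br (param_bracket (u, u', v, v', 0)) (T a) (T b) = T (br (param_bracket (x, x', y, y', 0)) a b)"
    using isometry_relE[OF assms] by blast
  define A where "A = matrix T"
  have A: "orthogonal_matrix A"
    using T(1) by (simp add: A_def orthogonal_transformation_matrix)
  let ?G1 = "gram_matrix x x'" and ?G2 = "gram_matrix y y'"
  define H1 H2 where H: "H1 = transpose A ** gram_matrix u u' ** A" "H2 = transpose A ** gram_matrix v v' ** A"
  have lin: "A *v a = T a" for a
    unfolding A_def by (rule fun_cong[OF matrix_vector_mul(2)[OF orthogonal_transformation_linear[OF T(1)]]])
  have H': "a \<bullet> (H1 *v a) = T a \<bullet> (gram_matrix u u' *v T a)" "a \<bullet> (H2 *v a) = T a \<bullet> (gram_matrix v v' *v T a)" for a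
    unfolding H inner_matrix_congruence lin by (rule refl)+
  note sk = skew_matrix_isometry[OF T, folded A_def]
  have sum: "a \<bullet> (?G1 *v a) + a \<bullet> (?G2 *v a) = a \<bullet> (H1 *v a) + a \<bullet> (H2 *v a)" for a
  proof -
    have "trace (skew_matrix (param_bracket (x, x', y, y', 0)) a ** skew_matrix (param_bracket (x, x', y, y', 0)) a)
        = trace (skew_matrix (param_bracket (u, u', v, v', 0)) (T a) ** skew_matrix (param_bracket (u, u', v, v', 0)) (T a))"
      unfolding sk congruence_mult[OF A] trace_congruence[OF A] ..
    then show ?thesis
      by (simp add: trace_skewm2 H')
  qed
  have prod: "(a \<bullet> (?G1 *v a)) * (a \<bullet> (?G2 *v a)) = (a \<bullet> (H1 *v a)) * (a \<bullet> (H2 *v a))" for a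
  proof -
    let ?J = "skew_matrix (param_bracket (x, x', y, y', 0)) a" and ?K = "skew_matrix (param_bracket (u, u', v, v', 0)) (T a)"
    have "trace ((?J ** ?J) ** (?J ** ?J)) = trace ((?K ** ?K) ** (?K ** ?K))"
      unfolding sk congruence_mult[OF A] trace_congruence[OF A] ..
    then show ?thesis
      using sum[of a] unfolding trace_skewm4 H' by simp
  qed
  have "a \<bullet> ((?G1 - H1) *v a) = 0 \<or> a \<bullet> ((?G1 - H2) *v a) = 0" for a
  proof -
    define p q p' q' where pq: "p = a \<bullet> (?G1 *v a)" "q = a \<bullet> (?G2 *v a)" "p' = a \<bullet> (H1 *v a)" "q' = a \<bullet> (H2 *v a)"
    have "p + q = p' + q'" "p * q = p' * q'"
      using sum[of a] prod[of a] by (simp_all add: pq)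
    then have "(p - p') * (p - q') = 0"
      by algebra
    then show ?thesis
      by (simp add: pq matrix_vector_mult_diff_rdistrib inner_diff_right)
  qed
  then consider "\<forall>a. a \<bullet> ((?G1 - H1) *v a) = 0" | "\<forall>a. a \<bullet> ((?G1 - H2) *v a) = 0"
    using quadratic_form_product_zero by blast
  then show ?thesis
  proof cases
    case 1
    then have 1: "a \<bullet> (?G1 *v a) = a \<bullet> (H1 *v a)" for a
      by (simp add: matrix_vector_mult_diff_rdistrib inner_diff_right)
    have "?G1 = H1"
      using 1 unfolding H by (rule symmetric_matrix_eqI[OF transpose_gram_matrix transpose_congruence[OF transpose_gram_matrix]])
    moreover have "?G2 = H2"
    proof -
      have "a \<bullet> (?G2 *v a) = a \<bullet> (H2 *v a)" for a
        using 1[of a] sum[of a] by linarith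
      then show ?thesis
        unfolding H by (rule symmetric_matrix_eqI[OF transpose_gram_matrix transpose_congruence[OF transpose_gram_matrix]])
    qed
    ultimately show ?thesis
      using gram_congruence_invariants[OF A, of x x' u u' y y' v v'] by (simp add: H)
  next
    case 2
    then have 2: "a \<bullet> (?G1 *v a) = a \<bullet> (H2 *v a)" for a
      by (simp add: matrix_vector_mult_diff_rdistrib inner_diff_right)
    have "?G1 = H2"
      using 2 unfolding H by (rule symmetric_matrix_eqI[OF transpose_gram_matrix transpose_congruence[OF transpose_gram_matrix]])
    moreover have "?G2 = H1"
    proof -
      have "a \<bullet> (?G2 *v a) = a \<bullet> (H1 *v a)" for a
        using 2[of a] sum[of a] by linarith
      then show ?thesis
        unfolding H by (rule symmetric_matrix_eqI[OF transpose_gram_matrix transpose_congruence[OF transpose_gram_matrix]])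
    qed
    ultimately show ?thesis
      using gram_congruence_invariants[OF A, of x x' v v' y y' u u'] by (simp add: H add.commute)
  qed
qed

section \<open>Singular values of a bracket\<close>

definition image_gram :: "param \<Rightarrow> real ^ 6 ^ 6"
  where "image_gram = (\<lambda>(x, x', y, y', h). gram_matrix x x' + gram_matrix y y' + (\<chi> i j. if i = 3 \<and> j = 3 then h\<^sup>2 / 2 else 0))"

lemma image_gram_nth:
  fixes x x' y y' :: "real ^ 3" and h :: real
  defines "S \<equiv> image_gram (x, x', y, y', h)"
  shows "S $ 0 $ j = 0" "S $ 1 $ j = 0" "S $ 2 $ j = 0" "S $ i $ 0 = 0" "S $ i $ 1 = 0" "S $ i $ 2 = 0"
    "S $ 3 $ 3 = h\<^sup>2 / 2" "S $ 3 $ 4 = 0" "S $ 3 $ 5 = 0" "S $ 4 $ 3 = 0" "S $ 5 $ 3 = 0"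
    "S $ 4 $ 4 = x \<bullet> x + y \<bullet> y" "S $ 4 $ 5 = x \<bullet> x' + y \<bullet> y'" "S $ 5 $ 4 = x \<bullet> x' + y \<bullet> y'" "S $ 5 $ 5 = x' \<bullet> x' + y' \<bullet> y'"
  by (simp_all add: S_def image_gram_def gram_matrix_nth)

lemma transpose_image_gram: "transpose (image_gram m) = image_gram m"
  by (cases m) (simp add: vec_eq_iff transpose_def forall_6 image_gram_nth)

text \<open>This identifies \<open>image_gram\<close> as half of c c*, where c* is the adjoint: the
  value at \<open>a\<close> is half the squared norm of the 2-form c* a.\<close>

lemma image_gram_form:
  assumes "h = 0 \<or> x $ 3 = y $ 3 \<and> x' $ 3 = y' $ 3"
  shows "a \<bullet> (image_gram (x, x', y, y', h) *v a) =
    - trace (skew_matrix (param_bracket (x, x', y, y', h)) a ** skew_matrix (param_bracket (x, x', y, y', h)) a) / 4"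
  unfolding trace_skewm2[OF assms] gram_matrix_form
  by (simp add: inner_6 matrix_vector_mult_def sum_6 image_gram_nth inner_add_left inner_add_right inner_commute[of x' x] 
    inner_commute[of y' y] algebra_simps power2_eq_square)

lemma image_gram_congruence:
  assumes "(param_bracket (x, x', y, y', h), param_bracket (u, u', v, v', k)) \<in> isometry_rel"
    "h = 0 \<or> x $ 3 = y $ 3 \<and> x' $ 3 = y' $ 3" "k = 0 \<or> u $ 3 = v $ 3 \<and> u' $ 3 = v' $ 3"
  obtains A where "orthogonal_matrix A" "image_gram (x, x', y, y', h) = transpose A ** image_gram (u, u', v, v', k) ** A"
proof -
  obtain T where T: "orthogonal_transformation T"
    "\<And>a b. br (param_bracket (u, u', v, v', k)) (T a) (T b) = T (br (param_bracket (x, x', y, y', h)) a b)"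
    using isometry_relE[OF assms(1)] by blast
  define A where "A = matrix T"
  have A: "orthogonal_matrix A"
    using T(1) by (simp add: A_def orthogonal_transformation_matrix)
  have lin: "A *v a = T a" for a
    unfolding A_def by (rule fun_cong[OF matrix_vector_mul(2)[OF orthogonal_transformation_linear[OF T(1)]]])
  note sk = skew_matrix_isometry[OF T, folded A_def]
  have "image_gram (x, x', y, y', h) = transpose A ** image_gram (u, u', v, v', k) ** A"
  proof (rule symmetric_matrix_eqI[OF transpose_image_gram transpose_congruence[OF transpose_image_gram]])
    fix a
    show "a \<bullet> (image_gram (x, x', y, y', h) *v a) = a \<bullet> ((transpose A ** image_gram (u, u', v, v', k) ** A) *v a)"
      unfolding inner_matrix_congruence lin image_gram_form[OF assms(2)] image_gram_form[OF assms(3)]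
        sk congruence_mult[OF A] trace_congruence[OF A] ..
  qed
  with A show ?thesis
    by (rule that)
qed

lemma image_gram_invariants:
  fixes h k
  assumes "(param_bracket (x, x', y, y', h), param_bracket (u, u', v, v', k)) \<in> isometry_rel"
    "h = 0 \<or> x $ 3 = y $ 3 \<and> x' $ 3 = y' $ 3" "k = 0 \<or> u $ 3 = v $ 3 \<and> u' $ 3 = v' $ 3"
  defines "S \<equiv> image_gram (x, x', y, y', h)" and "R \<equiv> image_gram (u, u', v, v', k)"
  shows "trace S = trace R" "trace (S ** S) = trace (R ** R)" "trace ((S ** S) ** S) = trace ((R ** R) ** R)"
proof -
  obtain A where A: "orthogonal_matrix A" and S: "S = transpose A ** R ** A"
    unfolding S_def R_def by (rule image_gram_congruence[OF assms(1-3)])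
  show "trace S = trace R" "trace (S ** S) = trace (R ** R)" "trace ((S ** S) ** S) = trace ((R ** R) ** R)"
    unfolding S congruence_mult[OF A] trace_congruence[OF A] by (rule refl)+
qed

text \<open>The third elementary symmetric function of the eigenvalues, by Newton's identities.\<close>

lemma image_gram_Newton:
  fixes x x' y y' :: "real ^ 3" and h :: real
  defines "S \<equiv> image_gram (x, x', y, y', h)"
  shows "(trace S) ^ 3 - 3 * trace S * trace (S ** S) + 2 * trace ((S ** S) ** S)
    = 3 * h\<^sup>2 * ((x \<bullet> x + y \<bullet> y) * (x' \<bullet> x' + y' \<bullet> y') - (x \<bullet> x' + y \<bullet> y')\<^sup>2)"
  unfolding S_def trace_6 matrix_mult_6 image_gram_nth by (simp add: field_simps power2_eq_square power3_eq_cube)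

lemma diag_param_nth: "(axis 1 a :: real ^ 3) $ 3 = 0" "(axis 2 a :: real ^ 3) $ 3 = 0"
  "(axis 1 a :: real ^ 3) \<bullet> axis 1 a = a * a" "(axis 2 a :: real ^ 3) \<bullet> axis 2 a = a * a"
  "(axis 1 a :: real ^ 3) \<bullet> axis 2 b = 0" "(axis 2 a :: real ^ 3) \<bullet> axis 1 b = 0"
  by (simp_all add: inner_3 axis_def)

lemma image_gram_Newton_diag_param:
  "(trace (image_gram (diag_param a b h))) ^ 3 - 3 * trace (image_gram (diag_param a b h)) * trace (image_gram (diag_param a b h) ** image_gram (diag_param a b h))
    + 2 * trace ((image_gram (diag_param a b h) ** image_gram (diag_param a b h)) ** image_gram (diag_param a b h)) = 3 / 4 * (a\<^sup>2 * b\<^sup>2 * h\<^sup>2)"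
  unfolding image_gram_Newton diag_param_nth by (simp add: power2_eq_square)

text \<open>The image has dimension three on the left and at most two on the right. The third
  elementary symmetric function of the eigenvalues of c c* detects this.\<close>

lemma param_bracket_diag_param_not_rel:
  assumes "h > 0" "a \<ge> h" "b \<ge> h"
  shows "(param_bracket (diag_param a b h), param_bracket (u, u', v, v', 0)) \<notin> isometry_rel"
proof
  assume *: "(param_bracket (diag_param a b h), param_bracket (u, u', v, v', 0)) \<in> isometry_rel"
  have "3 / 4 * (a\<^sup>2 * b\<^sup>2 * h\<^sup>2) = 3 * 0\<^sup>2 * ((u \<bullet> u + v \<bullet> v) * (u' \<bullet> u' + v' \<bullet> v') - (u \<bullet> u' + v \<bullet> v')\<^sup>2)"
    unfolding image_gram_Newton_diag_param[symmetric] image_gram_Newton[symmetric]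
    by (simp only: image_gram_invariants[OF *] diag_param_nth simp_thms)
  then show False
    using assms by simp
qed

text \<open>Both triples are the roots of the same cubic. The extreme entries agree as maximum and
  minimum of the set of roots, and the middle ones because of the sum; this avoids counting
  multiplicities.\<close>

lemma sorted_triple_unique:
  fixes a b c d e f :: real
  assumes "a \<ge> b" "b \<ge> c" "d \<ge> e" "e \<ge> f" and s: "a + b + c = d + e + f"
    "a * b + b * c + c * a = d * e + e * f + f * d" "a * b * c = d * e * f"
  shows "a = d \<and> b = e \<and> c = f"
proof -
  have root: "(t - a) * (t - b) * (t - c) = (t - d) * (t - e) * (t - f)" for t
    using s by algebra
  have 1: "a = d \<or> a = e \<or> a = f" "b = d \<or> b = e \<or> b = f" "c = d \<or> c = e \<or> c = f"
    using root[of a] root[of b] root[of c] by auto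
  have 2: "d = a \<or> d = b \<or> d = c" "e = a \<or> e = b \<or> e = c" "f = a \<or> f = b \<or> f = c"
    using root[of d] root[of e] root[of f] by auto
  have "a = d"
    using 1(1) 2(1) assms(1-4) by auto
  moreover have "c = f"
    using 1(3) 2(3) assms(1-4) by auto
  ultimately show ?thesis
    using s(1) by simp
qed

text \<open>The eigenvalues of c c* are the squared singular values and zeros; power sums up to the
  third determine their elementary symmetric functions.\<close>

lemma param_bracket_diag_param_rel:
  assumes "(param_bracket (diag_param a b h), param_bracket (diag_param a' b' h')) \<in> isometry_rel" "a \<ge> b" "b \<ge> h" "h \<ge> 0" "a' \<ge> b'" "b' \<ge> h'" "h' \<ge> 0"
  shows "a = a' \<and> b = b' \<and> h = h'"
proof -
  note I = image_gram_invariants[OF assms(1)]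
  have 1: "a\<^sup>2 + b\<^sup>2 + h\<^sup>2 = a'\<^sup>2 + b'\<^sup>2 + h'\<^sup>2"
    using I(1) by (simp add: diag_param_nth trace_6 image_gram_nth power2_eq_square)
  have 2: "(a\<^sup>2)\<^sup>2 + (b\<^sup>2)\<^sup>2 + (h\<^sup>2)\<^sup>2 = (a'\<^sup>2)\<^sup>2 + (b'\<^sup>2)\<^sup>2 + (h'\<^sup>2)\<^sup>2"
    using I(2) by (simp add: diag_param_nth trace_6 matrix_mult_6 image_gram_nth power2_eq_square)
  have 3: "a\<^sup>2 * b\<^sup>2 * h\<^sup>2 = a'\<^sup>2 * b'\<^sup>2 * h'\<^sup>2"
  proof -
    have "3 / 4 * (a\<^sup>2 * b\<^sup>2 * h\<^sup>2) = 3 / 4 * (a'\<^sup>2 * b'\<^sup>2 * h'\<^sup>2)"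
      unfolding image_gram_Newton_diag_param[symmetric] by (simp only: I diag_param_nth simp_thms)
    then show ?thesis
      by simp
  qed
  have 4: "a\<^sup>2 * b\<^sup>2 + b\<^sup>2 * h\<^sup>2 + h\<^sup>2 * a\<^sup>2 = a'\<^sup>2 * b'\<^sup>2 + b'\<^sup>2 * h'\<^sup>2 + h'\<^sup>2 * a'\<^sup>2"
  proof -
    define A B H A' B' H' where "A = a\<^sup>2" "B = b\<^sup>2" "H = h\<^sup>2" "A' = a'\<^sup>2" "B' = b'\<^sup>2" "H' = h'\<^sup>2"
    note d = this
    have "A + B + H = A' + B' + H'" "A\<^sup>2 + B\<^sup>2 + H\<^sup>2 = A'\<^sup>2 + B'\<^sup>2 + H'\<^sup>2"
      using 1 2 by (simp_all add: d)
    then have "2 * (A * B + B * H + H * A) = 2 * (A' * B' + B' * H' + H' * A')"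
      by algebra
    then show ?thesis
      by (simp add: d)
  qed
  have "a\<^sup>2 = a'\<^sup>2 \<and> b\<^sup>2 = b'\<^sup>2 \<and> h\<^sup>2 = h'\<^sup>2"
    using assms(2-7) 1 3 4 by (intro sorted_triple_unique power_mono) auto
  then show ?thesis
    using assms(2-7) by (simp add: power2_eq_iff_nonneg)
qed

section \<open>Piecewise linear coordinates\<close>

lemma exhaust_9: fixes x :: 9 shows "x = 0 \<or> x = 1 \<or> x = 2 \<or> x = 3 \<or> x = 4 \<or> x = 5 \<or> x = 6 \<or> x = 7 \<or> x = 8"
proof (induct x)
  case (of_int z)
  then have "0 \<le> z" "z < 9" by simp_all
  then have "z = 0 \<or> z = 1 \<or> z = 2 \<or> z = 3 \<or> z = 4 \<or> z = 5 \<or> z = 6 \<or> z = 7 \<or> z = 8" by arith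
  then show ?case by auto
qed

lemma UNIV_9: "(UNIV :: 9 set) = {0, 1, 2, 3, 4, 5, 6, 7, 8}"
  using exhaust_9 by auto

lemma sum_9: "sum f (UNIV :: 9 set) = f 0 + f 1 + f 2 + f 3 + f 4 + f 5 + f 6 + f 7 + f 8"
  unfolding UNIV_9 by (simp add: ac_simps)

lemma forall_9: "(\<forall>i :: 9. P i) \<longleftrightarrow> P 0 \<and> P 1 \<and> P 2 \<and> P 3 \<and> P 4 \<and> P 5 \<and> P 6 \<and> P 7 \<and> P 8"
  by (metis exhaust_9)

definition vec9 :: "real \<Rightarrow> real \<Rightarrow> real \<Rightarrow> real \<Rightarrow> real \<Rightarrow> real \<Rightarrow> real \<Rightarrow> real \<Rightarrow> real ^ 9"
  where "vec9 a b c d e f g h = (\<chi> i. if i = 0 then a else if i = 1 then b else if i = 2 then c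
    else if i = 3 then d else if i = 4 then e else if i = 5 then f else if i = 6 then g else if i = 7 then h else 0)"

lemma vec9_nth [simp]: "vec9 a b c d e f g h $ 0 = a" "vec9 a b c d e f g h $ 1 = b" "vec9 a b c d e f g h $ 2 = c"
  "vec9 a b c d e f g h $ 3 = d" "vec9 a b c d e f g h $ 4 = e" "vec9 a b c d e f g h $ 5 = f"
  "vec9 a b c d e f g h $ 6 = g" "vec9 a b c d e f g h $ 7 = h" "vec9 a b c d e f g h $ 8 = 0"
  by (simp_all add: vec9_def)

lemma vec9_eq_iff: "(u :: real ^ 9) = v \<longleftrightarrow> u $ 0 = v $ 0 \<and> u $ 1 = v $ 1 \<and> u $ 2 = v $ 2 \<and> u $ 3 = v $ 3
   \<and> u $ 4 = v $ 4 \<and> u $ 5 = v $ 5 \<and> u $ 6 = v $ 6 \<and> u $ 7 = v $ 7 \<and> u $ 8 = v $ 8"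
  by (simp add: vec_eq_iff forall_9)

text \<open>Unnormalised barycentric coordinates with respect to the vertices of the four 4-simplices (entries 0 to 6) and the
  additional vertex of the triangle (entry 7). The ninth coordinate is always zero.\<close>

definition pl_coords :: "real \<Rightarrow> real \<Rightarrow> real \<Rightarrow> real \<Rightarrow> real \<Rightarrow> real \<Rightarrow> real ^ 9"
  where "pl_coords p q r s t h = (let \<rho> = r - s; \<eta> = (p - r) - (q - s); \<nu> = (\<bar>\<rho> + \<eta>\<bar> - \<bar>\<rho> - \<eta>\<bar>) / 2 in
    vec9 (p + q - r - s - \<bar>\<eta>\<bar> - h\<^sup>2) (r + s - t) (t - \<bar>\<rho>\<bar>) (max (\<bar>\<rho>\<bar> - \<bar>\<eta>\<bar>) 0) (max (\<bar>\<eta>\<bar> - \<bar>\<rho>\<bar>) 0)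
      (\<bar>\<nu>\<bar> + \<nu>) (\<bar>\<nu>\<bar> - \<nu>) (3 * h\<^sup>2 / 2))"

lemma pl_coords_swap: "pl_coords q p s r t h = pl_coords p q r s t h"
proof -
  have *: "\<bar>(s - r) + ((q - s) - (p - r))\<bar> = \<bar>(r - s) + ((p - r) - (q - s))\<bar>"
    "\<bar>(s - r) - ((q - s) - (p - r))\<bar> = \<bar>(r - s) - ((p - r) - (q - s))\<bar>"
    "\<bar>(q - s) - (p - r)\<bar> = \<bar>(p - r) - (q - s)\<bar>" "\<bar>s - r\<bar> = \<bar>r - s\<bar>"
    by arith+
  show ?thesis
    unfolding pl_coords_def Let_def * by (simp add: vec9_eq_iff)
qed

text \<open>The folded coordinate has the sign of the product of its arguments and the size of the
  smaller one. Together with the difference of the absolute values it gives back both absolute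
  values.\<close>

lemma folded_min: "\<bar>(\<bar>\<rho> + \<eta>\<bar> - \<bar>\<rho> - \<eta>\<bar>) / 2\<bar> = min \<bar>\<rho>\<bar> \<bar>\<eta> :: real\<bar>"
  by (auto simp: min_def abs_if split: if_splits)

text \<open>\<open>(\<rho>, \<eta>) \<mapsto> (\<bar>\<rho>\<bar> - \<bar>\<eta>\<bar>, (\<bar>\<rho> + \<eta>\<bar> - \<bar>\<rho> - \<eta>\<bar>) / 2)\<close> is a piecewise linear model of the
  quotient map \<open>\<real>\<^sup>2 \<rightarrow> \<real>\<^sup>2 / {\<plusminus>1}\<close>.\<close>

lemma fold_inject:
  fixes \<rho> \<eta> \<rho>' \<eta>' :: real
  assumes "\<bar>\<rho>\<bar> - \<bar>\<eta>\<bar> = \<bar>\<rho>'\<bar> - \<bar>\<eta>'\<bar>" "\<bar>\<rho> + \<eta>\<bar> - \<bar>\<rho> - \<eta>\<bar> = \<bar>\<rho>' + \<eta>'\<bar> - \<bar>\<rho>' - \<eta>'\<bar>"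
  shows "\<rho> = \<rho>' \<and> \<eta> = \<eta>' \<or> \<rho> = - \<rho>' \<and> \<eta> = - \<eta>'"
proof -
  have m: "min \<bar>\<rho>\<bar> \<bar>\<eta>\<bar> = min \<bar>\<rho>'\<bar> \<bar>\<eta>'\<bar>"
    using assms(2) by (simp only: folded_min[symmetric])
  have "R = R' \<and> E = E'" if "R - E = R' - E'" "min R E = min R' E'" for R E R' E' :: real
    using that by (auto simp: min_def split: if_splits)
  from this[OF assms(1) m] have "\<rho> = \<rho>' \<or> \<rho> = - \<rho>'" "\<eta> = \<eta>' \<or> \<eta> = - \<eta>'"
    by (simp_all add: abs_eq_iff)
  moreover have "\<rho>' = 0 \<or> \<eta>' = 0" if "\<bar>\<rho>' + \<eta>'\<bar> = \<bar>\<rho>' - \<eta>'\<bar>"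
    using that by (auto simp: abs_eq_iff)
  ultimately show ?thesis
    using assms(2) abs_minus_commute[of \<rho>' \<eta>'] abs_minus_cancel[of "\<rho>' + \<eta>'"] by (elim disjE) auto
qed

text \<open>Entries 3 to 6 give the folded point, hence the two differences up to a common sign.
  Entries 2, 1 and 0 then yield \<open>t\<close>, \<open>r + s\<close> and \<open>p + q\<close> in
  this order, and the remaining sign is the exchange of the two parts.\<close>

lemma pl_coords_inject:
  assumes eq: "pl_coords p q r s t h = pl_coords p' q' r' s' t' h'"
  shows "t = t' \<and> h\<^sup>2 = h'\<^sup>2 \<and> (p = p' \<and> q = q' \<and> r = r' \<and> s = s' \<or> p = q' \<and> q = p' \<and> r = s' \<and> s = r')"
proof -
  define \<rho> \<eta> \<rho>' \<eta>' where d: "\<rho> = r - s" "\<eta> = (p - r) - (q - s)" "\<rho>' = r' - s'" "\<eta>' = (p' - r') - (q' - s')"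
  have e: "p + q - r - s - \<bar>\<eta>\<bar> - h\<^sup>2 = p' + q' - r' - s' - \<bar>\<eta>'\<bar> - h'\<^sup>2" "r + s - t = r' + s' - t'"
    "t - \<bar>\<rho>\<bar> = t' - \<bar>\<rho>'\<bar>" "max (\<bar>\<rho>\<bar> - \<bar>\<eta>\<bar>) 0 = max (\<bar>\<rho>'\<bar> - \<bar>\<eta>'\<bar>) 0" "max (\<bar>\<eta>\<bar> - \<bar>\<rho>\<bar>) 0 = max (\<bar>\<eta>'\<bar> - \<bar>\<rho>'\<bar>) 0"
    and v: "\<bar>(\<bar>\<rho> + \<eta>\<bar> - \<bar>\<rho> - \<eta>\<bar>) / 2\<bar> + (\<bar>\<rho> + \<eta>\<bar> - \<bar>\<rho> - \<eta>\<bar>) / 2 = \<bar>(\<bar>\<rho>' + \<eta>'\<bar> - \<bar>\<rho>' - \<eta>'\<bar>) / 2\<bar> + (\<bar>\<rho>' + \<eta>'\<bar> - \<bar>\<rho>' - \<eta>'\<bar>) / 2"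
    "\<bar>(\<bar>\<rho> + \<eta>\<bar> - \<bar>\<rho> - \<eta>\<bar>) / 2\<bar> - (\<bar>\<rho> + \<eta>\<bar> - \<bar>\<rho> - \<eta>\<bar>) / 2 = \<bar>(\<bar>\<rho>' + \<eta>'\<bar> - \<bar>\<rho>' - \<eta>'\<bar>) / 2\<bar> - (\<bar>\<rho>' + \<eta>'\<bar> - \<bar>\<rho>' - \<eta>'\<bar>) / 2"
    and h2: "3 * h\<^sup>2 / 2 = 3 * h'\<^sup>2 / 2"
    using eq unfolding pl_coords_def Let_def d[symmetric] vec9_eq_iff vec9_nth by blast+
  have h: "h\<^sup>2 = h'\<^sup>2"
    using h2 by simp
  have "N = N'" if "\<bar>N\<bar> + N = \<bar>N'\<bar> + N'" "\<bar>N\<bar> - N = \<bar>N'\<bar> - N'" for N N' :: real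
    using that by linarith
  from this[OF v] have 1: "\<bar>\<rho> + \<eta>\<bar> - \<bar>\<rho> - \<eta>\<bar> = \<bar>\<rho>' + \<eta>'\<bar> - \<bar>\<rho>' - \<eta>'\<bar>"
    by simp
  have "R - E = R' - E'" if "max (R - E) 0 = max (R' - E') 0" "max (E - R) 0 = max (E' - R') 0" for R E R' E' :: real
    using that by linarith
  from this[OF e(4,5)] have 2: "\<bar>\<rho>\<bar> - \<bar>\<eta>\<bar> = \<bar>\<rho>'\<bar> - \<bar>\<eta>'\<bar>" .
  from fold_inject[OF 2 1] have 3: "\<rho> = \<rho>' \<and> \<eta> = \<eta>' \<or> \<rho> = - \<rho>' \<and> \<eta> = - \<eta>'" .
  then have 4: "\<bar>\<rho>\<bar> = \<bar>\<rho>'\<bar>" "\<bar>\<eta>\<bar> = \<bar>\<eta>'\<bar>"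
    by auto
  have 5: "t = t'"
    using e(3) 4 by simp
  then have 6: "r + s = r' + s'"
    using e(2) by simp
  have "p + q - (r + s) = p' + q' - (r' + s')"
    using e(1) 4 h by simp
  then have "p + q = p' + q'"
    using 6 by simp
  from 3 show ?thesis
  proof (elim disjE conjE)
    assume "\<rho> = \<rho>'" "\<eta> = \<eta>'"
    then have "r = r'" "s = s'" "p = p'" "q = q'"
      using 6 \<open>p + q = p' + q'\<close> unfolding d by argo+
    with 5 h show ?thesis
      by simp
  next
    assume "\<rho> = - \<rho>'" "\<eta> = - \<eta>'"
    then have "r = s'" "s = r'" "p = q'" "q = p'"
      using 6 \<open>p + q = p' + q'\<close> unfolding d by argo+
    with 5 h show ?thesis
      by simp
  qed
qed

definition coords :: "param \<Rightarrow> real ^ 9"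
  where "coords = (\<lambda>(x, x', y, y', h). pl_coords (gramT x x') (gramT y y') (cmod (gramC x x')) (cmod (gramC y y'))
    (cmod (gramC x x' + gramC y y')) h)"

text \<open>The first set covers the brackets whose image has dimension at most two, the second one all brackets with a singular value
  decomposition on \<open>\<Lambda>\<^sup>2 \<real>\<^sup>3\<close>; both contain the case \<open>h = 0\<close> of the latter.\<close>

definition normal_params :: "param set"
  where "normal_params = {(x, x', y, y', h) | x x' y y' h. h = 0} \<union> {diag_param a b h | a b h. a \<ge> b \<and> b \<ge> h \<and> h \<ge> 0}"

lemma diag_param_invariants:
  assumes "a \<ge> b" "b \<ge> 0"
  shows "gramT (axis 1 (a / 2)) (axis 2 (b / 2)) = (a\<^sup>2 + b\<^sup>2) / 4"
    "gramC (axis 1 (a / 2)) (axis 2 (b / 2)) = of_real ((a\<^sup>2 - b\<^sup>2) / 4)"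
    "cmod (gramC (axis 1 (a / 2)) (axis 2 (b / 2))) = (a\<^sup>2 - b\<^sup>2) / 4"
    "cmod (gramC (axis 1 (a / 2)) (axis 2 (b / 2)) + gramC (axis 1 (a / 2)) (axis 2 (b / 2))) = (a\<^sup>2 - b\<^sup>2) / 2"
proof -
  show 1: "gramT (axis 1 (a / 2)) (axis 2 (b / 2)) = (a\<^sup>2 + b\<^sup>2) / 4"
    unfolding gramT_def diag_param_nth by (simp add: power2_eq_square)
  show 2: "gramC (axis 1 (a / 2)) (axis 2 (b / 2)) = of_real ((a\<^sup>2 - b\<^sup>2) / 4)"
    unfolding gramC_def diag_param_nth by (simp add: power2_eq_square complex_eq_iff diff_divide_distrib)
  have "a\<^sup>2 \<ge> b\<^sup>2"
    using assms by (intro power_mono)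
  then show "cmod (gramC (axis 1 (a / 2)) (axis 2 (b / 2))) = (a\<^sup>2 - b\<^sup>2) / 4"
    unfolding 2 norm_of_real by simp
  have "gramC (axis 1 (a / 2)) (axis 2 (b / 2)) + gramC (axis 1 (a / 2)) (axis 2 (b / 2)) = of_real ((a\<^sup>2 - b\<^sup>2) / 2)"
    unfolding 2 of_real_add[symmetric] by simp
  then show "cmod (gramC (axis 1 (a / 2)) (axis 2 (b / 2)) + gramC (axis 1 (a / 2)) (axis 2 (b / 2))) = (a\<^sup>2 - b\<^sup>2) / 2"
    using \<open>a\<^sup>2 \<ge> b\<^sup>2\<close> by (simp only: norm_of_real) simp
qed

text \<open>The constants in \<open>pl_coords\<close> come from here: the three entries are
  barycentric coordinates on the chamber a >= b >= h >= 0 in the squared singular values. Vertex 7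
  is a = b = h, and the factor 3/2 makes the sum of the entries half of a^2 + b^2 + h^2.\<close>

lemma coords_diag_param:
  assumes "a \<ge> b" "b \<ge> 0"
  shows "coords (diag_param a b h) = vec9 (b\<^sup>2 - h\<^sup>2) 0 ((a\<^sup>2 - b\<^sup>2) / 2) 0 0 0 0 (3 * h\<^sup>2 / 2)"
  unfolding coords_def prod.case diag_param_invariants(1,3,4)[OF assms] pl_coords_def Let_def by (simp add: vec9_eq_iff field_simps)

lemma param_bracket_normal_params_nil: "m \<in> normal_params \<Longrightarrow> param_bracket m \<in> nil_brackets"
  by (auto simp: normal_params_def param_bracket_nil param_bracket_diag_param_nil)

lemma normal_params_cases:
  assumes "m \<in> normal_params"
  obtains (flat) x x' y y' where "m = (x, x', y, y', 0)"
  | (diag_param) a b h where "m = diag_param a b h" "a \<ge> b" "b \<ge> h" "h > 0"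
proof (cases "snd (snd (snd (snd m))) = 0")
  case True
  then show ?thesis
    using flat by (cases m) auto
next
  case False
  then show ?thesis
    using assms diag_param unfolding normal_params_def by fastforce
qed

lemma coords_nth_7: "coords (x, x', y, y', h) $ 7 = 3 * h\<^sup>2 / 2"
  by (simp add: coords_def pl_coords_def Let_def)

text \<open>Entry 7 tells the two kinds of normal form apart, as does the dimension of the image;
  within each kind the coordinates encode the invariants already shown to be complete.\<close>

lemma param_bracket_rel_iff_coords:
  assumes "m \<in> normal_params" "n \<in> normal_params"
  shows "(param_bracket m, param_bracket n) \<in> isometry_rel \<longleftrightarrow> coords m = coords n"
  using assms(1)
proof (cases rule: normal_params_cases)
  case m: (flat x x' y y')
  show ?thesis
    using assms(2)
  proof (cases rule: normal_params_cases)
    case n: (flat u u' v v')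
    show ?thesis
    proof
      assume "(param_bracket m, param_bracket n) \<in> isometry_rel"
      from invariants_if_param_bracket_rel[OF this[unfolded m n]] show "coords m = coords n"
        unfolding m n coords_def prod.case by (auto simp: pl_coords_swap)
    next
      assume "coords m = coords n"
      from pl_coords_inject[OF this[unfolded m n coords_def prod.case]] show "(param_bracket m, param_bracket n) \<in> isometry_rel"
        unfolding m n by (elim conjE disjE) (rule param_bracket_rel_if_invariants param_bracket_rel_if_invariants_swap; simp)+
    qed
  next
    case n: (diag_param a b h)
    have "(param_bracket n, param_bracket m) \<notin> isometry_rel"
      unfolding m n(1) by (rule param_bracket_diag_param_not_rel) (use n in auto)
    moreover have "coords m \<noteq> coords n"
      using n(4) coords_nth_7 unfolding m n(1) by (metis divide_eq_0_iff less_irrefl mult_eq_0_iff power_zero_numeral zero_eq_power2 zero_neq_numeral)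
    ultimately show ?thesis
      using isometry_rel_sym by blast
  qed
next
  case m: (diag_param a b h)
  show ?thesis
    using assms(2)
  proof (cases rule: normal_params_cases)
    case n: (flat u u' v v')
    have "(param_bracket m, param_bracket n) \<notin> isometry_rel"
      unfolding n m(1) by (rule param_bracket_diag_param_not_rel) (use m in auto)
    moreover have "coords m \<noteq> coords n"
      using m(4) coords_nth_7 unfolding n m(1) by (metis divide_eq_0_iff less_irrefl mult_eq_0_iff power_zero_numeral zero_eq_power2 zero_neq_numeral)
    ultimately show ?thesis
      by blast
  next
    case n: (diag_param a' b' h')
    show ?thesis
    proof
      assume "(param_bracket m, param_bracket n) \<in> isometry_rel"
      from param_bracket_diag_param_rel[OF this[unfolded m(1) n(1)]] show "coords m = coords n"
        using m n by simp
    next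
      assume "coords m = coords n"
      moreover have "coords m = vec9 (b\<^sup>2 - h\<^sup>2) 0 ((a\<^sup>2 - b\<^sup>2) / 2) 0 0 0 0 (3 * h\<^sup>2 / 2)"
        "coords n = vec9 (b'\<^sup>2 - h'\<^sup>2) 0 ((a'\<^sup>2 - b'\<^sup>2) / 2) 0 0 0 0 (3 * h'\<^sup>2 / 2)"
        unfolding m(1) n(1) using m n by (intro coords_diag_param; simp)+
      ultimately have "h\<^sup>2 = h'\<^sup>2" "b\<^sup>2 = b'\<^sup>2" "a\<^sup>2 = a'\<^sup>2"
        by (simp_all add: vec9_eq_iff)
      then have "m = n"
        using m n by (simp add: power2_eq_iff_nonneg)
      then show "(param_bracket m, param_bracket n) \<in> isometry_rel"
        using equiv_isometry_rel param_bracket_normal_params_nil[OF assms(1)] by (metis equivE refl_onD)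
    qed
  qed
qed

section \<open>Normal forms\<close>

lemma orthonormal_extend:
  fixes b0 :: "'n \<Rightarrow> real ^ ('n :: finite)"
  assumes on: "\<And>i j. i \<in> S \<Longrightarrow> j \<in> S \<Longrightarrow> b0 i \<bullet> b0 j = (if i = j then 1 else 0)"
  obtains b where "\<And>i j. b i \<bullet> b j = (if i = j then 1 else 0)" "\<And>i. i \<in> S \<Longrightarrow> b i = b0 i"
proof -
  let ?A = "span (b0 ` S)"
  have inj: "inj_on b0 S"
    using on by (metis inj_onI zero_neq_one)
  have orth: "pairwise orthogonal (b0 ` S)"
    using on by (auto simp: pairwise_def orthogonal_def)
  have "0 \<notin> b0 ` S"
    using on by force
  then have ind: "independent (b0 ` S)"
    using orth by (rule pairwise_orthogonal_independent[rotated])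
  have dA: "dim ?A = card S"
    using dim_span_eq_card_independent[OF ind] card_image[OF inj] by simp
  define V where "V = {y \<in> UNIV. \<forall>x\<in>?A. orthogonal x y}"
  have "dim V + dim ?A = dim (UNIV :: (real ^ 'n) set)"
    unfolding V_def by (rule dim_subspace_orthogonal_to_vectors) auto
  then have dV: "dim V = card (- S)"
    using dA by (simp add: card_Diff_subset Compl_eq_Diff_UNIV)
  have "subspace V"
    unfolding V_def by (auto simp: subspace_def orthogonal_clauses)
  then obtain B where B: "B \<subseteq> V" "pairwise orthogonal B" "\<And>x. x \<in> B \<Longrightarrow> norm x = 1" "card B = dim V" "independent B"
    by (rule orthonormal_basis_subspace) blast
  have "finite B"
    using B(5) by (rule independent_imp_finite)
  then obtain e where e: "bij_betw e (- S) B"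
    using B(4) dV by (metis finite finite_same_card_bij)
  define b where "b i = (if i \<in> S then b0 i else e i)" for i
  have eB: "e i \<in> B" if "i \<notin> S" for i
    using e that by (auto simp: bij_betw_def)
  have ee: "e i \<bullet> e j = (if i = j then 1 else 0)" if "i \<notin> S" "j \<notin> S" for i j
  proof (cases "i = j")
    case True
    then show ?thesis
      using B(3)[OF eB[OF that(1)]] by (simp add: dot_square_norm)
  next
    case False
    then have "e i \<noteq> e j"
      using e that by (auto simp: bij_betw_def inj_on_def)
    then show ?thesis
      using B(2) eB that False by (auto simp: pairwise_def orthogonal_def)
  qed
  have be: "b0 i \<bullet> e j = 0" if "i \<in> S" "j \<notin> S" for i j
    using eB[OF that(2)] B(1) that(1) by (auto simp: V_def orthogonal_def span_base)
  have "b i \<bullet> b j = (if i = j then 1 else 0)" for i j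
    using on ee be be[of j i] by (auto simp: b_def inner_commute)
  then show ?thesis
    by (rule that) (simp add: b_def)
qed

locale frame =
  fixes b :: "'n \<Rightarrow> real ^ ('n :: finite)"
  assumes on: "b i \<bullet> b j = (if i = j then 1 else 0)"
begin

definition toframe :: "real ^ 'n \<Rightarrow> real ^ 'n"
  where "toframe u = (\<Sum>i\<in>UNIV. u $ i *\<^sub>R b i)"

lemma orthogonal_toframe: "orthogonal_transformation toframe"
proof -
  have "linear toframe"
    by (auto intro!: linearI simp: toframe_def algebra_simps sum.distrib scaleR_sum_right)
  moreover have "toframe u \<bullet> toframe u = u \<bullet> u" for u
    by (simp add: toframe_def inner_sum_left inner_sum_right on if_distrib[of "\<lambda>x. _ * x"] cong: if_cong)
      (simp add: inner_vec_def)
  ultimately show ?thesis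
    by (simp add: orthogonal_transformation norm_eq_sqrt_inner)
qed

lemma toframe_axis [simp]: "toframe (axis i 1) = b i"
  by (simp add: toframe_def axis_def if_distrib[of "\<lambda>x. x *\<^sub>R _"] cong: if_cong)

lemma frame_expand: "u = (\<Sum>i\<in>UNIV. (u \<bullet> b i) *\<^sub>R b i)"
proof -
  obtain w where w: "u = toframe w"
    using orthogonal_transformation_surj[OF orthogonal_toframe] by (metis surjD)
  have "toframe w \<bullet> b i = w $ i" for i
    by (simp add: toframe_def inner_sum_left on if_distrib[of "\<lambda>x. _ * x"] cong: if_cong)
  then show ?thesis
    by (simp add: w toframe_def)
qed

end

text \<open>The orthogonal map taking the standard basis to the frame transports the structure
  constants.\<close>

lemma param_bracket_rel_frame:
  assumes b: "frame b" and "c \<in> nil_brackets" "param_bracket m \<in> nil_brackets"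
    and eq: "\<And>i j. br c (b i) (b j) = (\<Sum>k\<in>UNIV. param_form m (axis i 1) (axis j 1) $ k *\<^sub>R b k)"
  shows "(c, param_bracket m) \<in> isometry_rel"
proof -
  interpret frame b by (rule b)
  have lin: "linear toframe"
    using orthogonal_toframe by (rule orthogonal_transformation_linear)
  have "br c (toframe u) (toframe v) = toframe (br (param_bracket m) u v)" for u v
  proof -
    have "bilinear (\<lambda>u v. br c (toframe u) (toframe v))"
      using bilinear_br[of c] lin unfolding bilinear_def by (auto intro!: linear_compose[unfolded o_def, of toframe])
    then have "br c (toframe u) (toframe v) = (\<Sum>i\<in>UNIV. \<Sum>j\<in>UNIV. (u $ i * v $ j) *\<^sub>R br c (b i) (b j))"
      by (subst bilinear_euc_expand[where B = "\<lambda>u v. br c (toframe u) (toframe v)"]) auto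
    also have "\<dots> = (\<Sum>i\<in>UNIV. \<Sum>j\<in>UNIV. (u $ i * v $ j) *\<^sub>R toframe (param_form m (axis i 1) (axis j 1)))"
      unfolding eq toframe_def ..
    also have "\<dots> = toframe (param_form m u v)"
      unfolding bilinear_euc_expand[OF bilinear_param_form, of m u v] by (simp add: linear_sum[OF lin] linear_cmul[OF lin])
    finally show ?thesis
      by (simp add: br_param_bracket)
  qed
  then have "(param_bracket m, c) \<in> isometry_rel"
    using assms orthogonal_toframe by (intro isometry_relI)
  then show ?thesis
    by (rule isometry_rel_sym)
qed

text \<open>The central vectors \<open>f\<close> and \<open>g\<close> become the last two axes. What
  is left are two 2-forms on the four-dimensional complement, to be split into their self-dual and
  anti-self-dual parts. The image may be smaller than the span.\<close>

lemma param_bracket_flat_exists: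
  assumes c: "c \<in> nil_brackets" and fg: "f \<bullet> f = 1" "g \<bullet> g = 1" "f \<bullet> g = 0"
    and z: "\<And>v. br c f v = 0" "\<And>v. br c g v = 0" and I: "\<And>u v. br c u v \<in> span {f, g}"
  shows "\<exists>x x' y y'. (c, param_bracket (x, x', y, y', 0)) \<in> isometry_rel"
proof -
  obtain b :: "6 \<Rightarrow> 6 euc" where b: "\<And>i j. b i \<bullet> b j = (if i = j then 1 else 0)" "\<And>i. i \<in> {4, 5} \<Longrightarrow> b i = (if i = 4 then f else g)"
    by (rule orthonormal_extend[where S = "{4, 5 :: 6}" and ?b0.0 = "\<lambda>i. if i = 4 then f else g"])
      (use fg in \<open>auto simp: inner_commute\<close>)
  interpret frame b
    by unfold_locales (rule b(1))
  have b45: "b 4 = f" "b 5 = g"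
    using b(2) by simp_all
  define C where "C k i j = br c (b i) (b j) \<bullet> b k" for k i j
  have skew: "C k j i = - C k i j" for k i j
    using br_skew[of c "b j" "b i"] by (simp add: C_def)
  have Cd: "C k i i = 0" for k i
    by (simp add: C_def)
  have C0: "C k 4 j = 0" "C k 5 j = 0" "C k j 4 = 0" "C k j 5 = 0" for k j
    using z skew[of k 4 j] skew[of k 5 j] by (simp_all add: C_def b45)
  have sp: "w \<bullet> b k = 0" if "w \<in> span {f, g}" "k \<noteq> 4" "k \<noteq> 5" for w k
  proof -
    have "orthogonal (b k) w"
      using that(1) by (rule orthogonal_to_span) (use that b(1)[of k 4] b(1)[of k 5] in \<open>auto simp: b45 orthogonal_def\<close>)
    then show ?thesis
      by (simp add: orthogonal_def inner_commute)
  qed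
  have Ck: "C k i j = 0" if "k \<noteq> 4" "k \<noteq> 5" for k i j
    unfolding C_def using that by (intro sp I)
  \<comment> \<open>Half sums and half differences of the complementary entries 01 and 23, 02 and
    13, 03 and 12 project to the two parts; the signs are those of \<open>sform\<close>.\<close>
  define X where "X k = (vector [(C k 0 1 + C k 2 3) / 2, (C k 0 2 - C k 1 3) / 2, (C k 0 3 + C k 1 2) / 2] :: real ^ 3)" for k
  define Y where "Y k = (vector [(C k 0 1 - C k 2 3) / 2, (C k 0 2 + C k 1 3) / 2, (C k 0 3 - C k 1 2) / 2] :: real ^ 3)" for k
  have XY: "X k $ 1 = (C k 0 1 + C k 2 3) / 2" "X k $ 2 = (C k 0 2 - C k 1 3) / 2" "X k $ 3 = (C k 0 3 + C k 1 2) / 2"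
    "Y k $ 1 = (C k 0 1 - C k 2 3) / 2" "Y k $ 2 = (C k 0 2 + C k 1 3) / 2" "Y k $ 3 = (C k 0 3 - C k 1 2) / 2" for k
    by (simp_all add: X_def Y_def)
  have sf: "\<forall>i j. sform (X k) (Y k) (axis i 1) (axis j 1) = C k i j" for k
    unfolding forall_6 sform_def XY
    using skew[of k 0 1] skew[of k 0 2] skew[of k 0 3] skew[of k 1 2] skew[of k 1 3] skew[of k 2 3]
    by (simp add: axis_def Cd C0 field_simps)
  have "(c, param_bracket (X 4, X 5, Y 4, Y 5, 0)) \<in> isometry_rel"
  proof (rule param_bracket_rel_frame[OF _ c param_bracket_nil])
    show "frame b" ..
    fix i j
    have "br c (b i) (b j) = (\<Sum>k\<in>UNIV. C k i j *\<^sub>R b k)"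
      unfolding C_def by (rule frame_expand)
    then show "br c (b i) (b j) = (\<Sum>k\<in>UNIV. param_form (X 4, X 5, Y 4, Y 5, 0) (axis i 1) (axis j 1) $ k *\<^sub>R b k)"
      by (simp add: sum_6 param_form_def sf Ck)
  qed
  then show ?thesis
    by blast
qed

text \<open>For a skew matrix \<open>J\<close> of even size with vanishing last row, \<open>J + e e\<^sup>T\<close> is turned into its transpose by changing the sign of
  all rows but the last; so its determinant vanishes.\<close>

lemma skew_6_kernel:
  fixes J :: "real ^ 6 ^ 6"
  assumes skew: "\<And>i j. J $ j $ i = - J $ i $ j" and J5: "\<And>j. J $ 5 $ j = 0"
  obtains g where "g \<noteq> 0" "g $ 5 = 0" "J *v g = 0"
proof -
  define A :: "real ^ 6 ^ 6" where "A = (\<chi> i j. J $ i $ j + (if i = 5 \<and> j = 5 then 1 else 0))"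
  define D :: "real ^ 6 ^ 6" where "D = (\<chi> i j. if i = j then (if i = 5 then 1 else - 1) else 0)"
  have J5': "J $ j $ 5 = 0" for j
    using skew[of 5 j] J5 by simp
  have Jd: "J $ i $ i = 0" for i
    using skew[of i i] by linarith
  have A_nth: "A $ i $ j = J $ i $ j + (if i = 5 \<and> j = 5 then 1 else 0)" for i j
    by (simp add: A_def)
  have DA: "(D ** A) $ i $ j = (if i = 5 then 1 else - 1) * A $ i $ j" for i j
    by (simp add: matrix_matrix_mult_def D_def if_distrib[of "\<lambda>x. x * _"] cong: if_cong)
  have "(D ** A) $ i $ j = transpose A $ i $ j" for i j
    using skew[of i j] J5[of j] J5'[of j] by (cases "i = 5") (simp_all add: DA A_nth transpose_def)
  then have DT: "D ** A = transpose A"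
    by (simp only: vec_eq_iff simp_thms)
  have "det D * det A = det A"
    unfolding det_mul[symmetric] DT by (rule det_transpose)
  moreover have "det D = - 1"
  proof -
    have "det D = (\<Prod>i\<in>UNIV. D $ i $ i)"
      by (rule det_diagonal) (simp add: D_def)
    also have "\<dots> = - 1"
      unfolding UNIV_6 by (simp add: D_def)
    finally show ?thesis .
  qed
  ultimately have "det A = 0"
    by simp
  then have "\<not> (\<exists>B. B ** A = mat 1)"
    using invertible_det_nz invertible_left_inverse by blast
  then obtain g where g: "A *v g = 0" "g \<noteq> 0"
    unfolding matrix_left_invertible_ker by blast
  have "(A *v g) $ 5 = g $ 5"
    by (simp add: matrix_vector_mult_def sum_6 A_def J5)
  then have g5: "g $ 5 = 0"
    using g by simp
  then have "J *v g = A *v g"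
    unfolding vec_eq_iff forall_6 by (simp add: matrix_vector_mult_def sum_6 A_def)
  then show ?thesis
    using that g g5 by simp
qed

section \<open>The derived algebra and its dimension\<close>

definition derived :: "6 bracket \<Rightarrow> 6 euc set"
  where "derived c = span (range (\<lambda>(u, v). br c u v))"

lemma br_in_derived: "br c u v \<in> derived c"
  unfolding derived_def by (rule span_base) force

lemma br_derived_left:
  assumes "c \<in> nil_brackets" "f \<in> derived c"
  shows "br c f v = 0"
  using assms(2) unfolding derived_def
proof (induction f rule: span_induct)
  show "subspace {f. br c f v = 0}"
    by (auto simp: subspace_def br_simps)
qed (use assms(1) in \<open>auto simp: nil_brackets_def\<close>)

lemma br_derived_right:
  assumes "c \<in> nil_brackets" "f \<in> derived c"
  shows "br c v f = 0"
  using br_derived_left[OF assms, of v] br_skew[of c v f] by simp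

lemma derived_frame:
  fixes S :: "6 set"
  assumes "card S \<le> dim (derived c)"
  obtains b where "frame b" "\<And>i. i \<in> S \<Longrightarrow> b i \<in> derived c"
    "card S = dim (derived c) \<Longrightarrow> derived c = span (b ` S)"
proof -
  have sub: "subspace (derived c)"
    unfolding derived_def by (rule subspace_span)
  then obtain B where B: "B \<subseteq> derived c" "pairwise orthogonal B" "\<And>x. x \<in> B \<Longrightarrow> norm x = 1"
    "card B = dim (derived c)" "independent B" "span B = derived c"
    by (rule orthonormal_basis_subspace) blast
  have fB: "finite B"
    using B(5) by (rule independent_imp_finite)
  obtain B' where B': "B' \<subseteq> B" "card B' = card S"
    using assms B(4) by (metis obtain_subset_with_card_n)
  then obtain e where e: "bij_betw e S B'"
    using fB by (metis finite finite_same_card_bij finite_subset)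
  have eB: "e i \<in> B" if "i \<in> S" for i
    using e that B'(1) by (auto simp: bij_betw_def)
  have on: "e i \<bullet> e j = (if i = j then 1 else 0)" if "i \<in> S" "j \<in> S" for i j
  proof (cases "i = j")
    case True
    then show ?thesis
      using B(3)[OF eB[OF that(1)]] by (simp add: dot_square_norm)
  next
    case False
    then have "e i \<noteq> e j"
      using e that by (auto simp: bij_betw_def inj_on_def)
    then show ?thesis
      using B(2) eB that False by (auto simp: pairwise_def orthogonal_def)
  qed
  obtain b :: "6 \<Rightarrow> 6 euc" where b: "\<And>i j. b i \<bullet> b j = (if i = j then 1 else 0)" "\<And>i. i \<in> S \<Longrightarrow> b i = e i"
    by (rule orthonormal_extend[OF on]) blast+
  have "frame b"
    by unfold_locales (rule b(1))
  moreover have "b i \<in> derived c" if "i \<in> S" for i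
    using b(2) eB B(1) that by auto
  moreover have "derived c = span (b ` S)" if "card S = dim (derived c)"
  proof -
    have "B' = B"
      using B' B(4) fB that by (metis card_subset_eq)
    moreover have "b ` S = B'"
      using e b(2) by (auto simp: bij_betw_def)
    ultimately show ?thesis
      using B(6) by simp
  qed
  ultimately show ?thesis
    by (rule that)
qed

lemma br_frame_expand:
  assumes "frame b"
  shows "br c u v = (\<Sum>i\<in>UNIV. \<Sum>j\<in>UNIV. ((u \<bullet> b i) * (v \<bullet> b j)) *\<^sub>R br c (b i) (b j))"
proof -
  interpret frame b by (rule assms)
  have "br c u v = br c (\<Sum>i\<in>UNIV. (u \<bullet> b i) *\<^sub>R b i) (\<Sum>j\<in>UNIV. (v \<bullet> b j) *\<^sub>R b j)"
    by (simp flip: frame_expand)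
  also have "\<dots> = (\<Sum>(i, j)\<in>UNIV \<times> UNIV. br c ((u \<bullet> b i) *\<^sub>R b i) ((v \<bullet> b j) *\<^sub>R b j))"
    by (rule bilinear_sum[OF bilinear_br])
  also have "\<dots> = (\<Sum>i\<in>UNIV. \<Sum>j\<in>UNIV. ((u \<bullet> b i) * (v \<bullet> b j)) *\<^sub>R br c (b i) (b j))"
    by (simp add: sum.cartesian_product br_simps mult.commute)
  finally show ?thesis .
qed

lemma derived_subset_frame:
  assumes "frame b" "subspace W" "\<And>i j. br c (b i) (b j) \<in> W"
  shows "derived c \<subseteq> W"
  unfolding derived_def
proof (rule span_minimal[OF _ assms(2)])
  have "br c u v \<in> W" for u v
    unfolding br_frame_expand[OF assms(1), of c u v] by (intro subspace_sum subspace_scale assms(2,3))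
  then show "range (\<lambda>(u, v). br c u v) \<subseteq> W"
    by auto
qed

text \<open>The derived algebra is central. If it contained four orthonormal vectors, the bracket
  would live on a complement of dimension two, whose exterior square has dimension one.\<close>

lemma dim_derived_le_3:
  assumes c: "c \<in> nil_brackets"
  shows "dim (derived c) \<le> 3"
proof (rule ccontr)
  assume n: "\<not> ?thesis"
  then have "card {2, 3, 4, 5 :: 6} \<le> dim (derived c)"
    by simp
  then obtain b where b: "frame b" "\<And>i. i \<in> {2, 3, 4, 5} \<Longrightarrow> b i \<in> derived c"
    by (rule derived_frame) blast
  have z: "br c (b i) v = 0" "br c v (b i) = 0" if "i \<in> {2, 3, 4, 5}" for i v
    using b(2)[OF that] c br_derived_left br_derived_right by auto
  have "\<forall>i j. br c (b i) (b j) \<in> span {br c (b 0) (b 1)}"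
    unfolding forall_6 br_skew[of c "b 1" "b 0"] using z by (simp add: span_base span_zero span_neg)
  then have "derived c \<subseteq> span {br c (b 0) (b 1)}"
    using b(1) by (intro derived_subset_frame) auto
  then have "dim (derived c) \<le> dim {br c (b 0) (b 1)}"
    by (metis dim_span dim_subset)
  also have "\<dots> \<le> 1"
    using dim_le_card[of "{br c (b 0) (b 1)}" "{br c (b 0) (b 1)}"] by (simp add: span_superset)
  finally show False
    using n by simp
qed

text \<open>A second central direction is needed besides the derived one. The bracket is a single
  2-form on the complement, whose dimension five is odd, so the form has a kernel; its normalised
  vector \<open>G\<close> is the other axis.\<close>

lemma flat_of_dim_1:
  assumes c: "c \<in> nil_brackets" and d: "dim (derived c) = 1"
  shows "\<exists>x x' y y'. (c, param_bracket (x, x', y, y', 0)) \<in> isometry_rel"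
proof -
  have card: "card {5 :: 6} = dim (derived c)"
    by (simp add: d)
  obtain b where b': "frame b" "\<And>i. i \<in> {5} \<Longrightarrow> b i \<in> derived c" "derived c = span (b ` {5})"
    by (rule derived_frame[OF eq_imp_le[OF card]]) (use card in blast)
  then have b: "frame b" "b 5 \<in> derived c" "derived c = span {b 5}"
    by simp_all
  interpret frame b by (rule b(1))
  define J :: "real ^ 6 ^ 6" where "J = (\<chi> i j. br c (b i) (b j) \<bullet> b 5)"
  obtain g where g: "g \<noteq> 0" "g $ 5 = 0" "J *v g = 0"
  proof (rule skew_6_kernel)
    show "J $ j $ i = - J $ i $ j" for i j
      using br_skew[of c "b j" "b i"] by (simp add: J_def)
    show "J $ 5 $ j = 0" for j
      by (simp add: J_def br_derived_left[OF c b(2)])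
  qed
  define G where "G = toframe g /\<^sub>R norm g"
  have "norm (toframe g) = norm g"
    by (rule orthogonal_transformation_norm[OF orthogonal_toframe])
  then have "norm G = 1"
    using g(1) by (simp add: G_def)
  then have "G \<bullet> G = 1"
    by (simp add: dot_square_norm)
  moreover have "b 5 \<bullet> G = 0"
    using g(2) by (simp add: G_def toframe_def inner_sum_right on if_distrib[of "\<lambda>x. _ * x"] cong: if_cong)
  moreover have "br c G v = 0" for v
  proof -
    have bz: "br c (b i) (toframe g) = 0" for i
    proof -
      have "br c (b i) (toframe g) \<bullet> b 5 = (\<Sum>j\<in>UNIV. g $ j * (br c (b i) (b j) \<bullet> b 5))"
        unfolding toframe_def by (simp add: linear_sum[OF bilinear_br[unfolded bilinear_def, THEN conjunct1, rule_format]] br_simps inner_sum_left)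
      also have "\<dots> = (J *v g) $ i"
        by (simp add: J_def matrix_vector_mult_def mult.commute)
      finally have 0: "br c (b i) (toframe g) \<bullet> b 5 = 0"
        using g(3) by simp
      obtain k where "br c (b i) (toframe g) = k *\<^sub>R b 5"
        using br_in_derived[of c "b i" "toframe g"] unfolding b(3) by (auto simp: span_singleton)
      with 0 show ?thesis
        by (simp add: on)
    qed
    have "br c v (toframe g) = (\<Sum>i\<in>UNIV. (v \<bullet> b i) *\<^sub>R br c (b i) (toframe g))"
      by (subst (1) frame_expand[of v]) (simp add: linear_sum[OF bilinear_br[unfolded bilinear_def, THEN conjunct2, rule_format]] br_simps)
    then have "br c v (toframe g) = 0"
      by (simp add: bz)
    then show ?thesis
      using br_skew[of c "toframe g" v] by (simp add: G_def br_simps)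
  qed
  moreover have "br c u v \<in> span {b 5, G}" for u v
    using br_in_derived[of c u v] span_mono[of "{b 5}" "{b 5, G}"] unfolding b(3) by blast
  ultimately show ?thesis
    using on[of 5 5] br_derived_left[OF c b(2)] by (intro param_bracket_flat_exists[OF c, of "b 5" G]) simp_all
qed

section \<open>Singular value decomposition by maximisation\<close>

lemma max_rotation_orthogonal:
  fixes a b :: "'a :: real_inner"
  assumes "\<And>C S :: real. C\<^sup>2 + S\<^sup>2 = 1 \<Longrightarrow> norm (C *\<^sub>R a + S *\<^sub>R b) \<le> norm a"
  shows "a \<bullet> b = 0" "norm b \<le> norm a"
proof -
  show "norm b \<le> norm a"
    using assms[of 0 1] by simp
  have *: "C\<^sup>2 * (a \<bullet> a) + 2 * C * S * (a \<bullet> b) + S\<^sup>2 * (b \<bullet> b) \<le> a \<bullet> a" if "C\<^sup>2 + S\<^sup>2 = 1" for C S :: real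
  proof -
    have "(norm (C *\<^sub>R a + S *\<^sub>R b))\<^sup>2 \<le> (norm a)\<^sup>2"
      using assms[OF that] by (intro power_mono) auto
    then show ?thesis
      unfolding power2_norm_eq_inner
      by (simp add: inner_add_left inner_add_right inner_commute[of b a] power2_eq_square algebra_simps)
  qed
  show "a \<bullet> b = 0"
  proof (rule ccontr)
    assume nz: "a \<bullet> b \<noteq> 0"
    define A B where "A = a \<bullet> a" and "B = b \<bullet> b"
    \<comment> \<open>\<open>t\<close> is the tangent of the angle by which \<open>a\<close> is
      rotated towards \<open>b\<close>. With \<open>a \<bullet> b = t * (A + 1)\<close> the gain 2
      (A + 1) t^2 exceeds the loss A t^2 caused by normalisation; the summand 1 also covers
      \<open>a = 0\<close>.\<close>
    define t where "t = (a \<bullet> b) / (A + 1)"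
    have A: "A \<ge> 0" "B \<ge> 0"
      by (simp_all add: A_def B_def)
    have q: "1 + t\<^sup>2 > 0"
      by (simp add: add_pos_nonneg)
    define C S where "C = 1 / sqrt (1 + t\<^sup>2)" and "S = t / sqrt (1 + t\<^sup>2)"
    have CS: "C\<^sup>2 = 1 / (1 + t\<^sup>2)" "S\<^sup>2 = t\<^sup>2 / (1 + t\<^sup>2)" "C * S = t / (1 + t\<^sup>2)"
      using q by (simp_all add: C_def S_def power_divide)
    have "C\<^sup>2 + S\<^sup>2 = 1"
      using q by (simp add: CS field_simps)
    from *[OF this] have "A / (1 + t\<^sup>2) + 2 * (t / (1 + t\<^sup>2)) * (a \<bullet> b) + t\<^sup>2 / (1 + t\<^sup>2) * B \<le> A"
      by (simp add: CS mult.assoc A_def B_def)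
    then have "(A + 2 * t * (a \<bullet> b) + t\<^sup>2 * B) / (1 + t\<^sup>2) \<le> A"
      by (simp add: add_divide_distrib)
    then have "A + 2 * t * (a \<bullet> b) + t\<^sup>2 * B \<le> A * (1 + t\<^sup>2)"
      using q by (simp add: pos_divide_le_eq)
    moreover have "0 \<le> t\<^sup>2 * B"
      using A by simp
    ultimately have "2 * t * (a \<bullet> b) \<le> A * t\<^sup>2"
      by (simp add: algebra_simps)
    moreover have ab: "a \<bullet> b = t * (A + 1)"
      using A by (simp add: t_def)
    ultimately have "2 * (A + 1) * t\<^sup>2 \<le> A * t\<^sup>2"
      by (simp add: power2_eq_square algebra_simps)
    moreover have "t\<^sup>2 > 0"
      using nz ab by auto
    ultimately have "2 * (A + 1) \<le> A"
      by (simp add: mult_le_cancel_right)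
    then show False
      using A by simp
  qed
qed

definition triples :: "6 euc set \<Rightarrow> (6 euc \<times> 6 euc \<times> 6 euc) set"
  where "triples F = {(u, v, w). u \<bullet> u = 1 \<and> v \<bullet> v = 1 \<and> w \<bullet> w = 1 \<and> u \<bullet> v = 0 \<and> u \<bullet> w = 0 \<and> v \<bullet> w = 0 \<and>
    (\<forall>f\<in>F. u \<bullet> f = 0 \<and> v \<bullet> f = 0 \<and> w \<bullet> f = 0)}"

lemma triples_rotate:
  fixes C S :: real
  assumes "(u, v, w) \<in> triples F" "C\<^sup>2 + S\<^sup>2 = 1"
  shows "(u, C *\<^sub>R v + S *\<^sub>R w, C *\<^sub>R w - S *\<^sub>R v) \<in> triples F"
    "(C *\<^sub>R u + S *\<^sub>R w, v, C *\<^sub>R w - S *\<^sub>R u) \<in> triples F"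
    "(C *\<^sub>R u + S *\<^sub>R v, C *\<^sub>R v - S *\<^sub>R u, w) \<in> triples F"
proof -
  have CS: "C * C + S * S = 1"
    using assms(2) by (simp add: power2_eq_square)
  show "(u, C *\<^sub>R v + S *\<^sub>R w, C *\<^sub>R w - S *\<^sub>R v) \<in> triples F"
    "(C *\<^sub>R u + S *\<^sub>R w, v, C *\<^sub>R w - S *\<^sub>R u) \<in> triples F"
    "(C *\<^sub>R u + S *\<^sub>R v, C *\<^sub>R v - S *\<^sub>R u, w) \<in> triples F"
    using assms(1) CS by (simp_all add: triples_def inner_add_left inner_add_right inner_diff_left inner_diff_right
      inner_commute[of w u] inner_commute[of w v] inner_commute[of v u] add.commute)
qed

lemma compact_triples: "compact (triples F)"
proof -
  have "closed (triples F)"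
    unfolding triples_def case_prod_beta Ball_def
    by (intro closed_Collect_conj closed_Collect_all closed_Collect_imp closed_Collect_eq open_Collect_const continuous_intros)
  moreover have "bounded (triples F)"
  proof (rule bounded_subset)
    show "triples F \<subseteq> cball 0 1 \<times> cball 0 1 \<times> cball 0 1"
      by (auto simp: triples_def norm_eq_sqrt_inner)
    show "bounded (cball (0 :: 6 euc) 1 \<times> cball (0 :: 6 euc) 1 \<times> cball (0 :: 6 euc) 1)"
      by (intro bounded_Times bounded_cball)
  qed
  ultimately show ?thesis
    by (simp add: compact_eq_bounded_closed)
qed

lemma continuous_br:
  assumes "continuous_on S f" "continuous_on S g"
  shows "continuous_on S (\<lambda>x. br c (f x) (g x))"
proof -
  have "bounded_bilinear (br c)"
    using bilinear_br by (simp add: bilinear_conv_bounded_bilinear)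
  then show ?thesis
    using assms by (rule bounded_bilinear.continuous_on)
qed

text \<open>A triple maximising first \<open>\<bar>c(u, v)\<bar>\<close> and then \<open>\<bar>c(u, w)\<bar>\<close> is the orthonormal basis of a singular value
  decomposition of \<open>c\<close>.\<close>

lemma singular_triple_exists:
  assumes "triples F \<noteq> {}"
  obtains u v w where "(u, v, w) \<in> triples F" "norm (br c u w) \<le> norm (br c u v)" "norm (br c v w) \<le> norm (br c u w)"
    "br c u v \<bullet> br c u w = 0" "br c u v \<bullet> br c v w = 0" "br c u w \<bullet> br c v w = 0"
proof -
  obtain m where m: "m \<in> triples F"
    "\<And>x. x \<in> triples F \<Longrightarrow> norm (br c (fst x) (fst (snd x))) \<le> norm (br c (fst m) (fst (snd m)))"
    using continuous_attains_sup[OF compact_triples assms, of "\<lambda>x. norm (br c (fst x) (fst (snd x)))"]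
    by (force intro!: continuous_intros continuous_br)
  define a where "a = norm (br c (fst m) (fst (snd m)))"
  define K where "K = {x \<in> triples F. norm (br c (fst x) (fst (snd x))) = a}"
  have cl: "closed {x. norm (br c (fst x) (fst (snd x))) = a}"
    by (intro closed_Collect_eq continuous_intros continuous_br)
  have Keq: "K = triples F \<inter> {x. norm (br c (fst x) (fst (snd x))) = a}"
    by (auto simp: K_def)
  have "compact K"
    unfolding Keq by (rule compact_Int_closed[OF compact_triples cl])
  moreover have "K \<noteq> {}"
    using m(1) unfolding K_def a_def by blast
  ultimately obtain n where n: "n \<in> K"
    "\<And>x. x \<in> K \<Longrightarrow> norm (br c (fst x) (snd (snd x))) \<le> norm (br c (fst n) (snd (snd n)))"
    using continuous_attains_sup[of K "\<lambda>x. norm (br c (fst x) (snd (snd x)))"]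
    by (force intro!: continuous_intros continuous_br)
  obtain u v w where uvw: "n = (u, v, w)"
    by (cases n)
  have t: "(u, v, w) \<in> triples F" and na: "norm (br c u v) = a"
    using n(1) by (simp_all add: K_def uvw)
  have max1: "norm (br c x y) \<le> norm (br c u v)" if "(x, y, z) \<in> triples F" for x y z
    using m(2)[OF that] na by (simp add: a_def)
  have max2: "norm (br c x z) \<le> norm (br c u w)" if "(x, y, z) \<in> triples F" "norm (br c x y) = norm (br c u v)" for x y z
    using n(2)[of "(x, y, z)"] that na by (simp add: K_def uvw)
  have r1: "norm (C *\<^sub>R br c u v + S *\<^sub>R br c u w) \<le> norm (br c u v)" if "C\<^sup>2 + S\<^sup>2 = 1" for C S
    using max1[OF triples_rotate(1)[OF t that]] by (simp add: br_simps)
  have r2: "norm (C *\<^sub>R br c u v + S *\<^sub>R (- br c v w)) \<le> norm (br c u v)" if "C\<^sup>2 + S\<^sup>2 = 1" for C S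
    using max1[OF triples_rotate(2)[OF t that]] by (simp add: br_simps br_skew[of c w v])
  \<comment> \<open>Rotating in the plane of \<open>u\<close> and \<open>v\<close> leaves
    \<open>br c u v\<close> unchanged. The rotated triple is still a maximiser of the first problem,
    so the second maximality applies to it.\<close>
  have r3: "norm (C *\<^sub>R br c u w + S *\<^sub>R br c v w) \<le> norm (br c u w)" if "C\<^sup>2 + S\<^sup>2 = 1" for C S
  proof -
    have CS: "C * C + S * S = 1"
      using that by (simp add: power2_eq_square)
    have "br c (C *\<^sub>R u + S *\<^sub>R v) (C *\<^sub>R v - S *\<^sub>R u) = (C * C + S * S) *\<^sub>R br c u v"
      by (simp add: br_simps br_skew[of c v u] algebra_simps)
    then have "norm (br c (C *\<^sub>R u + S *\<^sub>R v) (C *\<^sub>R v - S *\<^sub>R u)) = norm (br c u v)"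
      by (simp add: CS)
    from max2[OF triples_rotate(3)[OF t that] this] show ?thesis
      by (simp add: br_simps)
  qed
  have o1: "br c u v \<bullet> br c u w = 0" "norm (br c u w) \<le> norm (br c u v)"
    using max_rotation_orthogonal[of "br c u v" "br c u w"] r1 by blast+
  have "br c u v \<bullet> (- br c v w) = 0"
    using max_rotation_orthogonal(1)[of "br c u v" "- br c v w"] r2 by blast
  then have o2: "br c u v \<bullet> br c v w = 0"
    by simp
  have o3: "br c u w \<bullet> br c v w = 0" "norm (br c v w) \<le> norm (br c u w)"
    using max_rotation_orthogonal[of "br c u w" "br c v w"] r3 by blast+
  show ?thesis
    by (rule that[OF t o1(2) o3(2) o1(1) o2 o3(1)])
qed

text \<open>The derived algebra and its complement both have dimension three. The images of a
  singular triple are orthogonal and span the derived algebra, so none vanishes, and normalising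
  them completes the triple to a frame.\<close>

lemma diag_param_of_dim_3:
  assumes c: "c \<in> nil_brackets" and d: "dim (derived c) = 3"
  shows "\<exists>a b h. a \<ge> b \<and> b \<ge> h \<and> h \<ge> 0 \<and> (c, param_bracket (diag_param a b h)) \<in> isometry_rel"
proof -
  have card: "card {3, 4, 5 :: 6} = dim (derived c)"
    by (simp add: d)
  obtain b where b: "frame b" "\<And>i. i \<in> {3, 4, 5} \<Longrightarrow> b i \<in> derived c" "derived c = span (b ` {3, 4, 5})"
    by (rule derived_frame[OF eq_imp_le[OF card]]) (use card in blast)
  interpret frame b by (rule b(1))
  let ?F = "b ` {3, 4, 5}"
  have "(b 0, b 1, b 2) \<in> triples ?F"
    by (simp add: triples_def on)
  then obtain u v w where t: "(u, v, w) \<in> triples ?F" and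
    le: "norm (br c u w) \<le> norm (br c u v)" "norm (br c v w) \<le> norm (br c u w)" and
    orth: "br c u v \<bullet> br c u w = 0" "br c u v \<bullet> br c v w = 0" "br c u w \<bullet> br c v w = 0"
    using singular_triple_exists[of ?F c] by (metis empty_iff)
  have perp: "u \<bullet> x = 0" "v \<bullet> x = 0" "w \<bullet> x = 0" if "x \<in> derived c" for x
  proof -
    have "orthogonal y x" if "y \<in> {u, v, w}" for y
      using \<open>x \<in> derived c\<close> unfolding b(3)
      by (rule orthogonal_to_span) (use t that in \<open>auto simp: triples_def orthogonal_def\<close>)
    then show "u \<bullet> x = 0" "v \<bullet> x = 0" "w \<bullet> x = 0"
      by (simp_all add: orthogonal_def)
  qed
  define e where "e i = (if i = 0 then u else if i = 1 then v else if i = 2 then w else b i)" for i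
  have e: "e 0 = u" "e 1 = v" "e 2 = w" "e 3 = b 3" "e 4 = b 4" "e 5 = b 5"
    by (simp_all add: e_def)
  have pb: "u \<bullet> b i = 0" "v \<bullet> b i = 0" "w \<bullet> b i = 0" "b i \<bullet> u = 0" "b i \<bullet> v = 0" "b i \<bullet> w = 0" if "i \<in> {3, 4, 5}" for i
    using perp[OF b(2)[OF that]] by (simp_all add: inner_commute)
  have tt: "u \<bullet> u = 1" "v \<bullet> v = 1" "w \<bullet> w = 1" "u \<bullet> v = 0" "u \<bullet> w = 0" "v \<bullet> w = 0" "v \<bullet> u = 0" "w \<bullet> u = 0" "w \<bullet> v = 0"
    using t by (simp_all add: triples_def inner_commute)
  have "\<forall>i j. e i \<bullet> e j = (if i = j then 1 else 0)"
    unfolding forall_6 e by (simp add: pb tt on)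
  then have fe: "frame e"
    by unfold_locales blast
  have z: "br c (b i) x = 0" "br c x (b i) = 0" if "i \<in> {3, 4, 5}" for i x
    using b(2)[OF that] c br_derived_left br_derived_right by auto
  let ?B = "{br c u v, br c u w, br c v w}"
  have "\<forall>i j. br c (e i) (e j) \<in> span ?B"
    unfolding forall_6 e br_skew[of c v u] br_skew[of c w u] br_skew[of c w v]
    by (simp add: z span_base span_zero span_neg)
  then have "derived c \<subseteq> span ?B"
    using fe by (intro derived_subset_frame) auto
  then have dB: "dim (derived c) \<le> dim ?B"
    by (metis dim_span dim_subset)
  have nz: "br c u v \<noteq> 0" "br c u w \<noteq> 0" "br c v w \<noteq> 0"
  proof -
    have "br c v w \<noteq> 0"
    proof
      assume 0: "br c v w = 0"
      have "dim ?B \<le> card {br c u v, br c u w}"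
        by (rule dim_le_card) (simp_all add: 0 span_base span_zero)
      also have "\<dots> \<le> 2"
        by (simp add: card_insert_if)
      finally show False
        using dB d by simp
    qed
    then show "br c u v \<noteq> 0" "br c u w \<noteq> 0" "br c v w \<noteq> 0"
      using le by auto
  qed
  \<comment> \<open>Placed to match \<open>param_form_diag_param\<close>: the smallest value on the
    fourth axis, the largest on the fifth, the middle one on the last.\<close>
  define f where "f i = (if i = 3 then br c v w /\<^sub>R norm (br c v w) else if i = 4 then br c u v /\<^sub>R norm (br c u v)
    else if i = 5 then br c u w /\<^sub>R norm (br c u w) else e i)" for i
  have f: "f 0 = u" "f 1 = v" "f 2 = w" "f 3 = br c v w /\<^sub>R norm (br c v w)" "f 4 = br c u v /\<^sub>R norm (br c u v)"
     "f 5 = br c u w /\<^sub>R norm (br c u w)"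
    by (simp_all add: f_def e)
  have unit: "(x /\<^sub>R norm x) \<bullet> (x /\<^sub>R norm x) = 1" if "x \<noteq> 0" for x :: "6 euc"
    using that by (simp add: dot_square_norm power2_eq_square)
  have pd: "x \<bullet> br c y y' = 0" "br c y y' \<bullet> x = 0" if "x \<in> {u, v, w}" for x y y'
    using that perp[OF br_in_derived[of c y y']] by (auto simp: inner_commute)
  have orth': "br c u w \<bullet> br c u v = 0" "br c v w \<bullet> br c u v = 0" "br c v w \<bullet> br c u w = 0"
    using orth by (simp_all add: inner_commute)
  have "\<forall>i j. f i \<bullet> f j = (if i = j then 1 else 0)"
    unfolding forall_6 f using unit[OF nz(1)] unit[OF nz(2)] unit[OF nz(3)] by (simp add: pd tt orth orth')
  then have ff: "frame f"
    by unfold_locales blast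
  have fd: "f i \<in> derived c" if "i \<in> {3, 4, 5}" for i
    using that br_in_derived unfolding derived_def by (auto simp: f intro!: span_scale)
  have zf: "br c (f i) x = 0" "br c x (f i) = 0" if "i \<in> {3, 4, 5}" for i x
    using fd[OF that] c br_derived_left br_derived_right by auto
  let ?m = "diag_param (norm (br c u v)) (norm (br c u w)) (norm (br c v w))"
  have "\<forall>i j. br c (f i) (f j) = (\<Sum>k\<in>UNIV. param_form ?m (axis i 1) (axis j 1) $ k *\<^sub>R f k)"
    unfolding forall_6 param_form_diag_param sum_6
    using nz by (simp add: zf) (simp add: axis_def f br_skew[of c v u] br_skew[of c w u] br_skew[of c w v])
  then have "(c, param_bracket ?m) \<in> isometry_rel"
    by (intro param_bracket_rel_frame[OF ff c param_bracket_diag_param_nil]) blast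
  then show ?thesis
    using le by (intro exI conjI) auto
qed

theorem normal_params_exists:
  assumes c: "c \<in> nil_brackets"
  shows "\<exists>m\<in>normal_params. (c, param_bracket m) \<in> isometry_rel"
proof -
  have P: "(x, x', y, y', 0) \<in> normal_params" for x x' y y'
    by (simp add: normal_params_def)
  consider "dim (derived c) = 0" | "dim (derived c) = 1" | "dim (derived c) = 2" | "dim (derived c) = 3"
    using dim_derived_le_3[OF c] by linarith
  then show ?thesis
  proof cases
    case 1
    then have "derived c \<subseteq> {0}"
      by (simp add: dim_eq_0)
    then have z: "br c u v = 0" for u v
      using br_in_derived by blast
    have "\<exists>x x' y y'. (c, param_bracket (x, x', y, y', 0)) \<in> isometry_rel"
      by (rule param_bracket_flat_exists[OF c, of "axis 4 1" "axis 5 1"]) (simp_all add: z inner_axis_axis span_zero)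
    then show ?thesis
      using P by blast
  next
    case 2
    then show ?thesis
      using flat_of_dim_1[OF c] P by blast
  next
    case 3
    then have card: "card {4, 5 :: 6} = dim (derived c)"
      by simp
    obtain b where b: "frame b" "\<And>i. i \<in> {4, 5} \<Longrightarrow> b i \<in> derived c" "derived c = span (b ` {4, 5})"
      by (rule derived_frame[OF eq_imp_le[OF card]]) (use card in blast)
    interpret frame b by (rule b(1))
    have "\<exists>x x' y y'. (c, param_bracket (x, x', y, y', 0)) \<in> isometry_rel"
    proof (rule param_bracket_flat_exists[OF c, of "b 4" "b 5"])
      show "br c u v \<in> span {b 4, b 5}" for u v
        using br_in_derived[of c u v] b(3) by simp
    qed (use b(2) in \<open>simp_all add: on br_derived_left[OF c]\<close>)
    then show ?thesis
      using P by blast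
  next
    case 4
    then obtain a b h where "a \<ge> b" "b \<ge> h" "h \<ge> 0" "(c, param_bracket (diag_param a b h)) \<in> isometry_rel"
      using diag_param_of_dim_3[OF c] by blast
    then show ?thesis
      unfolding normal_params_def by blast
  qed
qed

section \<open>The image of the coordinates\<close>

definition param_cone :: "(real ^ 9) set"
  where "param_cone = {e. (\<forall>i. e $ i \<ge> 0) \<and> e $ 8 = 0 \<and> (e $ 3 = 0 \<or> e $ 4 = 0) \<and> (e $ 5 = 0 \<or> e $ 6 = 0) \<and>
    (e $ 7 = 0 \<or> e $ 1 = 0 \<and> e $ 3 = 0 \<and> e $ 4 = 0 \<and> e $ 5 = 0 \<and> e $ 6 = 0)}"

text \<open>Positive semidefiniteness: half of the difference of the two sides is the smaller
  eigenvalue of the Gram matrix.\<close>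

lemma cmod_gramC_le: "cmod (gramC x x') \<le> gramT x x'"
proof (rule power2_le_imp_le)
  have "(x \<bullet> x')\<^sup>2 \<le> (x \<bullet> x) * (x' \<bullet> x')"
    by (rule Cauchy_Schwarz_ineq)
  then show "(cmod (gramC x x'))\<^sup>2 \<le> (gramT x x')\<^sup>2"
    unfolding cmod_power2 gramC_def gramT_def complex.sel by (simp add: power2_eq_square algebra_simps)
qed (simp add: gramT_def)

lemma pl_coords_in_param_cone:
  assumes "\<bar>r - s\<bar> \<le> t" "t \<le> r + s" "r \<le> p" "s \<le> q"
  shows "pl_coords p q r s t 0 \<in> param_cone"
proof -
  define \<rho> \<eta> where d: "\<rho> = r - s" "\<eta> = (p - r) - (q - s)"
  define \<nu> where n: "\<nu> = (\<bar>\<rho> + \<eta>\<bar> - \<bar>\<rho> - \<eta>\<bar>) / 2"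
  have "\<bar>\<eta>\<bar> \<le> (p - r) + (q - s)"
    using assms unfolding d by (auto simp: abs_if)
  moreover have "\<bar>\<nu>\<bar> + \<nu> = 0 \<or> \<bar>\<nu>\<bar> - \<nu> = 0" "\<bar>\<nu>\<bar> + \<nu> \<ge> 0" "\<bar>\<nu>\<bar> - \<nu> \<ge> 0"
    by linarith+
  moreover have "max (\<bar>\<rho>\<bar> - \<bar>\<eta>\<bar>) 0 = 0 \<or> max (\<bar>\<eta>\<bar> - \<bar>\<rho>\<bar>) 0 = 0"
    by (auto simp: max_def)
  ultimately show ?thesis
    using assms unfolding pl_coords_def Let_def d[symmetric] n[symmetric] param_cone_def mem_Collect_eq forall_9 vec9_nth by simp
qed

lemma coords_in_param_cone:
  assumes "m \<in> normal_params" shows "coords m \<in> param_cone"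
  using assms
proof (cases rule: normal_params_cases)
  case (flat x x' y y')
  have "\<bar>cmod (gramC x x') - cmod (gramC y y')\<bar> \<le> cmod (gramC x x' + gramC y y')"
    using norm_triangle_ineq3[of "gramC x x'" "- gramC y y'"] by simp
  then show ?thesis
    unfolding flat coords_def prod.case by (intro pl_coords_in_param_cone norm_triangle_ineq cmod_gramC_le)
next
  case (diag_param a b h)
  have "h\<^sup>2 \<le> b\<^sup>2" "b\<^sup>2 \<le> a\<^sup>2"
    using diag_param by (intro power_mono; simp)+
  moreover have "coords m = vec9 (b\<^sup>2 - h\<^sup>2) 0 ((a\<^sup>2 - b\<^sup>2) / 2) 0 0 0 0 (3 * h\<^sup>2 / 2)"
    unfolding diag_param(1) using diag_param by (intro coords_diag_param) simp_all
  ultimately show ?thesis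
    by (simp add: param_cone_def forall_9)
qed

text \<open>Orthogonal vectors whose squared lengths are the eigenvalues, half of \<open>p\<close>
  plus and minus the modulus of \<open>w\<close>, realise the modulus. A rotation by half the
  argument then restores \<open>w\<close> itself.\<close>

lemma gram_exists:
  assumes "cmod w \<le> p"
  shows "\<exists>x x'. gramT x x' = p \<and> gramC x x' = w"
proof -
  have p: "0 \<le> p"
    using assms norm_ge_zero order_trans by blast
  define x :: "real ^ 3" where "x = axis 1 (sqrt ((p + cmod w) / 2))"
  define x' :: "real ^ 3" where "x' = axis 2 (sqrt ((p - cmod w) / 2))"
  have i: "x \<bullet> x = (p + cmod w) / 2" "x' \<bullet> x' = (p - cmod w) / 2" "x \<bullet> x' = 0"
    using assms p unfolding x_def x'_def diag_param_nth by simp_all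
  define \<theta> where "\<theta> = - Arg w / 2"
  have "gramC x x' = of_real (cmod w)"
    by (simp add: gramC_def i complex_eq_iff field_simps)
  moreover have "gramT x x' = p"
    by (simp add: gramT_def i field_simps)
  moreover have "cis (- 2 * \<theta>) * of_real (cmod w) = w"
    using rcis_cmod_Arg[of w] by (simp add: \<theta>_def rcis_def mult.commute)
  ultimately show ?thesis
    using gram_rot[of \<theta> x x'] by metis
qed

lemma triangle_exists:
  assumes "\<bar>r - s\<bar> \<le> t" "t \<le> r + s"
  shows "\<exists>w z. cmod w = r \<and> cmod z = s \<and> cmod (w + z) = t"
proof (cases "r = 0")
  case True
  then have "s = t" "s \<ge> 0"
    using assms by linarith+
  then show ?thesis
    using True by (intro exI[of _ 0] exI[of _ "of_real s"]) simp
next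
  case False
  then have r: "r > 0" and s: "s \<ge> 0" and t: "t \<ge> 0"
    using assms by linarith+
  \<comment> \<open>By the law of cosines this is the real part of the second number when the first
    is \<open>r\<close>.\<close>
  define k where "k = (t\<^sup>2 - r\<^sup>2 - s\<^sup>2) / (2 * r)"
  have rk: "2 * r * k = t\<^sup>2 - r\<^sup>2 - s\<^sup>2"
    using r by (simp add: k_def)
  have "t\<^sup>2 \<le> (r + s)\<^sup>2" "\<bar>r - s\<bar>\<^sup>2 \<le> t\<^sup>2"
    using assms t by (intro power_mono; simp)+
  then have "2 * r * k \<le> 2 * r * s" "2 * r * (- s) \<le> 2 * r * k"
    unfolding rk by (simp_all add: power2_eq_square algebra_simps)
  moreover have "0 < 2 * r"
    using r by simp
  ultimately have "k \<le> s" "- s \<le> k"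
    by (blast intro: mult_left_le_imp_le)+
  then have k: "k\<^sup>2 \<le> s\<^sup>2"
    using s by (simp add: abs_le_square_iff[symmetric])
  define z where "z = Complex k (sqrt (s\<^sup>2 - k\<^sup>2))"
  have z2: "(cmod z)\<^sup>2 = s\<^sup>2"
    using k by (simp add: z_def cmod_power2)
  then have "cmod z = s"
    using s by (simp add: power2_eq_iff_nonneg)
  moreover have "(cmod (of_real r + z))\<^sup>2 = t\<^sup>2"
    using k rk by (simp add: z_def cmod_power2 power2_sum)
  then have "cmod (of_real r + z) = t"
    using t by (simp add: power2_eq_iff_nonneg)
  moreover have "cmod (of_real r) = r"
    using r by simp
  ultimately show ?thesis
    by blast
qed

lemma coords_surj:
  assumes "e \<in> param_cone"
  shows "\<exists>m\<in>normal_params. coords m = e"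
proof (cases "e $ 7 = 0")
  case False
  have e: "e $ i \<ge> 0" "e $ 8 = 0" "e $ 1 = 0" "e $ 3 = 0" "e $ 4 = 0" "e $ 5 = 0" "e $ 6 = 0" for i
    using assms False by (auto simp: param_cone_def)
  \<comment> \<open>The formula of \<open>coords_diag_param\<close> solved for the singular
    values.\<close>
  define h b a where "h = sqrt (2 * e $ 7 / 3)" and "b = sqrt (e $ 0 + 2 * e $ 7 / 3)"
    and "a = sqrt (2 * e $ 2 + e $ 0 + 2 * e $ 7 / 3)"
  have sq: "h\<^sup>2 = 2 * e $ 7 / 3" "b\<^sup>2 = e $ 0 + 2 * e $ 7 / 3" "a\<^sup>2 = 2 * e $ 2 + e $ 0 + 2 * e $ 7 / 3"
    using e(1) by (simp_all add: h_def b_def a_def)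
  have o: "a \<ge> b" "b \<ge> h" "h \<ge> 0" "b \<ge> 0"
    using e(1) by (simp_all add: h_def b_def a_def)
  have "coords (diag_param a b h) = e"
    unfolding coords_diag_param[OF o(1,4)] sq by (simp add: vec9_eq_iff e)
  moreover have "diag_param a b h \<in> normal_params"
    using o unfolding normal_params_def by blast
  ultimately show ?thesis
    by blast
next
  case True
  have e: "e $ i \<ge> 0" "e $ 8 = 0" "e $ 3 = 0 \<or> e $ 4 = 0" "e $ 5 = 0 \<or> e $ 6 = 0" for i
    using assms by (auto simp: param_cone_def)
  \<comment> \<open>Here the fold is undone: \<open>\<nu>\<close> carries the sign of the product of
    the differences \<open>\<rho>\<close> and \<open>\<eta>\<close>, and of the two preimages the
    one with \<open>\<rho>\<close> nonnegative is taken. Entries 2, 1 and 0 are then solved for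
    \<open>t\<close>, \<open>\<sigma> = r + s\<close> and \<open>\<tau> = p + q\<close>.\<close>
  define \<nu> where "\<nu> = (e $ 5 - e $ 6) / 2"
  have av: "\<bar>\<nu>\<bar> = (e $ 5 + e $ 6) / 2"
    using e(4) e(1)[of 5] e(1)[of 6] by (auto simp: \<nu>_def)
  define \<rho> where "\<rho> = e $ 3 + \<bar>\<nu>\<bar>"
  define \<eta> where "\<eta> = (if \<nu> \<ge> 0 then e $ 4 + \<bar>\<nu>\<bar> else - (e $ 4 + \<bar>\<nu>\<bar>))"
  have \<rho>: "\<rho> \<ge> 0" and a\<eta>: "\<bar>\<eta>\<bar> = e $ 4 + \<bar>\<nu>\<bar>"
    using e(1)[of 3] e(1)[of 4] by (simp_all add: \<rho>_def \<eta>_def)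
  have \<nu>: "(\<bar>\<rho> + \<eta>\<bar> - \<bar>\<rho> - \<eta>\<bar>) / 2 = \<nu>"
    using e(1)[of 3] e(1)[of 4] e(3) unfolding \<rho>_def \<eta>_def by (auto simp: abs_if split: if_splits)
  define t \<sigma> \<tau> where "t = e $ 2 + \<rho>" and "\<sigma> = e $ 1 + t" and "\<tau> = e $ 0 + \<sigma> + \<bar>\<eta>\<bar>"
  define r s p q where "r = (\<sigma> + \<rho>) / 2" and "s = (\<sigma> - \<rho>) / 2" and "p = (\<tau> + \<rho> + \<eta>) / 2" and "q = (\<tau> - \<rho> - \<eta>) / 2"
  have rs: "r - s = \<rho>" "r + s = \<sigma>" "p + q = \<tau>" "(p - r) - (q - s) = \<eta>"
    by (simp_all add: r_def s_def p_def q_def field_simps)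
  have pr: "2 * (p - r) = e $ 0 + \<bar>\<eta>\<bar> + \<eta>" "2 * (q - s) = e $ 0 + \<bar>\<eta>\<bar> - \<eta>"
    by (simp_all add: p_def q_def r_def s_def \<tau>_def field_simps)
  have e0: "0 \<le> e $ 0"
    by (rule e)
  have *: "Z \<le> U" if "2 * (U - Z) = E + A + n" "0 \<le> E" "- n \<le> A" for Z U E A n :: real
    using that by argo
  have "r \<le> p"
    by (rule *[OF pr(1) e0 abs_ge_minus_self])
  have "s \<le> q"
    by (rule *[of q s "e $ 0" "\<bar>\<eta>\<bar>" "- \<eta>"]) (use pr(2) e0 in \<open>simp_all only: diff_conv_add_uminus minus_minus abs_ge_self\<close>)
  have "\<bar>r - s\<bar> \<le> t" "t \<le> r + s"
    unfolding rs using \<rho> e(1)[of 1] e(1)[of 2] by (simp_all add: t_def \<sigma>_def)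
  then obtain w z where wz: "cmod w = r" "cmod z = s" "cmod (w + z) = t"
    using triangle_exists by blast
  obtain x x' where x: "gramT x x' = p" "gramC x x' = w"
    using gram_exists[of w p] wz \<open>r \<le> p\<close> by auto
  obtain y y' where y: "gramT y y' = q" "gramC y y' = z"
    using gram_exists[of z q] wz \<open>s \<le> q\<close> by auto
  have "coords (x, x', y, y', 0) = pl_coords p q r s t 0"
    by (simp add: coords_def x y wz)
  also have "\<dots> = vec9 (\<tau> - \<sigma> - \<bar>\<eta>\<bar>) (\<sigma> - t) (t - \<rho>) (max (\<rho> - \<bar>\<eta>\<bar>) 0) (max (\<bar>\<eta>\<bar> - \<rho>) 0) (\<bar>\<nu>\<bar> + \<nu>) (\<bar>\<nu>\<bar> - \<nu>) 0"
    unfolding pl_coords_def Let_def rs \<nu> by (simp add: \<rho> vec9_eq_iff flip: rs(2,3))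
  also have "\<dots> = e"
    using e(3) e(1)[of 3] e(1)[of 4] True e(2) unfolding vec9_eq_iff vec9_nth
    by (auto simp: \<tau>_def \<sigma>_def t_def a\<eta> \<rho>_def av) (simp_all add: \<nu>_def field_simps)
  finally have "coords (x, x', y, y', 0) = e" .
  moreover have "(x, x', y, y', 0) \<in> normal_params"
    by (simp add: normal_params_def)
  ultimately show ?thesis
    by blast
qed

text \<open>For the coordinates of a bracket this is half of Tr(c* c), which turns the normalisation
  in \<open>moduli0\<close> into a linear equation.\<close>

lemma sum_pl_coords: "sum (($) (pl_coords p q r s t h)) UNIV = p + q + h\<^sup>2 / 2"
proof -
  have *: "max (R - E) 0 + max (E - R) 0 + 2 * min R E = R + E" for R E :: real
    by (simp add: max_def min_def)
  show ?thesis
    unfolding sum_9 pl_coords_def Let_def vec9_nth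
    using folded_min[of "r - s" "(p - r) - (q - s)"] *[of "\<bar>r - s\<bar>" "\<bar>(p - r) - (q - s)\<bar>"] by simp
qed

section \<open>The simplicial complex\<close>

definition axes_hull :: "9 set \<Rightarrow> (real ^ 9) set"
  where "axes_hull V = convex hull ((\<lambda>i. axis i 1) ` V)"

lemma inj_axis: "inj_on (\<lambda>i. axis i 1 :: real ^ 'n :: finite) V"
  by (auto simp: inj_on_def axis_eq_axis)

lemma axes_hull_eq: "axes_hull V = {e. (\<forall>i. 0 \<le> e $ i) \<and> (\<forall>i. i \<notin> V \<longrightarrow> e $ i = 0) \<and> sum (($) e) UNIV = 1}"
proof -
  have fin: "finite ((\<lambda>i. axis i 1 :: real ^ 9) ` V)"
    by simp
  have comp: "(\<Sum>i\<in>V. k i *\<^sub>R axis i 1 :: real ^ 9) $ j = (if j \<in> V then k j else 0)" for k j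
    by (simp add: axis_def if_distrib[of "\<lambda>x. _ * x"] cong: if_cong)
  show ?thesis
  proof (intro subset_antisym subsetI)
    fix e assume "e \<in> axes_hull V"
    then obtain u where u0: "\<forall>x\<in>(\<lambda>i. axis i 1) ` V. 0 \<le> u x" "sum u ((\<lambda>i. axis i 1) ` V) = 1"
        "(\<Sum>x\<in>(\<lambda>i. axis i 1) ` V. u x *\<^sub>R x) = e"
      unfolding axes_hull_def convex_hull_finite[OF fin] by blast
    have u: "\<forall>i\<in>V. 0 \<le> u (axis i 1)" "(\<Sum>i\<in>V. u (axis i 1)) = 1" "(\<Sum>i\<in>V. u (axis i 1) *\<^sub>R axis i 1) = e"
      using u0 by (simp_all add: sum.reindex[OF inj_axis])
    have e: "e $ j = (if j \<in> V then u (axis j 1) else 0)" for j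
      using comp[of "\<lambda>i. u (axis i 1)" j] by (simp only: u(3))
    have "sum (($) e) UNIV = (\<Sum>i\<in>V. u (axis i 1))"
      by (simp add: e sum.If_cases)
    then show "e \<in> {e. (\<forall>i. 0 \<le> e $ i) \<and> (\<forall>i. i \<notin> V \<longrightarrow> e $ i = 0) \<and> sum (($) e) UNIV = 1}"
      using u by (simp add: e)
  next
    fix e :: "real ^ 9" assume e: "e \<in> {e. (\<forall>i. 0 \<le> e $ i) \<and> (\<forall>i. i \<notin> V \<longrightarrow> e $ i = 0) \<and> sum (($) e) UNIV = 1}"
    have s: "(\<Sum>i\<in>V. e $ i) = sum (($) e) UNIV"
      by (rule sum.mono_neutral_left) (use e in auto)
    have "(\<Sum>i\<in>V. e $ i *\<^sub>R axis i 1) = e"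
      unfolding vec_eq_iff comp using e by auto
    then have "(\<Sum>i\<in>V. e $ i *\<^sub>R axis i 1) \<in> axes_hull V \<Longrightarrow> e \<in> axes_hull V"
      by simp
    moreover have "(\<Sum>i\<in>V. e $ i *\<^sub>R axis i 1) \<in> axes_hull V"
      unfolding axes_hull_def by (rule convex_sum) (use e s in \<open>auto simp: hull_inc\<close>)
    ultimately show "e \<in> axes_hull V"
      by blast
  qed
qed

lemma affine_independent_axes: "\<not> affine_dependent ((\<lambda>i. axis i 1 :: real ^ 9) ` V)"
proof -
  have "(\<lambda>i. axis i 1 :: real ^ 9) ` V \<subseteq> Basis"
    by (auto simp: Basis_vec_def)
  then have "independent ((\<lambda>i. axis i 1 :: real ^ 9) ` V)"
    by (rule independent_mono[OF independent_Basis])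
  then show ?thesis
    using affine_dependent_imp_dependent by blast
qed

lemma axes_hull_Int: "axes_hull V \<inter> axes_hull W = axes_hull (V \<inter> W)"
  unfolding axes_hull_eq by auto

lemma face_of_face: "T face_of axes_hull V \<longleftrightarrow> (\<exists>W\<subseteq>V. T = axes_hull W)"
  unfolding axes_hull_def face_of_convex_hull_affine_independent[OF affine_independent_axes]
  by (metis image_mono subset_imageE)

lemma aff_dim_face: "aff_dim (axes_hull V) = int (card V) - 1"
  using aff_dim_affine_independent[OF affine_independent_axes[of V]] card_image[OF inj_axis, of V]
  unfolding axes_hull_def aff_dim_convex_hull by simp

text \<open>The four 4-simplices are the joins of the triangle 0, 1, 2 with the edges of the 4-cycle
  3, 5, 4, 6. This cycle is the circle of directions of the folded plane: 3 and 4 come from its two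
  axes, 5 and 6 from its diagonals. The triangle 0, 2, 7 meets them in the edge 0, 2.\<close>

definition cells :: "9 set set"
  where "cells = Pow {0, 1, 2, 3, 5} \<union> Pow {0, 1, 2, 3, 6} \<union> Pow {0, 1, 2, 4, 5} \<union> Pow {0, 1, 2, 4, 6} \<union> Pow {0, 2, 7}"

lemma simplicial_complex_faces: "simplicial_complex (axes_hull ` cells)"
proof -
  have "\<exists>n. n simplex axes_hull V" for V
    unfolding Polytope.simplex axes_hull_def
    using affine_independent_axes[of V] card_image[OF inj_axis, of V]
    by (intro exI[of _ "int (card V) - 1"] exI[of _ "(\<lambda>i. axis i 1) ` V"]) auto
  moreover have "F \<in> axes_hull ` cells" if "V \<in> cells" "F face_of axes_hull V" for V F
    using that unfolding face_of_face cells_def by blast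
  moreover have "axes_hull V \<inter> axes_hull W face_of axes_hull V" for V W
    unfolding axes_hull_Int face_of_face by blast
  ultimately show ?thesis
    unfolding simplicial_complex_def by (auto simp: cells_def)
qed

lemma complex_dim_faces: "complex_dim (axes_hull ` cells) = 4"
  unfolding complex_dim_def
proof (rule Max_eqI)
  show "finite (aff_dim ` axes_hull ` cells)"
    by (simp add: cells_def)
  show "d \<le> 4" if "d \<in> aff_dim ` axes_hull ` cells" for d
  proof -
    obtain V where V: "V \<in> cells" "d = int (card V) - 1"
      using \<open>d \<in> _\<close> by (auto simp: aff_dim_face)
    have "card V \<le> 5"
    proof -
      have "\<exists>W. V \<subseteq> W \<and> card W \<le> 5"
        using V(1) unfolding cells_def by (elim UnE PowD[elim_format]) (rule exI, erule conjI, simp)+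
      then show ?thesis
        by (meson card_mono finite order_trans)
    qed
    then show ?thesis
      by (simp add: V(2))
  qed
  have "{0, 1, 2, 3, 5} \<in> cells"
    unfolding cells_def by blast
  moreover have "aff_dim (axes_hull {0, 1, 2, 3, 5}) = 4"
    by (simp add: aff_dim_face)
  ultimately show "4 \<in> aff_dim ` axes_hull ` cells"
    by (metis image_eqI)
qed

text \<open>The disjunctions in \<open>param_cone\<close> say exactly that the support of the point
  lies in a cell.\<close>

lemma Union_faces: "\<Union>(axes_hull ` cells) = {e \<in> param_cone. sum (($) e) UNIV = 1}"
proof (intro subset_antisym subsetI)
  fix e assume "e \<in> \<Union>(axes_hull ` cells)"
  then obtain V where "V \<in> cells" "e \<in> axes_hull V"
    by blast
  then show "e \<in> {e \<in> param_cone. sum (($) e) UNIV = 1}"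
    unfolding axes_hull_eq param_cone_def cells_def Un_iff Pow_iff by (elim disjE) auto
next
  fix e assume e: "e \<in> {e \<in> param_cone. sum (($) e) UNIV = 1}"
  have *: "e \<in> \<Union>(axes_hull ` cells)" if "V \<in> cells" "\<forall>i. i \<notin> V \<longrightarrow> e $ i = 0" for V
    using that e unfolding axes_hull_eq param_cone_def by blast
  consider "e $ 7 = 0" "e $ 3 = 0" "e $ 5 = 0" | "e $ 7 = 0" "e $ 3 = 0" "e $ 6 = 0"
    | "e $ 7 = 0" "e $ 4 = 0" "e $ 5 = 0" | "e $ 7 = 0" "e $ 4 = 0" "e $ 6 = 0"
    | "e $ 1 = 0 \<and> e $ 3 = 0 \<and> e $ 4 = 0 \<and> e $ 5 = 0 \<and> e $ 6 = 0"
    using e unfolding param_cone_def by blast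
  moreover have "e $ 8 = 0"
    using e by (simp add: param_cone_def)
  ultimately show "e \<in> \<Union>(axes_hull ` cells)"
  proof cases
    case 1
    then show ?thesis
      using \<open>e $ 8 = 0\<close> by (intro *[of "{0, 1, 2, 4, 6}"]) (simp_all add: cells_def forall_9)
  next
    case 2
    then show ?thesis
      using \<open>e $ 8 = 0\<close> by (intro *[of "{0, 1, 2, 4, 5}"]) (simp_all add: cells_def forall_9)
  next
    case 3
    then show ?thesis
      using \<open>e $ 8 = 0\<close> by (intro *[of "{0, 1, 2, 3, 6}"]) (simp_all add: cells_def forall_9)
  next
    case 4
    then show ?thesis
      using \<open>e $ 8 = 0\<close> by (intro *[of "{0, 1, 2, 3, 5}"]) (simp_all add: cells_def forall_9)
  next
    case 5
    then show ?thesis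
      using \<open>e $ 8 = 0\<close> by (intro *[of "{0, 2, 7}"]) (simp_all add: cells_def forall_9)
  qed
qed

lemma contractible_faces: "contractible (\<Union>(axes_hull ` cells))"
proof (rule starlike_imp_contractible)
  have "\<exists>a\<in>\<Union>(axes_hull ` cells). \<forall>x\<in>\<Union>(axes_hull ` cells). closed_segment a x \<subseteq> \<Union>(axes_hull ` cells)"
  proof (intro bexI[of _ "axis 0 1"] ballI)
    have ax: "axis 0 1 \<in> axes_hull (insert 0 V)" for V
      unfolding axes_hull_def by (rule hull_inc) simp
    \<comment> \<open>Vertex 0 lies in every maximal cell, so the complex is starlike about
      it.\<close>
    have ins: "insert 0 V \<in> cells" if "V \<in> cells" for V
      using that unfolding cells_def by blast
    fix x assume "x \<in> \<Union>(axes_hull ` cells)"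
    then obtain V where V: "V \<in> cells" "x \<in> axes_hull V"
      by blast
    have "x \<in> axes_hull (insert 0 V)"
      using V(2) hull_mono[of "(\<lambda>i. axis i 1) ` V" "(\<lambda>i. axis i 1) ` insert 0 V" convex] unfolding axes_hull_def by blast
    then have "closed_segment (axis 0 1) x \<subseteq> axes_hull (insert 0 V)"
      using ax[of V] unfolding axes_hull_def by (intro closed_segment_subset convex_convex_hull)
    then show "closed_segment (axis 0 1) x \<subseteq> \<Union>(axes_hull ` cells)"
      using ins[OF V(1)] by blast
  next
    have "axis 0 1 \<in> axes_hull {0}"
      unfolding axes_hull_def by (rule hull_inc) simp
    moreover have "{0} \<in> cells"
      unfolding cells_def by blast
    ultimately show "axis 0 1 \<in> \<Union>(axes_hull ` cells)"
      by blast
  qed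
  then show "starlike (\<Union>(axes_hull ` cells))"
    unfolding starlike_def .
qed

section \<open>The quotient map\<close>

definition bracket_norm2 :: "6 bracket \<Rightarrow> real"
  where "bracket_norm2 c = (\<Sum>i\<in>UNIV. \<Sum>j\<in>UNIV. (norm (br c (axis i 1) (axis j 1)))\<^sup>2)"

text \<open>The Hilbert-Schmidt norm does not depend on the orthonormal basis: passing to the
  adjoint reduces this to Parseval's identity.\<close>

lemma (in frame) sum_norm_frame:
  assumes L: "linear L"
  shows "(\<Sum>i\<in>UNIV. (norm (L (b i) :: real ^ 'm :: finite))\<^sup>2) = (\<Sum>i\<in>UNIV. (norm (L (axis i 1)))\<^sup>2)"
proof -
  have parseval: "(\<Sum>i\<in>UNIV. (w \<bullet> b i)\<^sup>2) = (\<Sum>i\<in>UNIV. (w \<bullet> axis i 1)\<^sup>2)" for w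
  proof -
    have "w \<bullet> w = w \<bullet> (\<Sum>i\<in>UNIV. (w \<bullet> b i) *\<^sub>R b i)"
      by (subst frame_expand[of w, symmetric]) (rule refl)
    also have "\<dots> = (\<Sum>i\<in>UNIV. (w \<bullet> b i)\<^sup>2)"
      by (simp add: inner_sum_right power2_eq_square)
    finally show ?thesis
      by (simp add: inner_axis inner_vec_def[of w w] power2_eq_square)
  qed
  have swap: "(\<Sum>i\<in>UNIV. (norm (L (f i)))\<^sup>2) = (\<Sum>k\<in>UNIV. \<Sum>i\<in>UNIV. (adjoint L (axis k 1) \<bullet> f i)\<^sup>2)" for f :: "'n \<Rightarrow> _"
  proof -
    have "(norm (L x))\<^sup>2 = (\<Sum>k\<in>UNIV. (adjoint L (axis k 1) \<bullet> x)\<^sup>2)" for x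
      unfolding power2_norm_eq_inner inner_vec_def[of "L x"]
      by (simp add: inner_commute[of _ x] adjoint_works[OF L] inner_axis power2_eq_square)
    then show ?thesis
      by (subst sum.swap) simp
  qed
  show ?thesis
    unfolding swap parseval ..
qed

lemma bracket_norm2_isometry:
  assumes "(c, d) \<in> isometry_rel"
  shows "bracket_norm2 c = bracket_norm2 d"
proof -
  obtain T where T: "orthogonal_transformation T" "\<And>u v. br d (T u) (T v) = T (br c u v)"
    using isometry_relE[OF assms] by blast
  interpret frame "\<lambda>i. T (axis i 1)"
    using T(1) by unfold_locales (simp add: orthogonal_transformation_def inner_axis_axis)
  have lin: "linear (\<lambda>u. br d u v)" "linear (\<lambda>v. br d u v)" for u v
    using bilinear_br[of d] by (simp_all add: bilinear_def)
  have "bracket_norm2 c = (\<Sum>i\<in>UNIV. \<Sum>j\<in>UNIV. (norm (br d (T (axis i 1)) (T (axis j 1))))\<^sup>2)"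
    by (simp add: bracket_norm2_def T(2) orthogonal_transformation_norm[OF T(1)])
  also have "\<dots> = (\<Sum>i\<in>UNIV. \<Sum>j\<in>UNIV. (norm (br d (T (axis i 1)) (axis j 1)))\<^sup>2)"
    unfolding sum_norm_frame[OF lin(2)] ..
  also have "\<dots> = (\<Sum>j\<in>UNIV. \<Sum>i\<in>UNIV. (norm (br d (T (axis i 1)) (axis j 1)))\<^sup>2)"
    by (rule sum.swap)
  also have "\<dots> = (\<Sum>j\<in>UNIV. \<Sum>i\<in>UNIV. (norm (br d (axis i 1) (axis j 1)))\<^sup>2)"
    unfolding sum_norm_frame[OF lin(1)] ..
  also have "\<dots> = bracket_norm2 d"
    unfolding bracket_norm2_def by (rule sum.swap)
  finally show ?thesis .
qed

lemma bracket_norm2_param_bracket: "bracket_norm2 (param_bracket (x, x', y, y', h)) = 4 * (gramT x x' + gramT y y') + 2 * h\<^sup>2"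
  unfolding bracket_norm2_def sum_6 br_param_bracket param_form_def prod.case power2_norm_eq_inner inner_6 vec6_nth gramT_def inner_3 sform_def
  by (simp add: axis_def power2_eq_square algebra_simps)

lemma sum_coords: "4 * sum (($) (coords m)) UNIV = bracket_norm2 (param_bracket m)"
proof -
  obtain x x' y y' h where m: "m = (x, x', y, y', h)"
    by (cases m)
  have "sum (($) (coords m)) UNIV = gramT x x' + gramT y y' + h\<^sup>2 / 2"
    unfolding m coords_def prod.case by (rule sum_pl_coords)
  then show ?thesis
    by (simp add: m bracket_norm2_param_bracket)
qed

text \<open>There are 36 pairs of axes. Only some bound by the operator norm matters, for the
  properness of the group action.\<close>

lemma bracket_norm2_le: "bracket_norm2 c \<le> 36 * (norm c)\<^sup>2"
proof -
  have "norm (br c (axis i 1) (axis j 1)) \<le> norm c" for i j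
  proof -
    have "norm (br c (axis i 1) (axis j 1)) \<le> norm c * norm (axis i 1 \<and>\<^sub>\<Lambda> axis j (1 :: real))"
      by (rule norm_blinfun)
    also have "\<dots> \<le> norm c * (norm (axis i (1 :: real)) * norm (axis j (1 :: real)))"
      by (intro mult_left_mono norm_wedge_le norm_ge_zero)
    finally show ?thesis
      by simp
  qed
  then have "bracket_norm2 c \<le> (\<Sum>i\<in>(UNIV :: 6 set). \<Sum>j\<in>(UNIV :: 6 set). (norm c)\<^sup>2)"
    unfolding bracket_norm2_def by (intro sum_mono power_mono) simp_all
  then show ?thesis
    by simp
qed

lemma bounded_bracket_norm2_param_bracket: "bounded {m. bracket_norm2 (param_bracket m) \<le> R}"
proof (rule bounded_subset)
  show "{m. bracket_norm2 (param_bracket m) \<le> R} \<subseteq> cball 0 (1 + R) \<times> cball 0 (1 + R) \<times> cball 0 (1 + R) \<times> cball 0 (1 + R) \<times> cball 0 (1 + R)"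
  proof
    fix m assume "m \<in> {m. bracket_norm2 (param_bracket m) \<le> R}"
    moreover obtain x x' y y' h where m: "m = (x, x', y, y', h)"
      by (cases m)
    ultimately have R: "4 * ((norm x)\<^sup>2 + (norm x')\<^sup>2 + (norm y)\<^sup>2 + (norm y')\<^sup>2) + 2 * \<bar>h\<bar>\<^sup>2 \<le> R"
      by (simp add: bracket_norm2_param_bracket gramT_def power2_norm_eq_inner)
    have "t \<le> 1 + R" if "t\<^sup>2 \<le> R" for t
    proof -
      have "0 \<le> (t - 1)\<^sup>2"
        by simp
      then have "2 * t \<le> 1 + R"
        using that by (simp add: power2_diff)
      moreover have "0 \<le> R"
        using that zero_le_power2[of t] by (rule order_trans[rotated])
      ultimately show ?thesis
        by simp
    qed
    moreover have "(norm x)\<^sup>2 \<le> R" "(norm x')\<^sup>2 \<le> R" "(norm y)\<^sup>2 \<le> R" "(norm y')\<^sup>2 \<le> R" "\<bar>h\<bar>\<^sup>2 \<le> R"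
      using R zero_le_power2[of "norm x"] zero_le_power2[of "norm x'"] zero_le_power2[of "norm y"]
        zero_le_power2[of "norm y'"] zero_le_power2[of "\<bar>h\<bar>"] by argo+
    ultimately show "m \<in> cball 0 (1 + R) \<times> cball 0 (1 + R) \<times> cball 0 (1 + R) \<times> cball 0 (1 + R) \<times> cball 0 (1 + R)"
      by (simp add: m)
  qed
  show "bounded (cball (0 :: real ^ 3) (1 + R) \<times> cball (0 :: real ^ 3) (1 + R) \<times> cball (0 :: real ^ 3) (1 + R)
      \<times> cball (0 :: real ^ 3) (1 + R) \<times> cball (0 :: real) (1 + R))"
    by (intro bounded_Times bounded_cball)
qed

section \<open>Continuity and closedness\<close>

lemma continuous_on_bracket_of:
  fixes B :: "'a :: t2_space \<Rightarrow> ('n :: {card2, linorder}) euc \<Rightarrow> 'n euc \<Rightarrow> 'n euc"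
  assumes "\<And>i j. continuous_on S (\<lambda>x. B x (axis i 1) (axis j 1))"
  shows "continuous_on S (\<lambda>x. bracket_of (B x))"
  by (rule continuous_on_blinfun_componentwise)
    (auto simp: bracket_of_apply intro!: continuous_intros assms)

lemma continuous_on_vec6 [continuous_intros]:
  fixes a :: "'a :: t2_space \<Rightarrow> real"
  assumes "continuous_on S a" "continuous_on S b" "continuous_on S c" "continuous_on S d" "continuous_on S e" "continuous_on S f"
  shows "continuous_on S (\<lambda>x. vec6 (a x) (b x) (c x) (d x) (e x) (f x))"
proof -
  have "\<forall>i :: 6. continuous_on S (\<lambda>x. vec6 (a x) (b x) (c x) (d x) (e x) (f x) $ i)"
    unfolding forall_6 using assms by simp
  then show ?thesis
    by (subst continuous_on_componentwise) (auto simp: Basis_vec_def inner_axis)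
qed

lemma continuous_on_vec9 [continuous_intros]:
  fixes a :: "'a :: t2_space \<Rightarrow> real"
  assumes "continuous_on S a" "continuous_on S b" "continuous_on S c" "continuous_on S d" "continuous_on S e" "continuous_on S f"
    "continuous_on S g" "continuous_on S h"
  shows "continuous_on S (\<lambda>x. vec9 (a x) (b x) (c x) (d x) (e x) (f x) (g x) (h x))"
proof -
  have "\<forall>i :: 9. continuous_on S (\<lambda>x. vec9 (a x) (b x) (c x) (d x) (e x) (f x) (g x) (h x) $ i)"
    unfolding forall_9 using assms by simp
  then show ?thesis
    by (subst continuous_on_componentwise) (auto simp: Basis_vec_def inner_axis)
qed

lemma continuous_on_param_form [continuous_intros]:
  fixes m :: "'a :: t2_space \<Rightarrow> param"
  assumes "continuous_on S m" "continuous_on S u" "continuous_on S v"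
  shows "continuous_on S (\<lambda>x. param_form (m x) (u x) (v x))"
  unfolding param_form_def case_prod_beta sform_def by (intro continuous_intros assms)

lemma continuous_on_param_bracket: "continuous_on S param_bracket"
  unfolding param_bracket_def[abs_def] by (intro continuous_on_bracket_of continuous_intros)

lemma continuous_on_coords: "continuous_on S coords"
  unfolding coords_def pl_coords_def Let_def case_prod_beta gramC_def gramT_def Complex_eq
  by (intro continuous_intros) simp_all

lemma closed_nil_brackets: "closed (nil_brackets :: 6 bracket set)"
proof -
  have w: "continuous_on UNIV (\<lambda>c. f c \<and>\<^sub>\<Lambda> g c)" if "continuous_on UNIV f" "continuous_on UNIV g"
    for f g :: "6 bracket \<Rightarrow> 6 euc"
    using that unfolding wedge_def case_prod_beta by (intro continuous_intros continuous_on_vec_lambda)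
  show ?thesis
    unfolding nil_brackets_def by (intro closed_Collect_all closed_Collect_eq w continuous_intros)
qed

lemma closed_normal_params: "closed normal_params"
proof -
  \<comment> \<open>Both pieces are rewritten as equations and weak inequalities between entries.
    The factor 2 undoes the halved axis entries of \<open>diag_param\<close>.\<close>
  have eq: "normal_params = {m. snd (snd (snd (snd m))) = 0} \<union> {m. fst (snd (snd m)) = fst m \<and> fst (snd (snd (snd m))) = fst (snd m) \<and>
    fst m $ 2 = 0 \<and> fst m $ 3 = 0 \<and> fst (snd m) $ 1 = 0 \<and> fst (snd m) $ 3 = 0 \<and> fst (snd m) $ 2 \<le> fst m $ 1 \<and>
    snd (snd (snd (snd m))) \<le> 2 * fst (snd m) $ 2 \<and> 0 \<le> snd (snd (snd (snd m)))}" (is "_ = ?A \<union> ?B")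
  proof -
    have "{diag_param a b h | a b h. a \<ge> b \<and> b \<ge> h \<and> h \<ge> 0} = ?B"
    proof (intro subset_antisym subsetI)
      fix m assume "m \<in> ?B"
      moreover obtain x x' y y' h where m: "m = (x, x', y, y', h)"
        by (cases m)
      ultimately have *: "y = x" "y' = x'" "x $ 2 = 0" "x $ 3 = 0" "x' $ 1 = 0" "x' $ 3 = 0" "x' $ 2 \<le> x $ 1" "h \<le> 2 * x' $ 2" "0 \<le> h"
        by simp_all
      then have "m = diag_param (2 * x $ 1) (2 * x' $ 2) h"
        by (simp add: m vec_eq_iff forall_3 axis_def)
      with * show "m \<in> {diag_param a b h | a b h. a \<ge> b \<and> b \<ge> h \<and> h \<ge> 0}"
        by fastforce
    qed (auto simp: axis_def)
    moreover have "{(x, x', y, y', h) | x x' y y' h. h = 0} = ?A"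
      by auto
    ultimately show ?thesis
      unfolding normal_params_def by (simp only:)
  qed
  have "closed ?A" "closed ?B"
    by (intro closed_Collect_conj closed_Collect_eq closed_Collect_le continuous_intros)+
  then show ?thesis
    unfolding eq by (rule closed_Un)
qed

lemma closed_param_cone: "closed param_cone"
  unfolding param_cone_def
  by (intro closed_Collect_conj closed_Collect_disj closed_Collect_all closed_Collect_eq closed_Collect_le continuous_intros)

section \<open>The action of the orthogonal group by matrices\<close>

definition orth_act :: "real ^ 6 ^ 6 \<Rightarrow> 6 bracket \<Rightarrow> 6 bracket"
  where "orth_act A c = bracket_of (\<lambda>u v. A *v br c (transpose A *v u) (transpose A *v v))"

lemma br_orth_act: "br (orth_act A c) u v = A *v br c (transpose A *v u) (transpose A *v v)"
  unfolding orth_act_def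
  by (rule br_bracket_of)
    (auto intro!: linearI simp: bilinear_def br_simps matrix_vector_right_distrib matrix_vector_mult_scaleR
      simp del: transpose_matrix_vector)

lemma orthogonal_matrix_cancel:
  fixes A :: "real ^ 'n ^ 'n"
  assumes "orthogonal_matrix A"
  shows "transpose A *v (A *v u) = u" "A *v (transpose A *v u) = u"
  using assms unfolding orthogonal_matrix_def matrix_vector_mul_assoc by simp_all

lemma orth_act_isometry:
  assumes A: "orthogonal_matrix A" and c: "c \<in> nil_brackets"
  shows "(c, orth_act A c) \<in> isometry_rel"
proof (rule isometry_relI[OF c])
  show "orth_act A c \<in> nil_brackets"
    using c by (simp add: nil_brackets_def br_orth_act orthogonal_matrix_cancel[OF A] del: transpose_matrix_vector)
  show "orthogonal_transformation ((*v) A)"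
    using A by (simp add: orthogonal_transformation_matrix)
  show "br (orth_act A c) (A *v u) (A *v v) = A *v br c u v" for u v
    by (simp add: br_orth_act orthogonal_matrix_cancel[OF A] del: transpose_matrix_vector)
qed

lemma isometry_orth_act:
  assumes "(c, d) \<in> isometry_rel"
  obtains A where "orthogonal_matrix A" "d = orth_act A c"
proof -
  obtain T where T: "orthogonal_transformation T" "\<And>u v. br d (T u) (T v) = T (br c u v)"
    using isometry_relE[OF assms] by blast
  define A where "A = matrix T"
  have A: "orthogonal_matrix A"
    using T(1) by (simp add: A_def orthogonal_transformation_matrix)
  have lin: "T u = A *v u" for u
    unfolding A_def by (rule fun_cong[OF matrix_vector_mul(2)[OF orthogonal_transformation_linear[OF T(1)]], symmetric])
  have "br d u v = br (orth_act A c) u v" for u v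
    using T(2)[of "transpose A *v u" "transpose A *v v"] unfolding lin orthogonal_matrix_cancel[OF A] br_orth_act .
  then have "d = orth_act A c"
    by (intro bracket_eqI)
  with A show ?thesis
    by (rule that)
qed

lemma continuous_on_matrix_vector_mult [continuous_intros]:
  fixes A :: "'a :: t2_space \<Rightarrow> real ^ 'n ^ 'm"
  assumes "continuous_on S A" "continuous_on S u"
  shows "continuous_on S (\<lambda>x. A x *v u x)"
  unfolding matrix_vector_mult_def by (intro continuous_on_vec_lambda continuous_intros assms)

lemma continuous_on_transpose [continuous_intros]:
  fixes A :: "'a :: t2_space \<Rightarrow> real ^ 'n ^ 'm"
  assumes "continuous_on S A"
  shows "continuous_on S (\<lambda>x. transpose (A x))"
  unfolding transpose_def by (intro continuous_on_vec_lambda continuous_intros assms)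

text \<open>The reason for acting by matrices: they carry a topology in which the orthogonal group
  is compact, and with the transpose in place of the inverse the action depends polynomially on the
  matrix.\<close>

lemma continuous_on_orth_act_param_bracket: "continuous_on S (\<lambda>(A, m). orth_act A (param_bracket m))"
  unfolding orth_act_def case_prod_beta br_param_bracket by (intro continuous_on_bracket_of continuous_intros)

lemma compact_orthogonal_matrices: "compact {A :: real ^ 'n ^ 'n. orthogonal_matrix A}"
proof -
  have "norm A \<le> real CARD('n)" if "orthogonal_matrix A" for A :: "real ^ 'n ^ 'n"
  proof -
    have "norm (A $ i) = 1" for i
      using that unfolding orthogonal_matrix_orthonormal_rows row_def by (simp add: vec_nth_inverse)
    then have "L2_set (\<lambda>i. norm (A $ i)) UNIV \<le> real CARD('n)"
      using L2_set_le_sum[of UNIV "\<lambda>i. norm (A $ i)"] by simp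
    then show ?thesis
      by (simp add: norm_vec_def)
  qed
  then have "bounded {A :: real ^ 'n ^ 'n. orthogonal_matrix A}"
    unfolding bounded_iff by blast
  moreover have "closed {A :: real ^ 'n ^ 'n. orthogonal_matrix A}"
  proof -
    have "{A :: real ^ 'n ^ 'n. orthogonal_matrix A} = {A. \<forall>u. transpose A *v (A *v u) = u}"
      unfolding orthogonal_matrix matrix_eq matrix_vector_mul_assoc by simp
    moreover have "closed {A :: real ^ 'n ^ 'n. \<forall>u. transpose A *v (A *v u) = u}"
      by (intro closed_Collect_all closed_Collect_eq continuous_intros)
    ultimately show ?thesis
      by simp
  qed
  ultimately show ?thesis
    by (simp add: compact_eq_bounded_closed)
qed

section \<open>The coordinate map on brackets and its fibres\<close>

definition bracket_coords :: "6 bracket \<Rightarrow> real ^ 9"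
  where "bracket_coords c = coords (SOME m. m \<in> normal_params \<and> (c, param_bracket m) \<in> isometry_rel)"

text \<open>Any two normal forms of \<open>c\<close> are related and hence have the same
  coordinates, so the choice in the definition does not matter.\<close>

lemma bracket_coords_eq:
  assumes "m \<in> normal_params" "(c, param_bracket m) \<in> isometry_rel"
  shows "bracket_coords c = coords m"
proof -
  define n where "n = (SOME m. m \<in> normal_params \<and> (c, param_bracket m) \<in> isometry_rel)"
  have n: "n \<in> normal_params \<and> (c, param_bracket n) \<in> isometry_rel"
    unfolding n_def by (rule someI[of _ m]) (use assms in blast)
  then have "(param_bracket n, param_bracket m) \<in> isometry_rel"
    using assms isometry_rel_sym isometry_rel_trans by blast
  then show ?thesis
    using n assms by (simp add: bracket_coords_def n_def[symmetric] param_bracket_rel_iff_coords)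
qed

lemma isometry_rel_iff_bracket_coords: "(c, d) \<in> isometry_rel \<longleftrightarrow> c \<in> nil_brackets \<and> d \<in> nil_brackets \<and> bracket_coords c = bracket_coords d"
proof
  assume cd: "(c, d) \<in> isometry_rel"
  then have "c \<in> nil_brackets" "d \<in> nil_brackets"
    by (auto simp: isometry_rel_def)
  moreover obtain m where "m \<in> normal_params" "(d, param_bracket m) \<in> isometry_rel"
    using normal_params_exists calculation by blast
  moreover have "(c, param_bracket m) \<in> isometry_rel"
    by (rule isometry_rel_trans[OF cd]) fact
  ultimately show "c \<in> nil_brackets \<and> d \<in> nil_brackets \<and> bracket_coords c = bracket_coords d"
    by (simp add: bracket_coords_eq)
next
  assume *: "c \<in> nil_brackets \<and> d \<in> nil_brackets \<and> bracket_coords c = bracket_coords d"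
  then obtain m n where mn: "m \<in> normal_params" "(c, param_bracket m) \<in> isometry_rel" "n \<in> normal_params" "(d, param_bracket n) \<in> isometry_rel"
    using normal_params_exists by metis
  then have "coords m = coords n"
    using * bracket_coords_eq by metis
  then have "(param_bracket m, param_bracket n) \<in> isometry_rel"
    using mn param_bracket_rel_iff_coords by blast
  then show "(c, d) \<in> isometry_rel"
    using mn isometry_rel_sym isometry_rel_trans by blast
qed

lemma bracket_coords_param_bracket: "m \<in> normal_params \<Longrightarrow> bracket_coords (param_bracket m) = coords m"
  using bracket_coords_eq[of m "param_bracket m"] param_bracket_normal_params_nil by (simp add: isometry_rel_iff_bracket_coords)

lemma bracket_coords_image: "bracket_coords ` nil_brackets = param_cone"
proof (intro subset_antisym subsetI)
  fix e assume "e \<in> bracket_coords ` nil_brackets"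
  then obtain c m where "e = bracket_coords c" "m \<in> normal_params" "(c, param_bracket m) \<in> isometry_rel"
    using normal_params_exists by blast
  then show "e \<in> param_cone"
    using coords_in_param_cone by (simp add: bracket_coords_eq)
next
  fix e assume "e \<in> param_cone"
  then obtain m where "m \<in> normal_params" "coords m = e"
    using coords_surj by blast
  then show "e \<in> bracket_coords ` nil_brackets"
    using bracket_coords_param_bracket param_bracket_normal_params_nil by (metis image_eqI)
qed

lemma sum_bracket_coords:
  assumes "c \<in> nil_brackets"
  shows "4 * sum (($) (bracket_coords c)) UNIV = bracket_norm2 c"
proof -
  obtain m where "m \<in> normal_params" "(c, param_bracket m) \<in> isometry_rel"
    using normal_params_exists[OF assms] by blast
  then show ?thesis
    using sum_coords[of m] bracket_norm2_isometry by (simp add: bracket_coords_eq)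
qed

text \<open>Both implications exhibit the set in question as a closed image: \<open>U\<close> as the
  coordinates of normal parameters with bracket in the preimage, and the preimage as the O(6)-orbits
  of normal forms with coordinates in \<open>U\<close>. The second implication is the continuity of
  \<open>bracket_coords\<close>.\<close>

lemma quotient_map_bracket_coords: "quotient_map (top_of_set nil_brackets) (top_of_set param_cone) bracket_coords"
  unfolding quotient_map_closedin
proof (intro conjI allI impI)
  show "bracket_coords ` topspace (top_of_set nil_brackets) = topspace (top_of_set param_cone)"
    by (simp add: bracket_coords_image)
  fix U assume "U \<subseteq> topspace (top_of_set param_cone)"
  then have U: "U \<subseteq> param_cone"
    by simp
  let ?Z = "{c \<in> nil_brackets. bracket_coords c \<in> U}"
  have Z: "{c. c \<in> topspace (top_of_set nil_brackets) \<and> bracket_coords c \<in> U} = ?Z"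
    by simp
  have "closed U" if "closed ?Z"
  proof -
    let ?K = "normal_params \<inter> param_bracket -` ?Z"
    have "U = coords ` ?K"
    proof (intro subset_antisym subsetI)
      fix e assume e: "e \<in> U"
      then obtain m where "m \<in> normal_params" "coords m = e"
        using U coords_surj by blast
      then show "e \<in> coords ` ?K"
        using e by (intro image_eqI[of _ _ m]) (simp_all add: bracket_coords_param_bracket param_bracket_normal_params_nil)
    qed (auto simp: bracket_coords_param_bracket)
    moreover have "closed (coords ` ?K)"
    proof (rule closed_image_proper[OF continuous_on_coords])
      show "closed ?K"
        using continuous_closed_preimage[OF continuous_on_param_bracket closed_normal_params that] .
      fix R :: real
      \<comment> \<open>Nine entries, each at most \<open>R\<close>; the factor 4 is that of
        \<open>sum_coords\<close>.\<close>
      have "bracket_norm2 (param_bracket m) \<le> 4 * (9 * R)" if "norm (coords m) \<le> R" for m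
      proof -
        have "coords m $ i \<le> R" for i
          using component_le_norm_cart[of "coords m" i] that by linarith
        then have "sum (($) (coords m)) UNIV \<le> (\<Sum>i\<in>(UNIV :: 9 set). R)"
          by (intro sum_mono)
        then show ?thesis
          using sum_coords[of m] by simp
      qed
      then have "{m \<in> ?K. norm (coords m) \<le> R} \<subseteq> {m. bracket_norm2 (param_bracket m) \<le> 4 * (9 * R)}"
        by blast
      then show "bounded {m \<in> ?K. norm (coords m) \<le> R}"
        by (rule bounded_subset[OF bounded_bracket_norm2_param_bracket])
    qed
    ultimately show ?thesis
      by simp
  qed
  moreover have "closed ?Z" if "closed U"
  proof -
    let ?K = "{A :: real ^ 6 ^ 6. orthogonal_matrix A} \<times> (normal_params \<inter> coords -` U)"
    let ?f = "\<lambda>(A, m). orth_act A (param_bracket m)"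
    have "?Z = ?f ` ?K"
    proof (intro subset_antisym subsetI)
      fix c assume c: "c \<in> ?Z"
      then obtain m where m: "m \<in> normal_params" "(c, param_bracket m) \<in> isometry_rel"
        using normal_params_exists by blast
      obtain A where "orthogonal_matrix A" "c = orth_act A (param_bracket m)"
        using isometry_orth_act[OF isometry_rel_sym[OF m(2)]] .
      moreover have "coords m \<in> U"
        using c bracket_coords_eq[OF m] by simp
      ultimately show "c \<in> ?f ` ?K"
        using m(1) by (intro image_eqI[of _ _ "(A, m)"]) simp_all
    next
      fix c assume "c \<in> ?f ` ?K"
      then obtain A m where Am: "orthogonal_matrix A" "m \<in> normal_params" "coords m \<in> U" "c = orth_act A (param_bracket m)"
        by auto
      then have "(param_bracket m, c) \<in> isometry_rel"
        using orth_act_isometry param_bracket_normal_params_nil by blast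
      then show "c \<in> ?Z"
        using Am by (simp add: isometry_rel_iff_bracket_coords bracket_coords_param_bracket)
    qed
    moreover have "closed (?f ` ?K)"
    proof (rule closed_image_proper[OF continuous_on_orth_act_param_bracket])
      have "closed (normal_params \<inter> coords -` U)"
        using continuous_closed_preimage[OF continuous_on_coords closed_normal_params that] .
      then show "closed ?K"
        by (intro closed_Times compact_imp_closed[OF compact_orthogonal_matrices])
      fix R :: real
      have "{x \<in> ?K. norm (?f x) \<le> R} \<subseteq> {A :: real ^ 6 ^ 6. orthogonal_matrix A} \<times> {m. bracket_norm2 (param_bracket m) \<le> 36 * R\<^sup>2}"
      proof
        fix x assume x: "x \<in> {x \<in> ?K. norm (?f x) \<le> R}"
        then obtain A m where Am: "x = (A, m)" "orthogonal_matrix A" "m \<in> normal_params" "norm (orth_act A (param_bracket m)) \<le> R"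
          by auto
        \<comment> \<open>Invariance along the orbit turns a bound on the moved bracket into one on
          the parameter, whatever the matrix.\<close>
        have "bracket_norm2 (param_bracket m) = bracket_norm2 (orth_act A (param_bracket m))"
          using Am by (intro bracket_norm2_isometry orth_act_isometry param_bracket_normal_params_nil)
        also have "\<dots> \<le> 36 * (norm (orth_act A (param_bracket m)))\<^sup>2"
          by (rule bracket_norm2_le)
        also have "\<dots> \<le> 36 * R\<^sup>2"
          using Am(4) by (intro mult_left_mono power_mono) simp_all
        finally show "x \<in> {A. orthogonal_matrix A} \<times> {m. bracket_norm2 (param_bracket m) \<le> 36 * R\<^sup>2}"
          using Am by simp
      qed
      then show "bounded {x \<in> ?K. norm (?f x) \<le> R}"
        by (rule bounded_subset[OF bounded_Times[OF compact_imp_bounded[OF compact_orthogonal_matrices] bounded_bracket_norm2_param_bracket]])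
    qed
    ultimately show ?thesis
      by simp
  qed
  ultimately show "closedin (top_of_set nil_brackets) {c. c \<in> topspace (top_of_set nil_brackets) \<and> bracket_coords c \<in> U} = closedin (top_of_set param_cone) U"
    unfolding Z closedin_closed_eq[OF closed_nil_brackets] closedin_closed_eq[OF closed_param_cone] using U by blast
qed

theorem mainTheorem1:
  shows "(\<exists>f. homeomorphic_map (moduli :: 6 bracket set topology)
                (open_cone (moduli0 :: 6 bracket set topology)) f \<and>
              f (isometry_class 0) = cone_peak (moduli0 :: 6 bracket set topology)) \<and>
         (\<exists>\<C> :: (real ^ 9) set set.
              simplicial_complex \<C> \<and> complex_dim \<C> = 4 \<and> contractible (\<Union>\<C>) \<and>
              (moduli0 :: 6 bracket set topology) homeomorphic_space top_of_set (\<Union>\<C>))"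
proof -
  define l where "l e = sum (($) e) UNIV" for e :: "real ^ 9"
  have rel: "(c, d) \<in> isometry_rel \<longleftrightarrow> c \<in> topspace (top_of_set nil_brackets) \<and> d \<in> topspace (top_of_set nil_brackets) \<and> bracket_coords c = bracket_coords d" for c d
    by (simp add: isometry_rel_iff_bracket_coords)
  obtain g where g': "homeomorphic_map (quotient_topology (top_of_set nil_brackets) isometry_rel) (top_of_set param_cone) g"
    "\<And>c. c \<in> topspace (top_of_set nil_brackets) \<Longrightarrow> g (isometry_rel `` {c}) = bracket_coords c"
    "topspace (quotient_topology (top_of_set (nil_brackets :: 6 bracket set)) isometry_rel) = topspace (top_of_set nil_brackets) // isometry_rel"
    by (rule homeomorphic_map_quotient_topology[OF quotient_map_bracket_coords rel]) blast
  have g: "homeomorphic_map (moduli :: 6 bracket set topology) (top_of_set param_cone) g"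
    "\<And>c. c \<in> nil_brackets \<Longrightarrow> g (isometry_class c) = bracket_coords c" "topspace moduli = (nil_brackets :: 6 bracket set) // isometry_rel"
    using g' unfolding moduli_def isometry_class_def by simp_all
  define N1 where "N1 = {c \<in> nil_brackets :: 6 bracket set. trace (matrix (adjoint (blinfun_apply c) \<circ> blinfun_apply c)) = 2}"
  \<comment> \<open>Twice the trace is \<open>bracket_norm2\<close>, which is four times the sum of
    the coordinates; so trace 2 corresponds to the slice \<open>l = 1\<close>.\<close>
  have tr: "trace (matrix (adjoint (blinfun_apply c) \<circ> blinfun_apply c)) = 2 * l (bracket_coords c)" if "c \<in> nil_brackets" for c :: "6 bracket"
    using trace_adjoint_bracket[of c] sum_bracket_coords[OF that] unfolding bracket_norm2_def l_def by linarith
  have N1: "N1 = {c \<in> nil_brackets. l (bracket_coords c) = 1}"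
    unfolding N1_def using tr by auto
  have "g ` (topspace moduli \<inter> isometry_class ` N1) = topspace (top_of_set param_cone) \<inter> {e. l e = 1}"
  proof -
    have "isometry_class ` N1 \<subseteq> topspace moduli"
      unfolding g(3) isometry_class_def N1_def by (auto intro: quotientI)
    then have "g ` (topspace moduli \<inter> isometry_class ` N1) = g ` isometry_class ` N1"
      by (simp add: Int_absorb1)
    also have "\<dots> = bracket_coords ` N1"
      unfolding image_image by (rule image_cong) (auto simp: g(2) N1)
    also have "\<dots> = bracket_coords ` nil_brackets \<inter> {e. l e = 1}"
      unfolding N1 by blast
    finally show ?thesis
      by (simp add: bracket_coords_image)
  qed
  from homeomorphic_map_subtopologies[OF g(1) this]
  have g0: "homeomorphic_map (moduli0 :: 6 bracket set topology) (top_of_set {e \<in> param_cone. l e = 1}) g"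
    unfolding moduli0_def N1_def[symmetric] subtopology_subtopology
    by (simp add: Int_def)
  have l: "linear l"
    unfolding l_def by (auto intro!: linearI simp: sum.distrib sum_distrib_left)
  have scale: "t *\<^sub>R e \<in> param_cone" if "e \<in> param_cone" "0 \<le> t" for e and t :: real
    using that by (auto simp: param_cone_def)
  \<comment> \<open>On nonnegative vectors \<open>l\<close> is the l1 norm.\<close>
  have norm: "norm e \<le> l e" if "e \<in> param_cone" for e
    using norm_le_l1_cart[of e] that by (simp add: l_def param_cone_def)
  have ne: "\<exists>e\<in>param_cone. l e = 1"
    by (rule bexI[of _ "vec9 1 0 0 0 0 0 0 0"]) (simp_all add: l_def sum_9 param_cone_def forall_9)
  let ?M = "moduli0 :: 6 bracket set topology"
  obtain k where k: "homeomorphic_map (open_cone ?M) (top_of_set param_cone) k" "k (cone_peak ?M) = 0"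
    "cone_peak ?M \<in> topspace (open_cone ?M)"
    by (rule homeomorphic_map_open_cone[OF l closed_param_cone scale norm ne g0]) blast+
  obtain k' where k': "homeomorphic_maps (open_cone ?M) (top_of_set param_cone) k k'"
    using k(1) homeomorphic_map_maps by blast
  have "homeomorphic_map (moduli :: 6 bracket set topology) (open_cone ?M) (k' \<circ> g)"
    using g(1) k' homeomorphic_map_compose homeomorphic_maps_map by blast
  moreover have "(k' \<circ> g) (isometry_class 0) = cone_peak ?M"
  proof -
    have "0 = param_bracket (0, 0, 0, 0, 0)"
      by (rule bracket_eqI) (simp add: br_param_bracket param_form_def sform_def vec6_eq_iff)
    moreover have "(0, 0, 0, 0, 0) \<in> normal_params"
      by (simp add: normal_params_def)
    ultimately have "0 \<in> (nil_brackets :: 6 bracket set)" "bracket_coords 0 = coords (0, 0, 0, 0, 0)"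
      using param_bracket_normal_params_nil bracket_coords_param_bracket by metis+
    moreover have "coords (0, 0, 0, 0, 0) = 0"
      by (simp add: coords_def pl_coords_def gramC_def gramT_def vec9_eq_iff Complex_eq)
    ultimately have "g (isometry_class 0) = k (cone_peak ?M)"
      by (simp add: g(2) k(2))
    then show ?thesis
      using k' k(3) by (simp add: homeomorphic_maps_def)
  qed
  moreover have "?M homeomorphic_space top_of_set (\<Union>(axes_hull ` cells))"
    using homeomorphic_map_imp_homeomorphic_space[OF g0] by (simp add: Union_faces l_def)
  ultimately show ?thesis
    using simplicial_complex_faces complex_dim_faces contractible_faces by blast
qed

end
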